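(* Let $F:[0,T]\times\mathbb R^d\to\mathbb R$ and $g:\mathbb R^d\to\mathbb R$ be smooth enough with bounded derivatives (that is, their derivatives up to some sufficiently high order, which is not specified, exist and are bounded). Assume that one of the following two conditions holds: (i) $T$ is sufficiently small; (ii) $d=1$, and either $\partial_{xx}g>0>\partial_{xx}F$, or $\partial_{xx}g<0<\partial_{xx}F$. Then the master equation $$\partial_tV(t,\mu)+\tfrac12\mathbb E\big[\mathrm{tr}(\partial_x\partial_\mu V(t,\mu,\xi))\big]+F\big(t,\mathbb E[\partial_\mu V(t,\mu,\xi)]\big)=0,\quad (t,\mu)\in[0,T)\times\mathcal P_2(\mathbb R^d),\qquad V(T,\mu)=\mathbb E[g(\xi)],$$ where $\xi$ denotes a random variable with law $\mu$, has a classical solution $V\in C^{1,2}(\Theta)$, $\Theta:=[0,T]\times\mathcal P_2(\mathbb R^d)$.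
   Context: $T>0$; $\mathcal P_2(\mathbb R^d)$ is the set of square-integrable probability measures on $\mathbb R^d$, with the 2-Wasserstein distance $\mathcal W_2$; $\mathcal L_\xi$ is the law of $\xi$. Random variables live on a filtered probability space $(\Omega,\mathbb F,\mathbb P)$ rich enough that for every $\mu\in\mathcal P_2(\mathbb R^d)$ there is an $\mathcal F_0$-measurable random variable with law $\mu$. Derivatives: $\partial_tV(t,\mu):=\lim_{\delta\downarrow0}\delta^{-1}[V(t+\delta,\mu)-V(t,\mu)]$. $\partial_\mu V:\Theta\times\mathbb R^d\to\mathbb R^d$ is the $L$-derivative (Lions derivative): with the lift $U(t,\xi):=V(t,\mathcal L_\xi)$ continuously Fréchet differentiable in $\xi\in\mathbb L^2(\mathcal F_t)$, $DU(t,\xi)=\partial_\mu V(t,\mathcal L_\xi,\xi)$. $\partial_x\partial_\mu V$ is the standard derivative of $\partial_\mu V(t,\mu,x)$ in $x$. (These are unique only on the support of $\mu$; a continuous extension to $\mathbb R^d$ is understood.) $\partial_{xx}F$ is the second derivative of $F(t,x)$ in $x$. Function spaces: $C^1_{Lip,b}(\mathcal P_2(\mathbb R^d))$ is the set of $\varphi:\mathcal P_2(\mathbb R^d)\to\mathbb R$ such that $\partial_\mu \varphi$ exists everywhere and $\partial_\mu \varphi:\mathcal P_2(\mathbb R^d)\times\mathbb R^d\to\mathbb R^d$ is bounded and Lipschitz continuous. $C^2_{Lip,b}(\mathcal P_2(\mathbb R^d))$ is the subset of those $\varphi$ such that for each $x\in\mathbb R^d$ all components of $\partial_\mu \varphi(\cdot,x)$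 belong to $C^1_{Lip,b}(\mathcal P_2(\mathbb R^d))$; $\partial_\mu^2\varphi:\mathcal P_2(\mathbb R^d)\times\mathbb R^d\times\mathbb R^d\to\mathbb R^{d\times d}$ is bounded and Lipschitz continuous; and $\partial_x\partial_\mu \varphi:\mathcal P_2(\mathbb R^d)\times\mathbb R^d\to\mathbb R^{d\times d}$ exists and is bounded and Lipschitz continuous. $C^{1,2}(\Theta)$ is the set of $V:\Theta\to\mathbb R$ such that $V(\cdot,\mu)\in C^1([0,T])$ for every $\mu$ and $V(t,\cdot)\in C^2_{Lip,b}(\mathcal P_2(\mathbb R^d))$ for every $t\in[0,T]$. *)

theory Defs
  imports "HOL-Probability.Probability"
begin

section \<open>The Wasserstein space\<close>

definition P2 :: "(real ^ 'n) measure set" where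
  "P2 = {\<mu>. prob_space \<mu> \<and> sets \<mu> = sets borel \<and> integrable \<mu> (\<lambda>x. (norm x)\<^sup>2)}"

definition couplings ::
    "(real ^ 'n) measure \<Rightarrow> (real ^ 'n) measure \<Rightarrow> ((real ^ 'n) \<times> (real ^ 'n)) measure set" where
  "couplings \<mu> \<nu> =
     {\<pi>. sets \<pi> = sets (borel \<Otimes>\<^sub>M borel) \<and> distr \<pi> borel fst = \<mu> \<and> distr \<pi> borel snd = \<nu>}"

definition W2 :: "(real ^ 'n) measure \<Rightarrow> (real ^ 'n) measure \<Rightarrow> real" where
  "W2 \<mu> \<nu> = sqrt (INF \<pi>\<in>couplings \<mu> \<nu>. \<integral>z. (dist (fst z) (snd z))\<^sup>2 \<partial>\<pi>)"


section \<open>Random variables\<close>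

definition filtered_prob_space :: "'w measure \<Rightarrow> (real \<Rightarrow> 'w measure) \<Rightarrow> real \<Rightarrow> bool" where
  "filtered_prob_space M Fil T \<longleftrightarrow>
     prob_space M \<and> (\<forall>t\<in>{0..T}. subalgebra M (Fil t)) \<and>
     (\<forall>s t. 0 \<le> s \<longrightarrow> s \<le> t \<longrightarrow> t \<le> T \<longrightarrow> sets (Fil s) \<subseteq> sets (Fil t))"

definition law :: "'w measure \<Rightarrow> ('w \<Rightarrow> real ^ 'n) \<Rightarrow> (real ^ 'n) measure" where
  "law M \<xi> = distr M borel \<xi>"

definition L2 :: "'w measure \<Rightarrow> ('w \<Rightarrow> real ^ 'n) set" where
  "L2 M = {\<xi> \<in> borel_measurable M. integrable M (\<lambda>\<omega>. (norm (\<xi> \<omega>))\<^sup>2)}"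

definition L2_norm :: "'w measure \<Rightarrow> ('w \<Rightarrow> real ^ 'n) \<Rightarrow> real" where
  "L2_norm M \<xi> = sqrt (\<integral>\<omega>. (norm (\<xi> \<omega>))\<^sup>2 \<partial>M)"


section \<open>Lions derivatives\<close>

text \<open>
  The lift \<open>\<xi> \<mapsto> \<phi> (law M \<xi>)\<close> is continuously Frechet differentiable on the Hilbert space
  \<open>L2 M\<close>, and its derivative at \<open>\<xi>\<close> is (the Riesz representative) \<open>D (law M \<xi>) (\<xi> \<cdot>)\<close>.
  Elements of \<open>L2 M\<close> are functions, not classes modulo null sets; every expression below
  depends only on the class.
\<close>

definition has_L_derivative ::
    "'w measure \<Rightarrow> ((real ^ 'n) measure \<Rightarrow> real)
      \<Rightarrow> ((real ^ 'n) measure \<Rightarrow> real ^ 'n \<Rightarrow> real ^ 'n) \<Rightarrow> bool" where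
  "has_L_derivative M \<phi> D \<longleftrightarrow>
     (\<forall>\<xi>\<in>L2 M.
        (\<lambda>\<omega>. D (law M \<xi>) (\<xi> \<omega>)) \<in> L2 M \<and>
        (\<forall>\<epsilon>>0. \<exists>\<delta>>0. \<forall>\<eta>\<in>L2 M. L2_norm M \<eta> \<le> \<delta> \<longrightarrow>
           \<bar>\<phi> (law M (\<lambda>\<omega>. \<xi> \<omega> + \<eta> \<omega>)) - \<phi> (law M \<xi>) - (\<integral>\<omega>. D (law M \<xi>) (\<xi> \<omega>) \<bullet> \<eta> \<omega> \<partial>M)\<bar>
             \<le> \<epsilon> * L2_norm M \<eta>) \<and>
        (\<forall>\<epsilon>>0. \<exists>\<delta>>0. \<forall>\<zeta>\<in>L2 M. L2_norm M (\<lambda>\<omega>. \<zeta> \<omega> - \<xi> \<omega>) \<le> \<delta> \<longrightarrow>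
           L2_norm M (\<lambda>\<omega>. D (law M \<zeta>) (\<zeta> \<omega>) - D (law M \<xi>) (\<xi> \<omega>)) \<le> \<epsilon>))"

definition bdd_Lip ::
    "((real ^ 'n) measure \<Rightarrow> real ^ 'n \<Rightarrow> 'b::real_normed_vector) \<Rightarrow> bool" where
  "bdd_Lip D \<longleftrightarrow>
     (\<exists>C. \<forall>\<mu>\<in>P2. \<forall>x. norm (D \<mu> x) \<le> C) \<and>
     (\<exists>L. \<forall>\<mu>\<in>P2. \<forall>\<nu>\<in>P2. \<forall>x y. dist (D \<mu> x) (D \<nu> y) \<le> L * (W2 \<mu> \<nu> + dist x y))"

definition bdd_Lip2 ::
    "((real ^ 'n) measure \<Rightarrow> real ^ 'n \<Rightarrow> real ^ 'n \<Rightarrow> 'b::real_normed_vector) \<Rightarrow> bool" where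
  "bdd_Lip2 D \<longleftrightarrow>
     (\<exists>C. \<forall>\<mu>\<in>P2. \<forall>x y. norm (D \<mu> x y) \<le> C) \<and>
     (\<exists>L. \<forall>\<mu>\<in>P2. \<forall>\<nu>\<in>P2. \<forall>x y x' y'.
        dist (D \<mu> x y) (D \<nu> x' y') \<le> L * (W2 \<mu> \<nu> + dist x x' + dist y y'))"

text \<open>
  A function with \<open>has_L_derivative M \<phi> D\<close> is determined only \<open>\<mu>\<close>-almost everywhere; joint
  continuity in \<open>(\<mu>, x)\<close> makes it unique on \<open>P2 \<times> UNIV\<close>, because each \<open>\<mu>\<close> is a limit of
  measures charging a given point.  The derivatives of a function of class C1 or C2 are therefore
  recorded as arguments of the following two predicates.
\<close>

definition C1_Lip_b_deriv ::
    "'w measure \<Rightarrow> ((real ^ 'n) measure \<Rightarrow> real)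
      \<Rightarrow> ((real ^ 'n) measure \<Rightarrow> real ^ 'n \<Rightarrow> real ^ 'n) \<Rightarrow> bool" where
  "C1_Lip_b_deriv M \<phi> D \<longleftrightarrow> has_L_derivative M \<phi> D \<and> bdd_Lip D"

text \<open>
  \<open>D\<close> is the first derivative, \<open>DD \<mu> x y\<close> the second one, whose row \<open>i\<close> is the derivative at
  \<open>(\<mu>, y)\<close> of component \<open>i\<close> of \<open>D (\<cdot>) x\<close>, and \<open>Dx \<mu> x\<close> is the Jacobian matrix of \<open>D \<mu>\<close> at \<open>x\<close>.
\<close>

definition C2_Lip_b_derivs ::
    "'w measure \<Rightarrow> ((real ^ 'n) measure \<Rightarrow> real)
      \<Rightarrow> ((real ^ 'n) measure \<Rightarrow> real ^ 'n \<Rightarrow> real ^ 'n)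
      \<Rightarrow> ((real ^ 'n) measure \<Rightarrow> real ^ 'n \<Rightarrow> real ^ 'n \<Rightarrow> real ^ 'n ^ 'n)
      \<Rightarrow> ((real ^ 'n) measure \<Rightarrow> real ^ 'n \<Rightarrow> real ^ 'n ^ 'n) \<Rightarrow> bool" where
  "C2_Lip_b_derivs M \<phi> D DD Dx \<longleftrightarrow>
     C1_Lip_b_deriv M \<phi> D \<and>
     (\<forall>x i. C1_Lip_b_deriv M (\<lambda>\<mu>. D \<mu> x $ i) (\<lambda>\<mu> y. DD \<mu> x y $ i)) \<and>
     bdd_Lip2 DD \<and>
     (\<forall>\<mu>\<in>P2. \<forall>x. (D \<mu> has_derivative (\<lambda>h. Dx \<mu> x *v h)) (at x)) \<and>
     bdd_Lip Dx"


section \<open>Functions of time and measure\<close>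

text \<open>The derivatives at the end points of the interval are one-sided.\<close>

definition C1_on_interval :: "real \<Rightarrow> (real \<Rightarrow> real) \<Rightarrow> bool" where
  "C1_on_interval T f \<longleftrightarrow>
     (\<exists>f'. continuous_on {0..T} f' \<and>
           (\<forall>t\<in>{0..T}. (f has_real_derivative f' t) (at t within {0..T})))"

definition C12 ::
    "'w measure \<Rightarrow> (real \<Rightarrow> 'w measure) \<Rightarrow> real \<Rightarrow> (real \<Rightarrow> (real ^ 'n) measure \<Rightarrow> real) set" where
  "C12 M Fil T =
     {V. (\<forall>\<mu>\<in>P2. C1_on_interval T (\<lambda>t. V t \<mu>)) \<and>
         (\<forall>t\<in>{0..T}. \<exists>D DD Dx. C2_Lip_b_derivs (restr_to_subalg M (Fil t)) (V t) D DD Dx)}"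

definition time_deriv ::
    "(real \<Rightarrow> (real ^ 'n) measure \<Rightarrow> real) \<Rightarrow> real \<Rightarrow> (real ^ 'n) measure \<Rightarrow> real" where
  "time_deriv V t \<mu> = Lim (at_right 0) (\<lambda>\<delta>. (V (t + \<delta>) \<mu> - V t \<mu>) / \<delta>)"

definition solves_master_equation ::
    "'w measure \<Rightarrow> (real \<Rightarrow> 'w measure) \<Rightarrow> real \<Rightarrow> (real \<Rightarrow> real ^ 'n \<Rightarrow> real)
      \<Rightarrow> (real ^ 'n \<Rightarrow> real) \<Rightarrow> (real \<Rightarrow> (real ^ 'n) measure \<Rightarrow> real) \<Rightarrow> bool" where
  "solves_master_equation M Fil T F g V \<longleftrightarrow>
     (\<forall>t\<in>{0..<T}. \<exists>D DD Dx.
        C2_Lip_b_derivs (restr_to_subalg M (Fil t)) (V t) D DD Dx \<and>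
        (\<forall>\<mu>\<in>P2. \<forall>\<xi>\<in>borel_measurable M. law M \<xi> = \<mu> \<longrightarrow>
           time_deriv V t \<mu> + 1/2 * (\<integral>\<omega>. trace (Dx \<mu> (\<xi> \<omega>)) \<partial>M)
             + F t (\<integral>\<omega>. D \<mu> (\<xi> \<omega>) \<partial>M) = 0)) \<and>
     (\<forall>\<mu>\<in>P2. \<forall>\<xi>\<in>borel_measurable M. law M \<xi> = \<mu> \<longrightarrow> V T \<mu> = (\<integral>\<omega>. g (\<xi> \<omega>) \<partial>M))"


section \<open>Smoothness of the data\<close>

text \<open>
  All partial derivatives of \<open>f\<close> on \<open>S\<close> of orders \<open>1, \<dots>, n\<close> exist, are continuous and are
  bounded by \<open>K\<close>; \<open>f\<close> itself need not be bounded.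
\<close>

primrec bounded_derivs ::
    "nat \<Rightarrow> real \<Rightarrow> 'a::euclidean_space set \<Rightarrow> ('a \<Rightarrow> real) \<Rightarrow> bool" where
  "bounded_derivs 0 K S f \<longleftrightarrow> continuous_on S f"
| "bounded_derivs (Suc n) K S f \<longleftrightarrow>
     (\<exists>D. (\<forall>z\<in>S. (f has_derivative D z) (at z within S)) \<and>
          (\<forall>h\<in>Basis. (\<forall>z\<in>S. \<bar>D z h\<bar> \<le> K) \<and> bounded_derivs n K S (\<lambda>z. D z h)))"

text \<open>
  The second derivative in dimension one: if \<open>CARD('n) = 1\<close> then \<open>vec\<close> is the canonical
  isomorphism from \<open>real\<close> to \<open>real ^ 'n\<close>.
\<close>

definition dxx :: "(real ^ 'n \<Rightarrow> real) \<Rightarrow> real ^ 'n \<Rightarrow> real" where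
  "dxx f x = (deriv ^^ 2) (\<lambda>s. f (x + vec s)) 0"

end

theory Submission imports Defs begin

text \<open>
  Let \<open>u t\<close> be the heat flow \<open>E[g (x + W (T - t))]\<close> of the terminal datum.  Along laws moved by heat
  flow and translation the master equation reduces to the Hamilton-Jacobi equation
  \<open>\<partial>\<^sub>t \<phi> + F (t, \<nabla> \<phi>) = 0\<close> on a Euclidean space.  As \<open>F\<close> does not depend on the
  position, the momentum \<open>p\<close> is constant along characteristics, and the method of characteristics
  gives
  \<open>V (t, \<mu>) = \<integral> u t (x + z) d\<mu> - p \<bullet> z + H t p\<close>, where \<open>H t p = \<integral>\<^sub>t\<^sup>T F (s, p) ds\<close>,
  \<open>z = \<nabla> (H t) p\<close> and \<open>p = \<integral> \<nabla> (u t) (x + z) d\<mu>\<close>.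
  A solution \<open>p\<close> exists by Brouwer's theorem because \<open>\<nabla> (u t)\<close> is bounded.  With
  \<open>\<Psi> p = p - \<integral> \<nabla> (u t) (x + \<nabla> (H t) p) d\<mu>\<close>, the estimate
  \<open>\<bar>p - q\<bar> \<le> 2 \<bar>\<Psi> p - \<Psi> q\<bar>\<close> holds by contraction if \<open>T\<close> is small, and by monotonicity in
  dimension one if the second derivatives of \<open>g\<close> and \<open>F\<close> have opposite signs.  Since \<open>V\<close> is
  stationary in \<open>p\<close> and \<open>z\<close>, its first derivatives are \<open>\<partial>\<^sub>\<mu> V = \<nabla> (u t) (x + z)\<close> and
  \<open>\<partial>\<^sub>t V = - 1/2 \<integral> \<Delta> (u t) (x + z) d\<mu> - F (t, p)\<close>, and \<open>\<integral> \<partial>\<^sub>\<mu> V d\<mu> = p\<close>.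
\<close>

section \<open>Matrices\<close>

text \<open>Everything gets averaged over an arbitrary measure, so differentiability is carried by
  explicit remainder bounds with a common constant instead of by limits. Three derivatives of the
  data suffice: since \<open>V\<close> is a critical value in (p, z), first order changes of p and z
  cancel, and the derivative of the momentum enters only the second derivative of \<open>V\<close>,
  where it is the inverse of a linearised equation. The estimate with factor 2 does the work four
  times: uniqueness of p, Lipschitz dependence on the measure, Lipschitz dependence on time,
  invertibility of the linearisation. A contraction with constant 1/2 gives 2 = 1 / (1 - 1/2). In
  dimension one the averaged gradient of u and the gradient of H are monotone in opposite senses, so
  their composition is nonincreasing, and subtracting it from the identity cannot shorten distances.
  As the Hessian of g is only Lipschitz, its heat flow is controlled in time only to Hoelder order
  1/2. Increments of \<open>V\<close> over a time step h are thus known up to order |h|^(3/2), which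
  is still enough for a continuous time derivative.\<close>

lemma norm_matrix_vector_le:
  fixes A :: "real ^ 'n ^ 'm"
  shows "norm (A *v x) \<le> norm A * norm x"
proof -
  have "norm (A *v x) \<le> L2_set (\<lambda>i. norm (A $ i) * norm x) UNIV"
    unfolding norm_vec_def[of "A *v x"]
    by (rule L2_set_mono) (simp_all add: matrix_vector_mul_component Cauchy_Schwarz_ineq2)
  also have "\<dots> = norm A * norm x"
    unfolding norm_vec_def[of A] by (simp add: L2_set_left_distrib)
  finally show ?thesis .
qed

lemma norm_transpose:
  fixes A :: "real ^ 'n ^ 'm"
  shows "norm (transpose A) = norm A"
  unfolding norm_vec_def L2_set_def transpose_def
  by (simp add: sum_nonneg) (rule sum.swap)

lemma norm_matrix_mult_le:
  fixes A :: "real ^ 'n ^ 'm" and B :: "real ^ 'k ^ 'n"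
  shows "norm (A ** B) \<le> norm A * norm B"
proof -
  have row: "(A ** B) $ i = transpose B *v (A $ i)" for i
    by (simp add: vec_eq_iff matrix_matrix_mult_def matrix_vector_mult_def transpose_def mult.commute)
  have "norm ((A ** B) $ i) \<le> norm (A $ i) * norm B" for i
    unfolding row using norm_matrix_vector_le[of "transpose B" "A $ i"]
    by (simp add: norm_transpose mult.commute)
  then have "norm (A ** B) \<le> L2_set (\<lambda>i. norm (A $ i) * norm B) UNIV"
    unfolding norm_vec_def[of "A ** B"] by (intro L2_set_mono) auto
  also have "\<dots> = norm A * norm B"
    unfolding norm_vec_def[of A] by (simp add: L2_set_left_distrib)
  finally show ?thesis .
qed

text \<open>The norm of a matrix is the Frobenius norm, at most the sum of the norms of the columns,
  and column i is the image of the unit vector \<open>axis i 1\<close>. It converts the operator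
  bound on the inverse \<open>R\<close> into a bound in norm.\<close>

lemma norm_matrix_le_operator_bound:
  fixes B :: "real ^ 'n ^ 'm"
  assumes "\<And>v. norm (B *v v) \<le> c * norm v"
  shows "norm B \<le> real CARD('n) * c"
proof -
  have "norm (transpose B) \<le> (\<Sum>i\<in>UNIV. norm (transpose B $ i))"
    unfolding norm_vec_def[of "transpose B"] by (rule L2_set_le_sum) simp
  also have "\<dots> \<le> (\<Sum>i\<in>(UNIV::'n set). c)"
  proof (rule sum_mono)
    fix i :: 'n
    have "transpose B $ i = B *v axis i 1"
      by (simp add: matrix_vector_mult_basis column_def transpose_def)
    then show "norm (transpose B $ i) \<le> c" using assms[of "axis i 1"] by simp
  qed
  finally show ?thesis by (simp add: norm_transpose)
qed

lemma bounded_linear_matrix_vector_mult_left: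
  "bounded_linear (\<lambda>A :: real ^ 'n ^ 'm. A *v h)"
  by (intro linear_conv_bounded_linear[THEN iffD1] linearI)
     (simp_all add: matrix_vector_mult_add_rdistrib scaleR_matrix_vector_assoc)

lemma bounded_linear_trace: "bounded_linear (trace :: real ^ 'n ^ 'n \<Rightarrow> real)"
  by (intro linear_conv_bounded_linear[THEN iffD1] linearI)
     (simp_all add: trace_def sum.distrib sum_distrib_left)

section \<open>Taylor expansions of second order\<close>

lemma has_derivative_quadratic_remainder:
  fixes f :: "'a::real_normed_vector \<Rightarrow> 'b::real_normed_vector"
  assumes "bounded_linear L" and rem: "\<And>h. norm (f (x + h) - f x - L h) \<le> C * (norm h)\<^sup>2"
  shows "(f has_derivative L) (at x)"
  unfolding has_derivative_at
proof (intro conjI assms(1))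
  have lim: "((\<lambda>h::'a. C * norm h) \<longlongrightarrow> 0) (at 0)"
    by (intro tendsto_mult_right_zero tendsto_norm_zero tendsto_ident_at)
  have "norm (norm (f (x + h) - f x - L h) / norm h) \<le> C * norm h" if "h \<noteq> 0" for h
    using rem[of h] that by (simp add: divide_le_eq power2_eq_square mult.assoc)
  then have "\<forall>\<^sub>F h in at 0. norm (norm (f (x + h) - f x - L h) / norm h) \<le> C * norm h"
    unfolding eventually_at_filter by (intro always_eventually) auto
  then show "(\<lambda>h. norm (f (x + h) - f x - L h) / norm h) \<midarrow>0\<rightarrow> 0"
    by (rule Lim_null_comparison[OF _ lim])
qed

text \<open>
  Remainder bounds, unlike mere differentiability, pass at once to averages over a measure; the
  cubic one yields the heat equation.
\<close>

definition taylor2 ::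
    "real \<Rightarrow> (real ^ 'n \<Rightarrow> real) \<Rightarrow> (real ^ 'n \<Rightarrow> real ^ 'n) \<Rightarrow> (real ^ 'n \<Rightarrow> real ^ 'n ^ 'n) \<Rightarrow> bool"
  where
  "taylor2 C f f1 f2 \<longleftrightarrow>
     (\<forall>x. norm (f1 x) \<le> C \<and> norm (f2 x) \<le> C) \<and>
     (\<forall>x h. \<bar>f (x + h) - f x\<bar> \<le> C * norm h \<and>
        norm (f1 (x + h) - f1 x) \<le> C * norm h \<and>
        norm (f2 (x + h) - f2 x) \<le> C * norm h \<and>
        \<bar>f (x + h) - f x - f1 x \<bullet> h\<bar> \<le> C * (norm h)\<^sup>2 \<and>
        norm (f1 (x + h) - f1 x - f2 x *v h) \<le> C * (norm h)\<^sup>2 \<and>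
        \<bar>f (x + h) - f x - f1 x \<bullet> h - (h \<bullet> (f2 x *v h)) / 2\<bar> \<le> C * norm h ^ 3)"

text \<open>The facts are cited by position: 1 and 2 are bounds, 3 to 5 Lipschitz estimates, 6 and 7
  quadratic remainders, 8 the cubic remainder. The middle ones use an end point y instead of an
  increment.\<close>

lemma taylor2D:
  assumes "taylor2 C f f1 f2"
  shows "norm (f1 x) \<le> C" "norm (f2 x) \<le> C"
    "\<bar>f y - f x\<bar> \<le> C * norm (y - x)"
    "norm (f1 y - f1 x) \<le> C * norm (y - x)"
    "norm (f2 y - f2 x) \<le> C * norm (y - x)"
    "\<bar>f y - f x - f1 x \<bullet> (y - x)\<bar> \<le> C * (norm (y - x))\<^sup>2"
    "norm (f1 y - f1 x - f2 x *v (y - x)) \<le> C * (norm (y - x))\<^sup>2"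
    "\<bar>f (x + h) - f x - f1 x \<bullet> h - (h \<bullet> (f2 x *v h)) / 2\<bar> \<le> C * norm h ^ 3"
  using assms[unfolded taylor2_def, THEN conjunct1, rule_format, of x]
    assms[unfolded taylor2_def, THEN conjunct2, rule_format, of x "y - x"]
    assms[unfolded taylor2_def, THEN conjunct2, rule_format, of x h]
  by auto

lemma taylor2_nonneg: "taylor2 C f f1 f2 \<Longrightarrow> 0 \<le> C"
  using taylor2D(1) norm_ge_zero order_trans by blast

lemma taylor2_mono:
  assumes "taylor2 C f f1 f2" "C \<le> C'"
  shows "taylor2 C' f f1 f2"
  using assms unfolding taylor2_def
  by (meson mult_right_mono norm_ge_zero order_trans zero_le_power2 zero_le_power)

lemma taylor2_has_derivative:
  assumes "taylor2 C f f1 f2"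
  shows "(f has_derivative (\<lambda>h. f1 x \<bullet> h)) (at x)"
    and "(f1 has_derivative (\<lambda>h. f2 x *v h)) (at x)"
proof -
  show "(f has_derivative (\<lambda>h. f1 x \<bullet> h)) (at x)"
    by (rule has_derivative_quadratic_remainder[where C=C])
       (use taylor2D(6)[OF assms, of "x + h" x for h] in \<open>auto simp: bounded_linear_inner_right\<close>)
  show "(f1 has_derivative (\<lambda>h. f2 x *v h)) (at x)"
    by (rule has_derivative_quadratic_remainder[where C=C])
       (use taylor2D(7)[OF assms, of "x + h" x for h] in auto)
qed

text \<open>Bounded derivatives give the Lipschitz clauses, and Lipschitz derivatives the quadratic
  remainders, by the mean value inequality on a segment. Factors such as 1/2 are given away so that
  a single constant \<open>C\<close> serves all clauses.\<close>

lemma taylor2I: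
  fixes f :: "real ^ 'n \<Rightarrow> real"
  assumes D1: "\<And>x. (f has_derivative (\<lambda>h. f1 x \<bullet> h)) (at x)"
    and D2: "\<And>x. (f1 has_derivative (\<lambda>h. f2 x *v h)) (at x)"
    and B1: "\<And>x. norm (f1 x) \<le> C" and B2: "\<And>x. norm (f2 x) \<le> C"
    and L2: "\<And>x y. norm (f2 x - f2 y) \<le> C * norm (x - y)"
  shows "taylor2 C f f1 f2"
  unfolding taylor2_def
proof (intro conjI allI B1 B2)
  fix x h :: "real ^ 'n"
  have C: "0 \<le> C" using B1[of x] norm_ge_zero order_trans by blast
  have on1: "onorm (\<lambda>h. f1 y \<bullet> h - f1 z \<bullet> h) \<le> norm (f1 y - f1 z)" for y z
    by (rule onorm_bound) (auto simp: inner_diff_left[symmetric] Cauchy_Schwarz_ineq2)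
  have on2: "onorm (\<lambda>h. f2 y *v h - f2 z *v h) \<le> norm (f2 y - f2 z)" for y z
    by (rule onorm_bound) (auto simp: matrix_vector_mult_diff_rdistrib[symmetric] norm_matrix_vector_le)
  have lipf: "\<bar>f b - f a\<bar> \<le> C * norm (b - a)" for a b
  proof -
    have "norm (f b - f a) \<le> C * norm (b - a)"
    proof (rule differentiable_bound[where S=UNIV and f'="\<lambda>y h. f1 y \<bullet> h"])
      fix y show "(f has_derivative (\<lambda>h. f1 y \<bullet> h)) (at y within UNIV)" using D1 by simp
      show "onorm ((\<bullet>) (f1 y)) \<le> C"
        by (rule onorm_bound[OF C]) (metis B1 Cauchy_Schwarz_ineq2 mult_right_mono norm_ge_zero order_trans real_norm_def)
    qed auto
    then show ?thesis by simp
  qed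
  then show "\<bar>f (x + h) - f x\<bar> \<le> C * norm h" by (metis add_diff_cancel_left')
  have lip1: "norm (f1 b - f1 a) \<le> C * norm (b - a)" for a b
  proof (rule differentiable_bound[where S=UNIV and f'="\<lambda>y h. f2 y *v h"])
    fix y show "(f1 has_derivative (\<lambda>h. f2 y *v h)) (at y within UNIV)" using D2 by simp
    show "onorm ((*v) (f2 y)) \<le> C"
      by (rule onorm_bound[OF C]) (metis B2 norm_matrix_vector_le mult_right_mono norm_ge_zero order_trans)
  qed auto
  then show "norm (f1 (x + h) - f1 x) \<le> C * norm h" by (metis add_diff_cancel_left')
  show "norm (f2 (x + h) - f2 x) \<le> C * norm h" using L2[of "x + h" x] by simp
  have seg: "norm (y - a) \<le> norm k" if "y \<in> closed_segment a (a + k)" for a k y :: "real ^ 'n"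
    using segment_bound(1)[OF that] by simp
  have in_seg: "a + t *\<^sub>R (a + k - a) \<in> closed_segment a (a + k)" if "t \<in> {0..1}" for a k :: "real ^ 'n" and t
    using that unfolding in_segment by (intro exI[of _ t]) (simp add: algebra_simps)
  have "norm (f (x + h) - f x - f1 x \<bullet> (x + h - x)) \<le> norm (x + h - x) * (C * norm h)"
  proof (rule differentiable_bound_linearization[where S="closed_segment x (x + h)" and f'="\<lambda>y h. f1 y \<bullet> h"])
    fix y assume y: "y \<in> closed_segment x (x + h)"
    show "(f has_derivative (\<lambda>h. f1 y \<bullet> h)) (at y within closed_segment x (x + h))"
      using D1 has_derivative_at_withinI by blast
    have "norm (f1 y - f1 x) \<le> C * norm h"
      using lip1[of y x] seg[OF y] C by (meson mult_left_mono order_trans)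
    then show "onorm ((\<bullet>) (f1 y) - (\<bullet>) (f1 x)) \<le> C * norm h"
      using on1[of y x] unfolding fun_diff_def by linarith
  qed (use in_seg in auto)
  then show "\<bar>f (x + h) - f x - f1 x \<bullet> h\<bar> \<le> C * (norm h)\<^sup>2"
    by (simp add: power2_eq_square algebra_simps)
  have q1: "norm (f1 (a + k) - f1 a - f2 a *v k) \<le> C * (norm k)\<^sup>2" for a k
  proof -
    have "norm (f1 (a + k) - f1 a - f2 a *v (a + k - a)) \<le> norm (a + k - a) * (C * norm k)"
    proof (rule differentiable_bound_linearization[where S="closed_segment a (a + k)" and f'="\<lambda>y h. f2 y *v h"])
      fix y assume y: "y \<in> closed_segment a (a + k)"
      show "(f1 has_derivative (\<lambda>h. f2 y *v h)) (at y within closed_segment a (a + k))"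
        using D2 has_derivative_at_withinI by blast
      have "norm (f2 y - f2 a) \<le> C * norm k"
        using L2[of y a] seg[OF y] C by (meson mult_left_mono order_trans)
      then show "onorm ((*v) (f2 y) - (*v) (f2 a)) \<le> C * norm k"
        using on2[of y a] unfolding fun_diff_def by linarith
    qed (use in_seg in auto)
    then show ?thesis by (simp add: power2_eq_square algebra_simps)
  qed
  then show "norm (f1 (x + h) - f1 x - f2 x *v h) \<le> C * (norm h)\<^sup>2" .
  \<comment> \<open>The second order Taylor remainder along the segment. Its derivative is the
    remainder of \<open>f1\<close> at the increment s h, paired with h; so one mean value step
    together with \<open>q1\<close> gives the cubic bound.\<close>
  define \<psi> where "\<psi> s = f (x + s *\<^sub>R h) - f x - s * (f1 x \<bullet> h) - s\<^sup>2 * (h \<bullet> (f2 x *v h)) / 2" for s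
  have d\<psi>: "(\<psi> has_real_derivative (f1 (x + s *\<^sub>R h) - f1 x - f2 x *v (s *\<^sub>R h)) \<bullet> h) (at s)" for s
  proof -
    have "((\<lambda>s. x + s *\<^sub>R h) has_derivative (\<lambda>r. r *\<^sub>R h)) (at s)"
      by (auto intro!: derivative_eq_intros)
    from has_derivative_compose[OF this D1]
    have "((\<lambda>s. f (x + s *\<^sub>R h)) has_real_derivative f1 (x + s *\<^sub>R h) \<bullet> h) (at s)"
      by (simp add: has_field_derivative_def mult.commute[of _ "f1 _ \<bullet> h"])
    then show ?thesis unfolding \<psi>_def
      by (auto intro!: derivative_eq_intros simp: algebra_simps matrix_vector_mult_scaleR inner_commute)
  qed
  obtain s where s: "0 < s" "s < 1" "\<psi> 1 - \<psi> 0 = (1 - 0) * ((f1 (x + s *\<^sub>R h) - f1 x - f2 x *v (s *\<^sub>R h)) \<bullet> h)"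
    using MVT2[of 0 1 \<psi> "\<lambda>s. (f1 (x + s *\<^sub>R h) - f1 x - f2 x *v (s *\<^sub>R h)) \<bullet> h"] d\<psi> by auto
  have "\<bar>\<psi> 1 - \<psi> 0\<bar> \<le> norm (f1 (x + s *\<^sub>R h) - f1 x - f2 x *v (s *\<^sub>R h)) * norm h"
    using s(3) Cauchy_Schwarz_ineq2 by simp
  also have "\<dots> \<le> C * (norm (s *\<^sub>R h))\<^sup>2 * norm h"
    by (intro mult_right_mono q1) auto
  also have "\<dots> \<le> C * (norm h)\<^sup>2 * norm h"
    using s C by (intro mult_right_mono mult_left_mono power_mono) (auto simp: mult_left_le_one_le)
  finally show "\<bar>f (x + h) - f x - f1 x \<bullet> h - (h \<bullet> (f2 x *v h)) / 2\<bar> \<le> C * norm h ^ 3"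
    by (simp add: \<psi>_def power2_eq_square power3_eq_cube mult.assoc)
qed

lemma (in finite_measure) norm_integral_le_bound:
  fixes k :: "'a \<Rightarrow> 'b::{banach, second_countable_topology}"
  assumes "integrable M k" "\<And>w. w \<in> space M \<Longrightarrow> norm (k w) \<le> B"
  shows "norm (\<integral>w. k w \<partial>M) \<le> B * measure M (space M)"
proof -
  have "norm (\<integral>w. k w \<partial>M) \<le> (\<integral>w. B \<partial>M)"
    using assms by (intro order_trans[OF integral_norm_bound integral_mono]) auto
  then show ?thesis by (simp add: mult.commute)
qed

text \<open>Each clause of \<open>taylor2\<close> is a norm bound on an expression linear in the
  three functions, so it can be integrated, and the total mass multiplies the constant. The mass is
  one for laws, and the length of the interval for integrals in time; the latter makes the
  integrated Hamiltonian small for small times.\<close>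

lemma taylor2_integral:
  fixes f2 :: "'w \<Rightarrow> real ^ 'n \<Rightarrow> real ^ 'n ^ 'n"
  assumes "finite_measure M"
    and t: "\<And>w. w \<in> space M \<Longrightarrow> taylor2 C (f w) (f1 w) (f2 w)"
    and i: "\<And>x. integrable M (\<lambda>w. f w x)" "\<And>x. integrable M (\<lambda>w. f1 w x)"
      "\<And>x. integrable M (\<lambda>w. f2 w x)"
  shows "taylor2 (C * measure M (space M)) (\<lambda>x. \<integral>w. f w x \<partial>M) (\<lambda>x. \<integral>w. f1 w x \<partial>M) (\<lambda>x. \<integral>w. f2 w x \<partial>M)"
proof -
  interpret finite_measure M by fact
  note mv = integrable_bounded_linear[OF bounded_linear_matrix_vector_mult_left i(3)]
    and mvi = integral_bounded_linear[OF bounded_linear_matrix_vector_mult_left i(3), symmetric]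
  note N = norm_integral_le_bound
  show ?thesis
    unfolding taylor2_def
  proof (intro conjI allI)
    fix x h :: "real ^ 'n"
    note D = taylor2D(3-7)[OF t, of _ "x + h" x]
    show "norm (\<integral>w. f1 w x \<partial>M) \<le> C * measure M (space M)"
      "norm (\<integral>w. f2 w x \<partial>M) \<le> C * measure M (space M)"
      by (rule N; use i taylor2D(1,2)[OF t] in auto)+
    have "\<bar>\<integral>w. f w (x + h) - f w x \<partial>M\<bar> \<le> C * norm h * measure M (space M)"
      using N[of "\<lambda>w. f w (x + h) - f w x" "C * norm h"] i D(1) by simp
    then show "\<bar>(\<integral>w. f w (x + h) \<partial>M) - (\<integral>w. f w x \<partial>M)\<bar> \<le> C * measure M (space M) * norm h"
      using i by (simp add: algebra_simps)
    have "norm (\<integral>w. f1 w (x + h) - f1 w x \<partial>M) \<le> C * norm h * measure M (space M)"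
      using N[of "\<lambda>w. f1 w (x + h) - f1 w x" "C * norm h"] i D(2) by simp
    then show "norm ((\<integral>w. f1 w (x + h) \<partial>M) - (\<integral>w. f1 w x \<partial>M)) \<le> C * measure M (space M) * norm h"
      using i by (simp add: algebra_simps)
    have "norm (\<integral>w. f2 w (x + h) - f2 w x \<partial>M) \<le> C * norm h * measure M (space M)"
      using N[of "\<lambda>w. f2 w (x + h) - f2 w x" "C * norm h"] i D(3) by simp
    then show "norm ((\<integral>w. f2 w (x + h) \<partial>M) - (\<integral>w. f2 w x \<partial>M)) \<le> C * measure M (space M) * norm h"
      using i by (simp add: algebra_simps)
    have "\<bar>\<integral>w. f w (x + h) - f w x - f1 w x \<bullet> h \<partial>M\<bar> \<le> C * (norm h)\<^sup>2 * measure M (space M)"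
      using N[of "\<lambda>w. f w (x + h) - f w x - f1 w x \<bullet> h" "C * (norm h)\<^sup>2"] i D(4) by simp
    then show "\<bar>(\<integral>w. f w (x + h) \<partial>M) - (\<integral>w. f w x \<partial>M) - (\<integral>w. f1 w x \<partial>M) \<bullet> h\<bar>
        \<le> C * measure M (space M) * (norm h)\<^sup>2"
      using i by (simp add: algebra_simps)
    have "norm (\<integral>w. f1 w (x + h) - f1 w x - f2 w x *v h \<partial>M) \<le> C * (norm h)\<^sup>2 * measure M (space M)"
      using N[of "\<lambda>w. f1 w (x + h) - f1 w x - f2 w x *v h" "C * (norm h)\<^sup>2"] i D(5) mv by simp
    then show "norm ((\<integral>w. f1 w (x + h) \<partial>M) - (\<integral>w. f1 w x \<partial>M) - (\<integral>w. f2 w x \<partial>M) *v h)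
        \<le> C * measure M (space M) * (norm h)\<^sup>2"
      using i mv by (simp add: mvi algebra_simps)
    have "\<bar>\<integral>w. f w (x + h) - f w x - f1 w x \<bullet> h - (h \<bullet> (f2 w x *v h)) / 2 \<partial>M\<bar>
        \<le> C * norm h ^ 3 * measure M (space M)"
      using N[of "\<lambda>w. f w (x + h) - f w x - f1 w x \<bullet> h - (h \<bullet> (f2 w x *v h)) / 2" "C * norm h ^ 3"]
        i taylor2D(8)[OF t, of _ x h] mv by simp
    then show "\<bar>(\<integral>w. f w (x + h) \<partial>M) - (\<integral>w. f w x \<partial>M) - (\<integral>w. f1 w x \<partial>M) \<bullet> h
          - (h \<bullet> ((\<integral>w. f2 w x \<partial>M) *v h)) / 2\<bar> \<le> C * measure M (space M) * norm h ^ 3"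
      using i mv by (simp add: mvi algebra_simps)
  qed
qed

section \<open>Square integrable random variables\<close>

lemma (in prob_space) expectation_le_sqrt_second_moment:
  fixes X :: "'a \<Rightarrow> real"
  assumes "integrable M X" "integrable M (\<lambda>w. (X w)\<^sup>2)"
  shows "expectation X \<le> sqrt (expectation (\<lambda>w. (X w)\<^sup>2))"
proof -
  have "0 \<le> variance X" by (rule variance_positive)
  then have "(expectation X)\<^sup>2 \<le> expectation (\<lambda>w. (X w)\<^sup>2)" using variance_eq[OF assms] by simp
  then show ?thesis by (rule real_le_rsqrt)
qed

lemma le_one_plus_square: "x \<le> 1 + x\<^sup>2" for x :: real
proof -
  have "0 \<le> (x - 1/2)\<^sup>2" by simp
  then show ?thesis by (simp add: power2_eq_square algebra_simps)
qed

lemma square_add_le: "(a + b)\<^sup>2 \<le> 2 * a\<^sup>2 + 2 * b\<^sup>2" for a b :: real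
  using sum_squares_bound[of a b] by (simp add: power2_sum)

lemma lipschitz_imp_borel_measurable:
  fixes f :: "'a::{second_countable_topology, real_normed_vector} \<Rightarrow> 'b::real_normed_vector"
  assumes "\<And>x y. norm (f x - f y) \<le> C * norm (x - y)"
  shows "continuous_on UNIV f" "f \<in> borel_measurable borel"
proof -
  have "\<bar>C\<bar>-lipschitz_on UNIV f"
    using assms by (intro lipschitz_onI) (auto simp: dist_norm intro: order_trans[OF _ mult_right_mono[OF abs_ge_self]])
  then show "continuous_on UNIV f" by (rule lipschitz_on_continuous_on)
  then show "f \<in> borel_measurable borel" by (rule borel_measurable_continuous_onI)
qed

lemma P2D:
  assumes "\<mu> \<in> P2"
  shows "prob_space \<mu>" "sets \<mu> = sets borel" "space \<mu> = UNIV" "integrable \<mu> (\<lambda>x. (norm x)\<^sup>2)"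
  using assms sets_eq_imp_space_eq[of \<mu> borel] by (auto simp: P2_def)

lemma L2D:
  assumes "\<xi> \<in> L2 M"
  shows "\<xi> \<in> borel_measurable M" "integrable M (\<lambda>w. (norm (\<xi> w))\<^sup>2)"
  using assms by (auto simp: L2_def)

lemma (in finite_measure) L2_integrable:
  assumes "\<xi> \<in> L2 M"
  shows "integrable M \<xi>" "integrable M (\<lambda>w. norm (\<xi> w))"
proof -
  note [measurable] = L2D(1)[OF assms]
  show "integrable M (\<lambda>w. norm (\<xi> w))"
    by (rule Bochner_Integration.integrable_bound[of _ "\<lambda>w. 1 + (norm (\<xi> w))\<^sup>2"])
      (use L2D(2)[OF assms] le_one_plus_square in auto)
  then show "integrable M \<xi>" by (simp add: integrable_norm_iff)
qed

lemma L2_add: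
  assumes "\<xi> \<in> L2 M" "\<eta> \<in> L2 M"
  shows "(\<lambda>w. \<xi> w + \<eta> w) \<in> L2 M"
proof -
  note [measurable] = L2D(1)[OF assms(1)] L2D(1)[OF assms(2)]
  have "integrable M (\<lambda>w. (norm (\<xi> w + \<eta> w))\<^sup>2)"
  proof (rule Bochner_Integration.integrable_bound)
    show "integrable M (\<lambda>w. 2 * (norm (\<xi> w))\<^sup>2 + 2 * (norm (\<eta> w))\<^sup>2)"
      using L2D(2)[OF assms(1)] L2D(2)[OF assms(2)] by auto
    show "AE w in M. norm ((norm (\<xi> w + \<eta> w))\<^sup>2) \<le> norm (2 * (norm (\<xi> w))\<^sup>2 + 2 * (norm (\<eta> w))\<^sup>2)"
      by (auto intro!: AE_I2 order_trans[OF power_mono[OF norm_triangle_ineq] square_add_le])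
  qed simp
  then show ?thesis by (simp add: L2_def)
qed

lemma (in finite_measure) L2_bounded:
  assumes [measurable]: "\<xi> \<in> borel_measurable M" and "\<And>w. norm (\<xi> w) \<le> C"
  shows "\<xi> \<in> L2 M"
proof -
  have "integrable M (\<lambda>w. (norm (\<xi> w))\<^sup>2)"
    by (rule integrable_const_bound[where B="C\<^sup>2"]) (use assms(2) in \<open>auto intro!: power_mono\<close>)
  then show ?thesis by (simp add: L2_def)
qed

lemma (in finite_measure) L2_const: "(\<lambda>w. c) \<in> L2 M"
  by (rule L2_bounded) auto

lemma L2_diff:
  assumes "\<xi> \<in> L2 M" "\<eta> \<in> L2 M"
  shows "(\<lambda>w. \<xi> w - \<eta> w) \<in> L2 M"
proof -
  have "(\<lambda>w. - \<eta> w) \<in> L2 M" using assms(2) by (simp add: L2_def)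
  from L2_add[OF assms(1) this] show ?thesis by simp
qed

lemma L2_norm_nonneg: "0 \<le> L2_norm M \<xi>"
  by (simp add: L2_norm_def)

lemma L2_norm_square: "(L2_norm M \<xi>)\<^sup>2 = (\<integral>w. (norm (\<xi> w))\<^sup>2 \<partial>M)"
  by (simp add: L2_norm_def)

lemma (in prob_space) L1_le_L2_norm:
  assumes "\<xi> \<in> L2 M"
  shows "(\<integral>w. norm (\<xi> w) \<partial>M) \<le> L2_norm M \<xi>"
  unfolding L2_norm_def
  by (rule expectation_le_sqrt_second_moment) (use L2_integrable[OF assms] L2D[OF assms] in auto)

lemma (in prob_space) norm_integral_le_L2_norm:
  fixes k :: "'a \<Rightarrow> 'b::{banach, second_countable_topology}"
  assumes "\<xi> \<in> L2 M" "0 \<le> C" "\<And>w. norm (k w) \<le> C * norm (\<xi> w)"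
  shows "norm (\<integral>w. k w \<partial>M) \<le> C * L2_norm M \<xi>"
proof -
  have "norm (\<integral>w. k w \<partial>M) \<le> (\<integral>w. C * norm (\<xi> w) \<partial>M)"
    using L2_integrable[OF assms(1)] assms
    by (intro order_trans[OF integral_norm_bound integral_mono']) auto
  also have "\<dots> \<le> C * L2_norm M \<xi>"
    using L1_le_L2_norm[OF assms(1)] assms(2) by (simp add: mult_left_mono)
  finally show ?thesis .
qed

lemma law_in_P2:
  assumes "prob_space M" "\<xi> \<in> L2 M"
  shows "law M \<xi> \<in> P2"
proof -
  interpret prob_space M by fact
  show ?thesis
    unfolding P2_def law_def using L2D[OF assms(2)]
    by (simp add: prob_space_distr integrable_distr_eq)
qed

lemma integral_law:
  fixes f :: "real ^ 'n \<Rightarrow> 'b::{banach, second_countable_topology}"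
  assumes "\<xi> \<in> borel_measurable M" "f \<in> borel_measurable borel"
  shows "(\<integral>x. f x \<partial>law M \<xi>) = (\<integral>w. f (\<xi> w) \<partial>M)"
  unfolding law_def by (rule integral_distr) (use assms in auto)

lemma P2_id_in_L2:
  assumes "\<mu> \<in> P2"
  shows "(\<lambda>x. x) \<in> L2 \<mu>" "law \<mu> (\<lambda>x. x) = \<mu>"
proof -
  show "(\<lambda>x. x) \<in> L2 \<mu>" using P2D[OF assms] by (simp add: L2_def)
  show "law \<mu> (\<lambda>x. x) = \<mu>" unfolding law_def using P2D(2)[OF assms] by (intro distr_id2) simp
qed

section \<open>The Wasserstein distance\<close>

text \<open>A coupling is itself a probability space carrying \<open>fst\<close> and
  \<open>snd\<close> as square integrable variables, so estimates for random variables apply to it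
  directly.\<close>

lemma couplingsD:
  assumes "\<pi> \<in> couplings \<mu> \<nu>" "\<mu> \<in> P2" "\<nu> \<in> P2"
  shows "prob_space \<pi>" "fst \<in> L2 \<pi>" "snd \<in> L2 \<pi>" "law \<pi> fst = \<mu>" "law \<pi> snd = \<nu>"
proof -
  have [measurable_cong]: "sets \<pi> = sets (borel \<Otimes>\<^sub>M borel)"
    and d: "distr \<pi> borel fst = \<mu>" "distr \<pi> borel snd = \<nu>"
    using assms(1) by (auto simp: couplings_def)
  have m[measurable]: "fst \<in> borel_measurable \<pi>" "snd \<in> borel_measurable \<pi>" by measurable
  show "prob_space \<pi>" using prob_space_distrD[OF m(1)] d(1) P2D(1)[OF assms(2)] by simp
  show "law \<pi> fst = \<mu>" "law \<pi> snd = \<nu>" using d by (simp_all add: law_def)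
  have "integrable (distr \<pi> borel fst) (\<lambda>x. (norm x)\<^sup>2)" "integrable (distr \<pi> borel snd) (\<lambda>x. (norm x)\<^sup>2)"
    using d P2D(4) assms by auto
  then show "fst \<in> L2 \<pi>" "snd \<in> L2 \<pi>"
    using m by (simp_all add: L2_def integrable_distr_eq)
qed

text \<open>The independent coupling. It shows that the infimum in \<open>W2\<close> is over a
  nonempty set, without which that infimum carries no information.\<close>

lemma pair_measure_in_couplings:
  assumes "\<mu> \<in> P2" "\<nu> \<in> P2"
  shows "\<mu> \<Otimes>\<^sub>M \<nu> \<in> couplings \<mu> \<nu>"
proof -
  interpret m: prob_space \<mu> using P2D(1)[OF assms(1)] .
  interpret n: prob_space \<nu> using P2D(1)[OF assms(2)] .
  have s: "sets \<mu> = sets borel" "sets \<nu> = sets borel" using P2D(2) assms by auto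
  have "distr (\<mu> \<Otimes>\<^sub>M \<nu>) \<nu> snd = \<nu>"
  proof (rule measure_eqI)
    fix A assume "A \<in> sets (distr (\<mu> \<Otimes>\<^sub>M \<nu>) \<nu> snd)"
    then have A: "A \<in> sets \<nu>" by simp
    then have "snd -` A \<inter> space (\<mu> \<Otimes>\<^sub>M \<nu>) = space \<mu> \<times> A"
      using sets.sets_into_space by (auto simp: space_pair_measure)
    then show "emeasure (distr (\<mu> \<Otimes>\<^sub>M \<nu>) \<nu> snd) A = emeasure \<nu> A"
      using A by (simp add: emeasure_distr n.emeasure_pair_measure_Times m.emeasure_space_1)
  qed simp
  moreover have "distr (\<mu> \<Otimes>\<^sub>M \<nu>) borel fst = distr (\<mu> \<Otimes>\<^sub>M \<nu>) \<mu> fst" "distr (\<mu> \<Otimes>\<^sub>M \<nu>) borel snd = distr (\<mu> \<Otimes>\<^sub>M \<nu>) \<nu> snd"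
    using s by (auto intro!: distr_cong)
  ultimately show ?thesis
    unfolding couplings_def using sets_pair_measure_cong[OF s]
    by (simp add: n.distr_pair_fst)
qed

lemma couplings_nonempty: "\<mu> \<in> P2 \<Longrightarrow> \<nu> \<in> P2 \<Longrightarrow> couplings \<mu> \<nu> \<noteq> {}"
  using pair_measure_in_couplings by blast

lemma W2_le_L2_norm:
  assumes "prob_space M" "\<zeta> \<in> L2 M" "\<xi> \<in> L2 M"
  shows "W2 (law M \<zeta>) (law M \<xi>) \<le> L2_norm M (\<lambda>w. \<zeta> w - \<xi> w)"
proof -
  note [measurable] = L2D(1)[OF assms(2)] L2D(1)[OF assms(3)]
  let ?\<pi> = "distr M (borel \<Otimes>\<^sub>M borel) (\<lambda>w. (\<zeta> w, \<xi> w))"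
  have "?\<pi> \<in> couplings (law M \<zeta>) (law M \<xi>)"
    by (simp add: couplings_def law_def distr_distr comp_def)
  then have "(INF \<pi>\<in>couplings (law M \<zeta>) (law M \<xi>). \<integral>z. (dist (fst z) (snd z))\<^sup>2 \<partial>\<pi>)
      \<le> (\<integral>z. (dist (fst z) (snd z))\<^sup>2 \<partial>?\<pi>)"
    by (intro cINF_lower bdd_belowI2[where m=0]) auto
  also have "\<dots> = (\<integral>w. (norm (\<zeta> w - \<xi> w))\<^sup>2 \<partial>M)"
    by (subst integral_distr) (auto simp: dist_norm)
  finally show ?thesis unfolding W2_def L2_norm_def by (rule real_sqrt_le_mono)
qed

lemma W2_nonneg:
  assumes "\<mu> \<in> P2" "\<nu> \<in> P2"
  shows "0 \<le> W2 \<mu> \<nu>"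
  unfolding W2_def using couplings_nonempty[OF assms] by (auto intro!: cINF_greatest)

lemma W2_self_le:
  assumes "\<mu> \<in> P2"
  shows "W2 \<mu> \<mu> \<le> 0"
  using W2_le_L2_norm[OF P2D(1)[OF assms] P2_id_in_L2(1)[OF assms] P2_id_in_L2(1)[OF assms]] P2_id_in_L2(2)[OF assms]
  by (simp add: L2_norm_def)

lemma lipschitz_integrable:
  fixes f :: "real ^ 'n \<Rightarrow> 'b::{banach, second_countable_topology}"
  assumes "prob_space M" "\<xi> \<in> L2 M" and lip: "\<And>x y. norm (f x - f y) \<le> C * norm (x - y)"
  shows "integrable M (\<lambda>w. f (\<xi> w))"
proof (rule Bochner_Integration.integrable_bound)
  interpret prob_space M by fact
  note [measurable] = L2D(1)[OF assms(2)] lipschitz_imp_borel_measurable(2)[OF lip]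
  show "(\<lambda>w. f (\<xi> w)) \<in> borel_measurable M" by measurable
  show "integrable M (\<lambda>w. norm (f 0) + \<bar>C\<bar> * norm (\<xi> w))" using L2_integrable[OF assms(2)] by auto
  have "norm (f x) \<le> norm (f 0) + \<bar>C\<bar> * norm x" for x
    using lip[of x 0] norm_triangle_ineq2[of "f x" "f 0"] mult_right_mono[OF abs_ge_self[of C], of "norm x"] by simp
  then show "AE w in M. norm (f (\<xi> w)) \<le> norm (norm (f 0) + \<bar>C\<bar> * norm (\<xi> w))" by auto
qed

text \<open>For every coupling the difference is the mean of \<open>f (fst z) - f (snd z)\<close>,
  bounded by \<open>C\<close> times the L2 distance of the marginal variables. The infimum in
  \<open>W2\<close> is over squared costs, hence the passage through squares and the division by
  \<open>C\<^sup>2\<close>.\<close>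

lemma norm_integral_diff_le_W2:
  fixes f :: "real ^ 'n \<Rightarrow> 'b::{banach, second_countable_topology}"
  assumes "\<mu> \<in> P2" "\<nu> \<in> P2" and lip: "\<And>x y. norm (f x - f y) \<le> C * norm (x - y)" and C: "0 < C"
  shows "norm ((\<integral>x. f x \<partial>\<mu>) - (\<integral>x. f x \<partial>\<nu>)) \<le> C * W2 \<mu> \<nu>"
proof -
  let ?N = "norm ((\<integral>x. f x \<partial>\<mu>) - (\<integral>x. f x \<partial>\<nu>))"
  have "?N\<^sup>2 / C\<^sup>2 \<le> (INF \<pi>\<in>couplings \<mu> \<nu>. \<integral>z. (dist (fst z) (snd z))\<^sup>2 \<partial>\<pi>)"
  proof (rule cINF_greatest[OF couplings_nonempty[OF assms(1,2)]])
    fix \<pi> assume pi: "\<pi> \<in> couplings \<mu> \<nu>"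
    note c = couplingsD[OF pi assms(1,2)]
    interpret prob_space \<pi> by (rule c(1))
    note meas = lipschitz_imp_borel_measurable(2)[OF lip]
    have "(\<integral>x. f x \<partial>\<mu>) - (\<integral>x. f x \<partial>\<nu>) = (\<integral>z. f (fst z) - f (snd z) \<partial>\<pi>)"
      using integral_law[OF L2D(1)[OF c(2)] meas] integral_law[OF L2D(1)[OF c(3)] meas] c(4,5)
        lipschitz_integrable[OF c(1,2) lip] lipschitz_integrable[OF c(1,3) lip] by simp
    then have "?N \<le> C * L2_norm \<pi> (\<lambda>z. fst z - snd z)"
      using norm_integral_le_L2_norm[OF L2_diff[OF c(2,3)], of C "\<lambda>z. f (fst z) - f (snd z)"] lip C by simp
    then have "?N\<^sup>2 \<le> (C * L2_norm \<pi> (\<lambda>z. fst z - snd z))\<^sup>2" by (intro power_mono) auto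
    also have "\<dots> = C\<^sup>2 * (\<integral>z. (dist (fst z) (snd z))\<^sup>2 \<partial>\<pi>)"
      by (simp add: power_mult_distrib L2_norm_square dist_norm)
    finally show "?N\<^sup>2 / C\<^sup>2 \<le> (\<integral>z. (dist (fst z) (snd z))\<^sup>2 \<partial>\<pi>)"
      using C by (simp add: divide_le_eq mult.commute)
  qed
  then have "sqrt (?N\<^sup>2 / C\<^sup>2) \<le> W2 \<mu> \<nu>" unfolding W2_def by (rule real_sqrt_le_mono)
  then show ?thesis using C by (simp add: real_sqrt_divide divide_le_eq mult.commute)
qed

section \<open>A criterion for Lions differentiability\<close>

lemma bdd_LipD:
  fixes D :: "(real ^ 'n) measure \<Rightarrow> real ^ 'n \<Rightarrow> 'b::real_normed_vector"
  assumes "bdd_Lip D"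
  obtains C where "0 < C" "\<And>\<mu> x. \<mu> \<in> P2 \<Longrightarrow> norm (D \<mu> x) \<le> C"
    "\<And>\<mu> \<nu> x y. \<mu> \<in> P2 \<Longrightarrow> \<nu> \<in> P2 \<Longrightarrow> norm (D \<mu> x - D \<nu> y) \<le> C * (W2 \<mu> \<nu> + norm (x - y))"
    "\<And>\<mu> x y. \<mu> \<in> P2 \<Longrightarrow> norm (D \<mu> x - D \<mu> y) \<le> C * norm (x - y)"
proof -
  obtain A L where A: "\<forall>\<mu>\<in>P2. \<forall>x. norm (D \<mu> x) \<le> A"
    and L: "\<forall>\<mu>\<in>P2. \<forall>\<nu>\<in>P2. \<forall>x y. dist (D \<mu> x) (D \<nu> y) \<le> L * (W2 \<mu> \<nu> + dist x y)"
    using assms unfolding bdd_Lip_def by blast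
  define C where "C = max (max A L) 1"
  have C: "A \<le> C" "L \<le> C" "0 < C" by (auto simp: C_def)
  have 1: "norm (D \<mu> x) \<le> C" if "\<mu> \<in> P2" for \<mu> x using A C(1) that order_trans by blast
  have 2: "norm (D \<mu> x - D \<nu> y) \<le> C * (W2 \<mu> \<nu> + norm (x - y))" if "\<mu> \<in> P2" "\<nu> \<in> P2" for \<mu> \<nu> x y
  proof (rule order_trans)
    show "norm (D \<mu> x - D \<nu> y) \<le> L * (W2 \<mu> \<nu> + norm (x - y))"
      using L that by (simp add: dist_norm)
    show "L * (W2 \<mu> \<nu> + norm (x - y)) \<le> C * (W2 \<mu> \<nu> + norm (x - y))"
      using W2_nonneg[OF that] by (intro mult_right_mono C(2)) auto
  qed
  have 3: "norm (D \<mu> x - D \<mu> y) \<le> C * norm (x - y)" if "\<mu> \<in> P2" for \<mu> x y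
  proof (rule order_trans[OF 2[OF that that]])
    show "C * (W2 \<mu> \<mu> + norm (x - y)) \<le> C * norm (x - y)"
      using W2_self_le[OF that] C(3) by (intro mult_left_mono) auto
  qed
  show thesis using that C(3) 1 2 3 by blast
qed

text \<open>The remainder bound gives Frechet differentiability of the lift. Continuity of the
  derivative comes from \<open>bdd_Lip\<close>, because the distance of two laws is at most the L2
  distance of the variables.\<close>

lemma has_L_derivative_quadratic_remainder:
  fixes D :: "(real ^ 'n) measure \<Rightarrow> real ^ 'n \<Rightarrow> real ^ 'n"
  assumes "prob_space M" "bdd_Lip D"
    and rem: "\<And>\<xi> \<eta>. \<xi> \<in> L2 M \<Longrightarrow> \<eta> \<in> L2 M \<Longrightarrow>
      \<bar>\<phi> (law M (\<lambda>w. \<xi> w + \<eta> w)) - \<phi> (law M \<xi>) - (\<integral>w. D (law M \<xi>) (\<xi> w) \<bullet> \<eta> w \<partial>M)\<bar> \<le> K * (L2_norm M \<eta>)\<^sup>2"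
  shows "has_L_derivative M \<phi> D"
  unfolding has_L_derivative_def
proof (intro ballI conjI allI impI)
  interpret prob_space M by fact
  obtain C where C: "0 < C" "\<And>\<mu> x. \<mu> \<in> P2 \<Longrightarrow> norm (D \<mu> x) \<le> C"
    "\<And>\<mu> \<nu> x y. \<mu> \<in> P2 \<Longrightarrow> \<nu> \<in> P2 \<Longrightarrow> norm (D \<mu> x - D \<nu> y) \<le> C * (W2 \<mu> \<nu> + norm (x - y))"
    "\<And>\<mu> x y. \<mu> \<in> P2 \<Longrightarrow> norm (D \<mu> x - D \<mu> y) \<le> C * norm (x - y)"
    using bdd_LipD[OF assms(2)] by blast
  fix \<xi> :: "_ \<Rightarrow> real ^ 'n" assume xi: "\<xi> \<in> L2 M"
  have DL2: "(\<lambda>w. D (law M \<zeta>) (\<zeta> w)) \<in> L2 M" if "\<zeta> \<in> L2 M" for \<zeta>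
  proof (rule L2_bounded)
    have P: "law M \<zeta> \<in> P2" by (rule law_in_P2) (use assms that in auto)
    note [measurable] = lipschitz_imp_borel_measurable(2)[OF C(4)[OF P]] L2D(1)[OF that]
    show "(\<lambda>w. D (law M \<zeta>) (\<zeta> w)) \<in> borel_measurable M" by measurable
    show "norm (D (law M \<zeta>) (\<zeta> w)) \<le> C" for w by (rule C(2)[OF P])
  qed
  show "(\<lambda>w. D (law M \<xi>) (\<xi> w)) \<in> L2 M" by (rule DL2[OF xi])
  fix \<epsilon> :: real assume e: "0 < \<epsilon>"
  show "\<exists>\<delta>>0. \<forall>\<eta>\<in>L2 M. L2_norm M \<eta> \<le> \<delta> \<longrightarrow>
      \<bar>\<phi> (law M (\<lambda>w. \<xi> w + \<eta> w)) - \<phi> (law M \<xi>) - (\<integral>w. D (law M \<xi>) (\<xi> w) \<bullet> \<eta> w \<partial>M)\<bar> \<le> \<epsilon> * L2_norm M \<eta>"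
  proof (intro exI[of _ "\<epsilon> / (\<bar>K\<bar> + 1)"] conjI ballI impI)
    show "0 < \<epsilon> / (\<bar>K\<bar> + 1)" using e by simp
    fix \<eta> :: "_ \<Rightarrow> real ^ 'n" assume eta: "\<eta> \<in> L2 M" "L2_norm M \<eta> \<le> \<epsilon> / (\<bar>K\<bar> + 1)"
    have "(\<bar>K\<bar> + 1) * L2_norm M \<eta> \<le> \<epsilon>"
      using eta(2) by (simp add: pos_le_divide_eq mult.commute)
    moreover have "K * L2_norm M \<eta> \<le> (\<bar>K\<bar> + 1) * L2_norm M \<eta>"
      by (intro mult_right_mono L2_norm_nonneg) auto
    ultimately have "K * L2_norm M \<eta> * L2_norm M \<eta> \<le> \<epsilon> * L2_norm M \<eta>"
      by (intro mult_right_mono L2_norm_nonneg) auto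
    then show "\<bar>\<phi> (law M (\<lambda>w. \<xi> w + \<eta> w)) - \<phi> (law M \<xi>) - (\<integral>w. D (law M \<xi>) (\<xi> w) \<bullet> \<eta> w \<partial>M)\<bar> \<le> \<epsilon> * L2_norm M \<eta>"
      using rem[OF xi eta(1)] by (simp add: power2_eq_square)
  qed
  show "\<exists>\<delta>>0. \<forall>\<zeta>\<in>L2 M. L2_norm M (\<lambda>w. \<zeta> w - \<xi> w) \<le> \<delta> \<longrightarrow>
      L2_norm M (\<lambda>w. D (law M \<zeta>) (\<zeta> w) - D (law M \<xi>) (\<xi> w)) \<le> \<epsilon>"
  proof (intro exI[of _ "\<epsilon> / (2 * C)"] conjI ballI impI)
    show "0 < \<epsilon> / (2 * C)" using e C by simp
    fix \<zeta> :: "_ \<Rightarrow> real ^ 'n" assume z: "\<zeta> \<in> L2 M" "L2_norm M (\<lambda>w. \<zeta> w - \<xi> w) \<le> \<epsilon> / (2 * C)"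
    let ?d = "L2_norm M (\<lambda>w. \<zeta> w - \<xi> w)"
    have P: "law M \<zeta> \<in> P2" "law M \<xi> \<in> P2" using law_in_P2 assms xi z by auto
    \<comment> \<open>\<open>?d\<close> dominates the distance of the two laws. The mean of the
      right-hand side is at most, in fact equal to, the square of \<open>2 * C * ?d\<close>, which
      explains the radius \<open>\<epsilon> / (2 * C)\<close>.\<close>
    have pw: "(norm (D (law M \<zeta>) (\<zeta> w) - D (law M \<xi>) (\<xi> w)))\<^sup>2 \<le> C\<^sup>2 * (2 * ?d\<^sup>2 + 2 * (norm (\<zeta> w - \<xi> w))\<^sup>2)" for w
    proof -
      have "norm (D (law M \<zeta>) (\<zeta> w) - D (law M \<xi>) (\<xi> w)) \<le> C * (?d + norm (\<zeta> w - \<xi> w))"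
        using W2_le_L2_norm[OF assms(1) z(1) xi] C(1)
        by (intro order_trans[OF C(3)[OF P] mult_left_mono]) auto
      then have "(norm (D (law M \<zeta>) (\<zeta> w) - D (law M \<xi>) (\<xi> w)))\<^sup>2 \<le> (C * (?d + norm (\<zeta> w - \<xi> w)))\<^sup>2"
        by (intro power_mono) auto
      also have "\<dots> \<le> C\<^sup>2 * (2 * ?d\<^sup>2 + 2 * (norm (\<zeta> w - \<xi> w))\<^sup>2)"
        unfolding power_mult_distrib by (intro mult_left_mono square_add_le) auto
      finally show ?thesis .
    qed
    have "(L2_norm M (\<lambda>w. D (law M \<zeta>) (\<zeta> w) - D (law M \<xi>) (\<xi> w)))\<^sup>2
        \<le> (\<integral>w. C\<^sup>2 * (2 * ?d\<^sup>2 + 2 * (norm (\<zeta> w - \<xi> w))\<^sup>2) \<partial>M)"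
      unfolding L2_norm_square[of M "\<lambda>w. D (law M \<zeta>) (\<zeta> w) - D (law M \<xi>) (\<xi> w)"]
    proof (rule integral_mono)
      show "integrable M (\<lambda>w. (norm (D (law M \<zeta>) (\<zeta> w) - D (law M \<xi>) (\<xi> w)))\<^sup>2)"
        by (rule L2D(2)[OF L2_diff[OF DL2[OF z(1)] DL2[OF xi]]])
      show "integrable M (\<lambda>w. C\<^sup>2 * (2 * ?d\<^sup>2 + 2 * (norm (\<zeta> w - \<xi> w))\<^sup>2))"
        using L2D(2)[OF L2_diff[OF z(1) xi]] by simp
    qed (rule pw)
    also have "\<dots> = (2 * C * ?d)\<^sup>2"
      using L2D(2)[OF L2_diff[OF z(1) xi]]
      by (simp add: prob_space L2_norm_square[symmetric] power_mult_distrib)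
    finally have "L2_norm M (\<lambda>w. D (law M \<zeta>) (\<zeta> w) - D (law M \<xi>) (\<xi> w)) \<le> 2 * C * ?d"
      by (rule power2_le_imp_le) (use C(1) L2_norm_nonneg in \<open>auto intro!: mult_nonneg_nonneg\<close>)
    also have "\<dots> \<le> \<epsilon>" using z(2) C(1) by (simp add: pos_le_divide_eq mult.commute)
    finally show "L2_norm M (\<lambda>w. D (law M \<zeta>) (\<zeta> w) - D (law M \<xi>) (\<xi> w)) \<le> \<epsilon>" .
  qed
qed

section \<open>The value function at a fixed time\<close>

lemma bounded_bilinear_matrix_vector_mult:
  "bounded_bilinear ((*v) :: real ^ 'n ^ 'm \<Rightarrow> real ^ 'n \<Rightarrow> real ^ 'm)"
proof
  show "\<exists>K. \<forall>(A :: real ^ 'n ^ 'm) x. norm (A *v x) \<le> norm A * norm x * K"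
    using norm_matrix_vector_le by (intro exI[of _ 1]) auto
qed (simp_all add: matrix_vector_mult_add_rdistrib matrix_vector_right_distrib
      scaleR_matrix_vector_assoc matrix_vector_mult_scaleR)

lemma borel_measurable_matrix_vector_mult[measurable (raw)]:
  fixes A :: "'w \<Rightarrow> real ^ 'n ^ 'm"
  assumes "A \<in> borel_measurable M" "x \<in> borel_measurable M"
  shows "(\<lambda>w. A w *v x w) \<in> borel_measurable M"
  by (rule borel_measurable_continuous_Pair[OF assms])
     (intro bounded_bilinear.continuous_on[OF bounded_bilinear_matrix_vector_mult] continuous_intros)

lemma matrix_sub_ldistrib:
  fixes A :: "real ^ 'n ^ 'm"
  shows "A ** (B - C) = A ** B - A ** C"
  by (simp add: vec_eq_iff matrix_matrix_mult_def right_diff_distrib sum_subtractf)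

lemma matrix_sub_rdistrib:
  fixes C :: "real ^ 'k ^ 'n"
  shows "(A - B) ** C = A ** C - B ** C"
  by (simp add: vec_eq_iff matrix_matrix_mult_def left_diff_distrib sum_subtractf)

lemma bdd_Lip2I:
  assumes "\<And>\<mu> x y. \<mu> \<in> P2 \<Longrightarrow> norm (D \<mu> x y) \<le> B"
    and "\<And>\<mu> \<nu> x y x' y'. \<mu> \<in> P2 \<Longrightarrow> \<nu> \<in> P2 \<Longrightarrow>
      norm (D \<mu> x y - D \<nu> x' y') \<le> L * (W2 \<mu> \<nu> + norm (x - x') + norm (y - y'))"
  shows "bdd_Lip2 D"
  unfolding bdd_Lip2_def dist_norm using assms by blast

lemma bdd_Lip2D:
  fixes D :: "(real ^ 'n) measure \<Rightarrow> real ^ 'n \<Rightarrow> real ^ 'n \<Rightarrow> 'b::real_normed_vector"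
  assumes "bdd_Lip2 D"
  obtains C where "0 \<le> C" "\<And>\<mu> x y. \<mu> \<in> P2 \<Longrightarrow> norm (D \<mu> x y) \<le> C"
    "\<And>\<mu> \<nu> x y x' y'. \<mu> \<in> P2 \<Longrightarrow> \<nu> \<in> P2 \<Longrightarrow>
      norm (D \<mu> x y - D \<nu> x' y') \<le> C * (W2 \<mu> \<nu> + norm (x - x') + norm (y - y'))"
proof -
  obtain A L where A: "\<forall>\<mu>\<in>P2. \<forall>x y. norm (D \<mu> x y) \<le> A"
    and L: "\<forall>\<mu>\<in>P2. \<forall>\<nu>\<in>P2. \<forall>x y x' y'.
        norm (D \<mu> x y - D \<nu> x' y') \<le> L * (W2 \<mu> \<nu> + norm (x - x') + norm (y - y'))"
    using assms unfolding bdd_Lip2_def dist_norm by blast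
  define C where "C = max (max A L) 0"
  have C: "A \<le> C" "L \<le> C" "0 \<le> C" by (auto simp: C_def)
  show thesis
  proof (rule that[OF C(3)])
    show "norm (D \<mu> x y) \<le> C" if "\<mu> \<in> P2" for \<mu> x y
      using A that C(1) order_trans by blast
    show "norm (D \<mu> x y - D \<nu> x' y') \<le> C * (W2 \<mu> \<nu> + norm (x - x') + norm (y - y'))"
      if "\<mu> \<in> P2" "\<nu> \<in> P2" for \<mu> \<nu> x y x' y'
    proof (rule order_trans)
      show "norm (D \<mu> x y - D \<nu> x' y') \<le> L * (W2 \<mu> \<nu> + norm (x - x') + norm (y - y'))"
        using L that by blast
      show "L * (W2 \<mu> \<nu> + norm (x - x') + norm (y - y')) \<le> C * (W2 \<mu> \<nu> + norm (x - x') + norm (y - y'))"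
        using W2_nonneg[OF that] by (intro mult_right_mono C(2)) auto
    qed
  qed
qed

text \<open>The second derivative of the value is a product of four matrices; this reduces its
  regularity to that of the factors.\<close>

lemma bdd_Lip2_matrix_mult:
  fixes P Q :: "(real ^ 'n) measure \<Rightarrow> real ^ 'n \<Rightarrow> real ^ 'n \<Rightarrow> real ^ 'n ^ 'n"
  assumes "bdd_Lip2 P" "bdd_Lip2 Q"
  shows "bdd_Lip2 (\<lambda>\<mu> x y. P \<mu> x y ** Q \<mu> x y)"
proof -
  obtain A where A: "0 \<le> A" "\<And>\<mu> x y. \<mu> \<in> P2 \<Longrightarrow> norm (P \<mu> x y) \<le> A"
    "\<And>\<mu> \<nu> x y x' y'. \<mu> \<in> P2 \<Longrightarrow> \<nu> \<in> P2 \<Longrightarrow>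
      norm (P \<mu> x y - P \<nu> x' y') \<le> A * (W2 \<mu> \<nu> + norm (x - x') + norm (y - y'))"
    using bdd_Lip2D[OF assms(1)] by blast
  obtain B where B: "0 \<le> B" "\<And>\<mu> x y. \<mu> \<in> P2 \<Longrightarrow> norm (Q \<mu> x y) \<le> B"
    "\<And>\<mu> \<nu> x y x' y'. \<mu> \<in> P2 \<Longrightarrow> \<nu> \<in> P2 \<Longrightarrow>
      norm (Q \<mu> x y - Q \<nu> x' y') \<le> B * (W2 \<mu> \<nu> + norm (x - x') + norm (y - y'))"
    using bdd_Lip2D[OF assms(2)] by blast
  show ?thesis
  proof (rule bdd_Lip2I)
    fix \<mu> :: "(real ^ 'n) measure" and x y :: "real ^ 'n" assume m: "\<mu> \<in> P2"
    show "norm (P \<mu> x y ** Q \<mu> x y) \<le> A * B"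
      by (rule order_trans[OF norm_matrix_mult_le mult_mono]) (use A B m in auto)
  next
    fix \<mu> \<nu> :: "(real ^ 'n) measure" and x y x' y' :: "real ^ 'n" assume m: "\<mu> \<in> P2" "\<nu> \<in> P2"
    let ?w = "W2 \<mu> \<nu> + norm (x - x') + norm (y - y')"
    have w: "0 \<le> ?w" using W2_nonneg[OF m] by simp
    have "P \<mu> x y ** Q \<mu> x y - P \<nu> x' y' ** Q \<nu> x' y'
        = (P \<mu> x y - P \<nu> x' y') ** Q \<mu> x y + P \<nu> x' y' ** (Q \<mu> x y - Q \<nu> x' y')"
      by (simp add: matrix_sub_ldistrib matrix_sub_rdistrib)
    also have "norm \<dots> \<le> norm ((P \<mu> x y - P \<nu> x' y') ** Q \<mu> x y) + norm (P \<nu> x' y' ** (Q \<mu> x y - Q \<nu> x' y'))"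
      by (rule norm_triangle_ineq)
    also have "\<dots> \<le> (A * ?w) * B + A * (B * ?w)"
      by (intro add_mono order_trans[OF norm_matrix_mult_le mult_mono]) (use A B m w in auto)
    finally show "norm (P \<mu> x y ** Q \<mu> x y - P \<nu> x' y' ** Q \<nu> x' y') \<le> (2 * A * B) * ?w"
      by (simp add: algebra_simps)
  qed
qed

text \<open>Total mass one keeps the constant, so the bounds are uniform in the measure. Averaging
  over a Gaussian law turns this into the corresponding statement for the heat flow.\<close>

lemma taylor2_average:
  fixes f2 :: "real ^ 'n \<Rightarrow> real ^ 'n ^ 'n"
  assumes "\<mu> \<in> P2" and t: "taylor2 C f f1 f2"
  shows "taylor2 C (\<lambda>z. \<integral>x. f (x + z) \<partial>\<mu>) (\<lambda>z. \<integral>x. f1 (x + z) \<partial>\<mu>) (\<lambda>z. \<integral>x. f2 (x + z) \<partial>\<mu>)"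
proof -
  interpret prob_space \<mu> using P2D(1)[OF assms(1)] .
  note i = lipschitz_integrable[OF P2D(1)[OF assms(1)] P2_id_in_L2(1)[OF assms(1)], where C=C]
  have "taylor2 (C * measure \<mu> (space \<mu>)) (\<lambda>z. \<integral>x. f (x + z) \<partial>\<mu>)
      (\<lambda>z. \<integral>x. f1 (x + z) \<partial>\<mu>) (\<lambda>z. \<integral>x. f2 (x + z) \<partial>\<mu>)"
  proof (rule taylor2_integral)
    fix x show "taylor2 C (\<lambda>z. f (x + z)) (\<lambda>z. f1 (x + z)) (\<lambda>z. f2 (x + z))"
      using t unfolding taylor2_def add.assoc[symmetric] by blast
  next
    fix z
    show "integrable \<mu> (\<lambda>x. f (x + z))" "integrable \<mu> (\<lambda>x. f1 (x + z))" "integrable \<mu> (\<lambda>x. f2 (x + z))"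
      by (rule i; use taylor2D(3-5)[OF t, of "x + z" "y + z" for x y] in simp)+
  qed unfold_locales
  then show ?thesis by (simp add: prob_space)
qed

text \<open>
  \<open>stability\<close> is all that is needed in place of the implicit function theorem: it gives uniqueness
  and Lipschitz dependence of the momentum, and by linearisation the bounded inverse \<open>R\<close> of
  \<open>mat 1 - A\<close>, hence the derivative of the momentum with respect to the measure.
\<close>

locale implicit_momentum =
  fixes C :: real
    and u :: "real ^ 'n \<Rightarrow> real" and u1 u2
    and H :: "real ^ 'n \<Rightarrow> real" and H1 H2
  assumes u: "taylor2 C u u1 u2" and H: "taylor2 C H H1 H2" and C_ge_1: "1 \<le> C"
    and stability: "\<And>\<mu> p q. \<mu> \<in> P2 \<Longrightarrow>
      norm (p - q) \<le> 2 * norm ((p - (\<integral>x. u1 (x + H1 p) \<partial>\<mu>)) - (q - (\<integral>x. u1 (x + H1 q) \<partial>\<mu>)))"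
begin

definition G1 :: "(real ^ 'n) measure \<Rightarrow> real ^ 'n \<Rightarrow> real ^ 'n" where
  "G1 \<mu> z = (\<integral>x. u1 (x + z) \<partial>\<mu>)"

definition G2 :: "(real ^ 'n) measure \<Rightarrow> real ^ 'n \<Rightarrow> real ^ 'n ^ 'n" where
  "G2 \<mu> z = (\<integral>x. u2 (x + z) \<partial>\<mu>)"

text \<open>A choice is harmless: a solution exists by \<open>mom_fixed_point\<close>, and by
  \<open>mom_stable\<close> every solution equals the chosen one.\<close>

definition mom :: "(real ^ 'n) measure \<Rightarrow> real ^ 'n" where
  "mom \<mu> = (SOME p. p = G1 \<mu> (H1 p))"

definition pos :: "(real ^ 'n) measure \<Rightarrow> real ^ 'n" where
  "pos \<mu> = H1 (mom \<mu>)"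

definition val :: "(real ^ 'n) measure \<Rightarrow> real" where
  "val \<mu> = (\<integral>x. u (x + pos \<mu>) \<partial>\<mu>) - mom \<mu> \<bullet> pos \<mu> + H (mom \<mu>)"

text \<open>By the chain rule, the derivative at \<open>mom \<mu>\<close> of the map p ->
  \<open>G1 \<mu> (H1 p)\<close>, whose fixed point is the momentum.\<close>

definition A :: "(real ^ 'n) measure \<Rightarrow> real ^ 'n ^ 'n" where
  "A \<mu> = G2 \<mu> (pos \<mu>) ** H2 (mom \<mu>)"

definition R :: "(real ^ 'n) measure \<Rightarrow> real ^ 'n ^ 'n" where
  "R \<mu> = matrix_inv (mat 1 - A \<mu>)"

definition dval :: "(real ^ 'n) measure \<Rightarrow> real ^ 'n \<Rightarrow> real ^ 'n" where
  "dval \<mu> x = u1 (x + pos \<mu>)"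

text \<open>A chain rule, read from right to left: displacing mass at y changes the averaged
  gradient through \<open>u2 (y + pos \<mu>)\<close>, \<open>R \<mu>\<close> turns this into the
  change of the momentum, \<open>H2\<close> into the change of \<open>pos\<close>, and
  \<open>u2 (x + pos \<mu>)\<close> into the change of \<open>dval \<mu> x\<close>.\<close>

definition ddval :: "(real ^ 'n) measure \<Rightarrow> real ^ 'n \<Rightarrow> real ^ 'n \<Rightarrow> real ^ 'n ^ 'n" where
  "ddval \<mu> x y = u2 (x + pos \<mu>) ** H2 (mom \<mu>) ** R \<mu> ** u2 (y + pos \<mu>)"

definition dxdval :: "(real ^ 'n) measure \<Rightarrow> real ^ 'n \<Rightarrow> real ^ 'n ^ 'n" where
  "dxdval \<mu> x = u2 (x + pos \<mu>)"

lemma C_pos: "0 < C" "0 \<le> C" using C_ge_1 by auto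

lemma G_taylor2: "\<mu> \<in> P2 \<Longrightarrow> taylor2 C (\<lambda>z. \<integral>x. u (x + z) \<partial>\<mu>) (G1 \<mu>) (G2 \<mu>)"
  unfolding G1_def G2_def by (rule taylor2_average[OF _ u])

lemma G_diff_le_W2:
  assumes "\<mu> \<in> P2" "\<nu> \<in> P2"
  shows "norm (G1 \<mu> z - G1 \<nu> z) \<le> C * W2 \<mu> \<nu>" "norm (G2 \<mu> z - G2 \<nu> z) \<le> C * W2 \<mu> \<nu>"
  unfolding G1_def G2_def
  by (rule norm_integral_diff_le_W2[OF assms _ C_pos(1)];
      use taylor2D(4,5)[OF u, of "x + z" "y + z" for x y] in simp)+

lemma mom_fixed_point:
  assumes "\<mu> \<in> P2"
  shows "mom \<mu> = G1 \<mu> (pos \<mu>)"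
proof -
  have c1: "continuous_on UNIV (G1 \<mu>)" "continuous_on UNIV H1"
    by (rule lipschitz_imp_borel_measurable(1), rule taylor2D(4)[OF G_taylor2[OF assms]] taylor2D(4)[OF H])+
  have "continuous_on UNIV (\<lambda>p. G1 \<mu> (H1 p))"
    by (rule continuous_on_compose2[OF c1]) simp
  then have "continuous_on (cball 0 C) (\<lambda>p. G1 \<mu> (H1 p))" by (rule continuous_on_subset) simp
  then obtain p where "G1 \<mu> (H1 p) = p"
    using brouwer_ball[of C 0 "\<lambda>p. G1 \<mu> (H1 p)"] C_pos taylor2D(1)[OF G_taylor2[OF assms]]
    by (auto simp: Pi_iff)
  then have "\<exists>p. p = G1 \<mu> (H1 p)" by metis
  then show ?thesis unfolding mom_def pos_def by (rule someI_ex)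
qed

text \<open>The residual of \<open>mom \<mu>\<close> vanishes, so the residual of any p controls its
  distance from the solution. Approximate solutions are fed in below: the momentum of another
  measure, of another time, or a small displacement of \<open>mom \<mu>\<close>.\<close>

lemma mom_stable:
  assumes "\<mu> \<in> P2"
  shows "norm (p - mom \<mu>) \<le> 2 * norm (p - G1 \<mu> (H1 p))"
proof -
  have "mom \<mu> - (\<integral>x. u1 (x + H1 (mom \<mu>)) \<partial>\<mu>) = 0"
    unfolding pos_def[symmetric] G1_def[symmetric] mom_fixed_point[OF assms, symmetric] by simp
  then show ?thesis using stability[OF assms, of p "mom \<mu>"] by (simp only: G1_def diff_zero)
qed

text \<open>\<open>mom \<mu>\<close> is an approximate solution for \<open>\<nu>\<close>: its
  residual is the difference of the two averages of one Lipschitz function.\<close>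

lemma mom_pos_lipschitz:
  assumes "\<mu> \<in> P2" "\<nu> \<in> P2"
  shows "norm (mom \<mu> - mom \<nu>) \<le> 2 * C * W2 \<mu> \<nu>"
    and "norm (pos \<mu> - pos \<nu>) \<le> 2 * C\<^sup>2 * W2 \<mu> \<nu>"
proof -
  have "norm (mom \<mu> - mom \<nu>) \<le> 2 * norm (G1 \<mu> (pos \<mu>) - G1 \<nu> (pos \<mu>))"
    using mom_stable[OF assms(2), of "mom \<mu>"]
    unfolding pos_def[symmetric] mom_fixed_point[OF assms(1), symmetric] .
  then show m: "norm (mom \<mu> - mom \<nu>) \<le> 2 * C * W2 \<mu> \<nu>"
    using G_diff_le_W2(1)[OF assms, of "pos \<mu>"] by simp
  have "norm (pos \<mu> - pos \<nu>) \<le> C * norm (mom \<mu> - mom \<nu>)"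
    unfolding pos_def by (rule taylor2D(4)[OF H])
  also have "\<dots> \<le> C * (2 * C * W2 \<mu> \<nu>)" by (intro mult_left_mono m C_pos)
  finally show "norm (pos \<mu> - pos \<nu>) \<le> 2 * C\<^sup>2 * W2 \<mu> \<nu>" by (simp add: power2_eq_square)
qed

text \<open>\<open>mom_stable\<close> is applied to the momentum displaced by s v, and s tends to
  zero. The limit is replaced by an arbitrary slack e.\<close>

lemma linearised_stability:
  assumes "\<mu> \<in> P2"
  shows "norm v \<le> 2 * norm ((mat 1 - A \<mu>) *v v)"
proof (rule field_le_epsilon)
  fix e :: real assume e: "0 < e"
  \<comment> \<open>The errors of linearising \<open>H1\<close> and \<open>G1 \<mu>\<close> at
    increment s v add up to at most \<open>s\<^sup>2 * K\<close>; after division by s the slack is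
    \<open>2 * s * K\<close>. The summand 1 in the denominator of s allows for K = 0.\<close>
  define K where "K = C * C * (norm v)\<^sup>2 + C * (C * norm v)\<^sup>2"
  have K: "0 \<le> K" using C_pos by (simp add: K_def)
  define s where "s = e / (2 * K + 1)"
  have s: "0 < s" "2 * s * K \<le> e"
    using e K by (auto simp: s_def field_simps add_nonneg_pos)
  let ?p = "mom \<mu>" and ?z = "pos \<mu>"
  define k where "k = H1 (?p + s *\<^sub>R v) - ?z"
  note T = G_taylor2[OF assms]
  have k1: "norm k \<le> C * (s * norm v)"
    using taylor2D(4)[OF H, of "?p + s *\<^sub>R v" ?p] s by (simp add: k_def pos_def)
  have "norm (k - H2 ?p *v (s *\<^sub>R v)) \<le> C * (s * norm v)\<^sup>2"
    using taylor2D(7)[OF H, of "?p + s *\<^sub>R v" ?p] s by (simp add: k_def pos_def)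
  then have k2: "norm (G2 \<mu> ?z *v (k - H2 ?p *v (s *\<^sub>R v))) \<le> C * (C * (s * norm v)\<^sup>2)"
    by (intro order_trans[OF norm_matrix_vector_le mult_mono] taylor2D(2)[OF T])
      (use C_pos in auto)
  have "norm (G1 \<mu> (?z + k) - G1 \<mu> ?z - G2 \<mu> ?z *v k) \<le> C * (norm k)\<^sup>2"
    using taylor2D(7)[OF T, of "?z + k" ?z] by simp
  also have "\<dots> \<le> C * (C * (s * norm v))\<^sup>2"
    using k1 C_pos by (intro mult_left_mono power_mono) auto
  finally have k3: "norm (G1 \<mu> (?z + k) - ?p - G2 \<mu> ?z *v k) \<le> C * (C * (s * norm v))\<^sup>2"
    unfolding mom_fixed_point[OF assms, symmetric] .
  have "s * norm v \<le> 2 * norm (?p + s *\<^sub>R v - G1 \<mu> (?z + k))"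
    using mom_stable[OF assms, of "?p + s *\<^sub>R v"] s by (simp add: k_def)
  also have "?p + s *\<^sub>R v - G1 \<mu> (?z + k) = s *\<^sub>R ((mat 1 - A \<mu>) *v v)
      - (G2 \<mu> ?z *v (k - H2 ?p *v (s *\<^sub>R v)) + (G1 \<mu> (?z + k) - ?p - G2 \<mu> ?z *v k))"
    by (simp add: A_def matrix_vector_mult_diff_rdistrib matrix_vector_mult_diff_distrib
        matrix_vector_mul_assoc[symmetric] matrix_vector_mult_scaleR algebra_simps)
  also have "2 * norm \<dots> \<le> 2 * (s * norm ((mat 1 - A \<mu>) *v v) + (C * (C * (s * norm v)\<^sup>2) + C * (C * (s * norm v))\<^sup>2))"
    using k2 k3 s
    by (intro mult_left_mono order_trans[OF norm_triangle_ineq4 add_mono]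
        order_trans[OF norm_triangle_ineq add_mono]) auto
  also have "\<dots> = s * (2 * norm ((mat 1 - A \<mu>) *v v) + 2 * s * K)"
    by (simp add: K_def power2_eq_square algebra_simps)
  finally have "norm v \<le> 2 * norm ((mat 1 - A \<mu>) *v v) + 2 * s * K"
    using s by (simp only: mult_le_cancel_left_pos)
  then show "norm v \<le> 2 * norm ((mat 1 - A \<mu>) *v v) + e" using s by simp
qed

text \<open>The lower bound makes the square matrix injective, hence invertible, and
  \<open>matrix_inv\<close> then picks a two-sided inverse.\<close>

lemma R_inverse:
  assumes "\<mu> \<in> P2"
  shows "(mat 1 - A \<mu>) ** R \<mu> = mat 1" "R \<mu> ** (mat 1 - A \<mu>) = mat 1"
proof -
  have "x = y" if "(mat 1 - A \<mu>) *v x = (mat 1 - A \<mu>) *v y" for x y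
    using linearised_stability[OF assms, of "x - y"] that by (simp add: matrix_vector_mult_diff_distrib)
  then have "invertible (mat 1 - A \<mu>)"
    by (metis invertible_left_inverse matrix_left_invertible_injective injI)
  then show "(mat 1 - A \<mu>) ** R \<mu> = mat 1" "R \<mu> ** (mat 1 - A \<mu>) = mat 1"
    unfolding R_def matrix_inv_def invertible_def by (rule someI2_ex; simp)+
qed

lemma norm_R_vector_le:
  assumes "\<mu> \<in> P2"
  shows "norm (R \<mu> *v w) \<le> 2 * norm w"
  using linearised_stability[OF assms, of "R \<mu> *v w"]
  by (simp add: matrix_vector_mul_assoc R_inverse[OF assms])

text \<open>The factors of \<open>A\<close> and \<open>ddval\<close>, all written as functions of
  (\<mu>, x, y), with dummy arguments where necessary, so that \<open>bdd_Lip2_matrix_mult\<close>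
  can combine them.\<close>

lemma bdd_Lip2_coefficients:
  "bdd_Lip2 (\<lambda>\<mu> x y. u2 (x + pos \<mu>))" "bdd_Lip2 (\<lambda>\<mu> x y. u2 (y + pos \<mu>))"
  "bdd_Lip2 (\<lambda>\<mu> x y. H2 (mom \<mu>))" "bdd_Lip2 (\<lambda>\<mu> x y. G2 \<mu> (pos \<mu>))"
proof -
  \<comment> \<open>\<open>2 * C\<^sup>2\<close> is the Lipschitz constant of \<open>pos\<close>,
    amplified by that of the Hessian; the extra C accounts for the explicit dependence on the point,
    or on the measure in the case of \<open>G2\<close>.\<close>
  define L where "L = C * (2 * C\<^sup>2) + C"
  have L: "0 \<le> C * (2 * C\<^sup>2)" "C \<le> L" "C * (2 * C\<^sup>2) \<le> L" using C_pos by (auto simp: L_def)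
  have key: "norm (u2 (a + pos \<mu>) - u2 (b + pos \<nu>)) \<le> L * (W2 \<mu> \<nu> + norm (a - b))"
    if m: "\<mu> \<in> P2" "\<nu> \<in> P2" for \<mu> \<nu> a b
  proof -
    have "norm (u2 (a + pos \<mu>) - u2 (b + pos \<nu>)) \<le> C * norm ((a - b) + (pos \<mu> - pos \<nu>))"
      using taylor2D(5)[OF u, of "a + pos \<mu>" "b + pos \<nu>"] by (simp add: algebra_simps)
    also have "\<dots> \<le> C * (norm (a - b) + 2 * C\<^sup>2 * W2 \<mu> \<nu>)"
      using mom_pos_lipschitz(2)[OF m] C_pos
      by (intro mult_left_mono order_trans[OF norm_triangle_ineq add_mono]) auto
    also have "\<dots> = C * norm (a - b) + C * (2 * C\<^sup>2) * W2 \<mu> \<nu>" by (simp add: algebra_simps)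
    also have "\<dots> \<le> L * norm (a - b) + L * W2 \<mu> \<nu>"
      using W2_nonneg[OF m] by (intro add_mono mult_right_mono L) auto
    finally show ?thesis by (simp add: algebra_simps)
  qed
  have wk: "L * (W2 \<mu> \<nu> + r) \<le> L * (W2 \<mu> \<nu> + r + s)" "L * (W2 \<mu> \<nu> + r) \<le> L * (W2 \<mu> \<nu> + s + r)"
    if "0 \<le> s" for \<mu> \<nu> and r s :: real
    using L C_pos that by (intro mult_left_mono; simp)+
  show "bdd_Lip2 (\<lambda>\<mu> x y. u2 (x + pos \<mu>))"
    by (rule bdd_Lip2I, rule taylor2D(2)[OF u], rule order_trans[OF key wk(1)]) auto
  show "bdd_Lip2 (\<lambda>\<mu> x y. u2 (y + pos \<mu>))"
    by (rule bdd_Lip2I, rule taylor2D(2)[OF u], rule order_trans[OF key wk(2)]) auto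
  show "bdd_Lip2 (\<lambda>\<mu> x y. H2 (mom \<mu>))"
  proof (rule bdd_Lip2I)
    show "norm (H2 (mom \<mu>)) \<le> C" for \<mu> by (rule taylor2D(2)[OF H])
  next
    fix \<mu> \<nu> :: "(real ^ 'n) measure" and x y x' y' :: "real ^ 'n" assume m: "\<mu> \<in> P2" "\<nu> \<in> P2"
    have "norm (H2 (mom \<mu>) - H2 (mom \<nu>)) \<le> C * (2 * C * W2 \<mu> \<nu>)"
      using C_pos by (intro order_trans[OF taylor2D(5)[OF H] mult_left_mono] mom_pos_lipschitz(1)[OF m]) auto
    also have "\<dots> \<le> (2 * C * C) * (W2 \<mu> \<nu> + norm (x - x') + norm (y - y'))"
      using C_pos by (simp add: mult.assoc)
    finally show "norm (H2 (mom \<mu>) - H2 (mom \<nu>)) \<le> (2 * C * C) * (W2 \<mu> \<nu> + norm (x - x') + norm (y - y'))" .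
  qed
  show "bdd_Lip2 (\<lambda>\<mu> x y. G2 \<mu> (pos \<mu>))"
  proof (rule bdd_Lip2I)
    fix \<mu> :: "(real ^ 'n) measure" assume "\<mu> \<in> P2"
    then show "norm (G2 \<mu> (pos \<mu>)) \<le> C" by (rule taylor2D(2)[OF G_taylor2])
  next
    fix \<mu> \<nu> :: "(real ^ 'n) measure" and x y x' y' :: "real ^ 'n" assume m: "\<mu> \<in> P2" "\<nu> \<in> P2"
    have "norm (G2 \<mu> (pos \<mu>) - G2 \<nu> (pos \<nu>))
        \<le> norm (G2 \<mu> (pos \<mu>) - G2 \<mu> (pos \<nu>)) + norm (G2 \<mu> (pos \<nu>) - G2 \<nu> (pos \<nu>))"
      using norm_triangle_ineq[of "G2 \<mu> (pos \<mu>) - G2 \<mu> (pos \<nu>)" "G2 \<mu> (pos \<nu>) - G2 \<nu> (pos \<nu>)"] by simp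
    also have "\<dots> \<le> C * (2 * C\<^sup>2 * W2 \<mu> \<nu>) + C * W2 \<mu> \<nu>"
      using C_pos by (intro add_mono G_diff_le_W2(2)[OF m]
        order_trans[OF taylor2D(5)[OF G_taylor2[OF m(1)]] mult_left_mono] mom_pos_lipschitz(2)[OF m]) auto
    also have "\<dots> = L * W2 \<mu> \<nu>" by (simp add: L_def algebra_simps)
    also have "\<dots> \<le> L * (W2 \<mu> \<nu> + norm (x - x') + norm (y - y'))"
      using L C_pos by (intro mult_left_mono) auto
    finally show "norm (G2 \<mu> (pos \<mu>) - G2 \<nu> (pos \<nu>)) \<le> L * (W2 \<mu> \<nu> + norm (x - x') + norm (y - y'))" .
  qed
qed

text \<open>The resolvent identity \<open>R \<mu> - R \<nu> = R \<mu> ** (A \<mu> - A \<nu>) ** R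
  \<nu>\<close> transfers the Lipschitz bound from \<open>A\<close> to \<open>R\<close>.\<close>

lemma bdd_Lip2_R: "bdd_Lip2 (\<lambda>\<mu> x y. R \<mu>)"
proof -
  have "bdd_Lip2 (\<lambda>\<mu> (x :: real ^ 'n) (y :: real ^ 'n). A \<mu>)"
    unfolding A_def by (rule bdd_Lip2_matrix_mult[OF bdd_Lip2_coefficients(4,3)])
  then obtain L where L: "0 \<le> L"
    and Lip: "\<And>\<mu> \<nu> (x :: real ^ 'n) (y :: real ^ 'n) x' y'. \<mu> \<in> P2 \<Longrightarrow> \<nu> \<in> P2 \<Longrightarrow>
      norm (A \<mu> - A \<nu>) \<le> L * (W2 \<mu> \<nu> + norm (x - x') + norm (y - y'))"
    by (rule bdd_Lip2D) (rule that)
  define c where "c = real CARD('n) * 2"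
  have c: "norm (R \<mu>) \<le> c" if "\<mu> \<in> P2" for \<mu>
    unfolding c_def by (rule norm_matrix_le_operator_bound[OF norm_R_vector_le[OF that]])
  show ?thesis
  proof (rule bdd_Lip2I)
    fix \<mu> :: "(real ^ 'n) measure" assume "\<mu> \<in> P2"
    then show "norm (R \<mu>) \<le> c" by (rule c)
  next
    fix \<mu> \<nu> :: "(real ^ 'n) measure" and x y x' y' :: "real ^ 'n" assume m: "\<mu> \<in> P2" "\<nu> \<in> P2"
    let ?w = "W2 \<mu> \<nu> + norm (x - x') + norm (y - y')"
    have w: "0 \<le> ?w" using W2_nonneg[OF m] by simp
    have "R \<mu> ** (A \<mu> - A \<nu>) ** R \<nu> = R \<mu> ** ((mat 1 - A \<nu>) - (mat 1 - A \<mu>)) ** R \<nu>" by simp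
    also have "\<dots> = R \<mu> ** ((mat 1 - A \<nu>) ** R \<nu>) - (R \<mu> ** (mat 1 - A \<mu>)) ** R \<nu>"
      by (simp only: matrix_sub_ldistrib matrix_sub_rdistrib matrix_mul_assoc)
    also have "\<dots> = R \<mu> - R \<nu>"
      unfolding R_inverse(1)[OF m(2)] R_inverse(2)[OF m(1)] by simp
    finally have "norm (R \<mu> - R \<nu>) = norm (R \<mu> ** (A \<mu> - A \<nu>) ** R \<nu>)" by simp
    also have "\<dots> \<le> (c * (L * ?w)) * c"
      by (intro order_trans[OF norm_matrix_mult_le mult_mono] c m Lip)
        (use L w in \<open>auto simp: c_def\<close>)
    finally show "norm (R \<mu> - R \<nu>) \<le> (c * L * c) * ?w" by (simp add: algebra_simps)
  qed
qed

lemma bdd_Lip2_ddval: "bdd_Lip2 ddval"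
  unfolding ddval_def[abs_def]
  by (rule bdd_Lip2_matrix_mult[OF bdd_Lip2_matrix_mult[OF bdd_Lip2_matrix_mult[OF
        bdd_Lip2_coefficients(1,3)] bdd_Lip2_R] bdd_Lip2_coefficients(2)])

lemma bdd_Lip_dxdval: "bdd_Lip dxdval"
proof -
  obtain L where L: "\<And>\<mu> \<nu> x y x' y'. \<mu> \<in> P2 \<Longrightarrow> \<nu> \<in> P2 \<Longrightarrow>
      norm (u2 (x + pos \<mu>) - u2 (x' + pos \<nu>)) \<le> L * (W2 \<mu> \<nu> + norm (x - x') + norm (y - y' :: real ^ 'n))"
    using bdd_Lip2_coefficients(1) by (rule bdd_Lip2D) (rule that)
  have "norm (u2 (x + pos \<mu>) - u2 (y + pos \<nu>)) \<le> L * (W2 \<mu> \<nu> + norm (x - y))"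
    if m: "\<mu> \<in> P2" "\<nu> \<in> P2" for \<mu> \<nu> x y
    using L[OF m, of x y 0 0] by simp
  then show ?thesis unfolding bdd_Lip_def dxdval_def dist_norm using taylor2D(2)[OF u] by blast
qed

lemma bdd_Lip_dval: "bdd_Lip dval"
proof -
  have "norm (u1 (x + pos \<mu>) - u1 (y + pos \<nu>)) \<le> (C + C * (2 * C\<^sup>2)) * (W2 \<mu> \<nu> + norm (x - y))"
    if m: "\<mu> \<in> P2" "\<nu> \<in> P2" for \<mu> \<nu> x y
  proof -
    have "norm (u1 (x + pos \<mu>) - u1 (y + pos \<nu>)) \<le> C * norm ((x - y) + (pos \<mu> - pos \<nu>))"
      using taylor2D(4)[OF u, of "x + pos \<mu>" "y + pos \<nu>"] by (simp add: algebra_simps)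
    also have "\<dots> \<le> C * (norm (x - y) + 2 * C\<^sup>2 * W2 \<mu> \<nu>)"
      using mom_pos_lipschitz(2)[OF m] C_pos
      by (intro mult_left_mono order_trans[OF norm_triangle_ineq add_mono]) auto
    also have "\<dots> \<le> (C + C * (2 * C\<^sup>2)) * (W2 \<mu> \<nu> + norm (x - y))"
      using C_pos W2_nonneg[OF m] by (simp add: algebra_simps)
    finally show ?thesis .
  qed
  then show ?thesis unfolding bdd_Lip_def dval_def dist_norm using taylor2D(1)[OF u] by blast
qed

end

section \<open>Expansion of the value along square integrable perturbations\<close>

lemma taylor2_measurable:
  assumes "taylor2 C u u1 u2"
  shows "u \<in> borel_measurable borel" "u1 \<in> borel_measurable borel" "u2 \<in> borel_measurable borel"
  using lipschitz_imp_borel_measurable(2)[of u C] lipschitz_imp_borel_measurable(2)[of u1 C]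
    lipschitz_imp_borel_measurable(2)[of u2 C] taylor2D(3-5)[OF assms] by auto

lemma (in prob_space) taylor2_integrable:
  assumes t: "taylor2 C u u1 u2" and xi: "\<xi> \<in> L2 M"
  shows "integrable M (\<lambda>w. u (\<xi> w))" "integrable M (\<lambda>w. u1 (\<xi> w))" "integrable M (\<lambda>w. u2 (\<xi> w))"
proof -
  note i = lipschitz_integrable[OF prob_space_axioms xi, where C=C]
  show "integrable M (\<lambda>w. u (\<xi> w))" "integrable M (\<lambda>w. u1 (\<xi> w))" "integrable M (\<lambda>w. u2 (\<xi> w))"
    by (rule i; use taylor2D(3-5)[OF t] in simp)+
qed

lemma (in prob_space) taylor2_integrable_linear:
  fixes \<xi> \<eta> :: "'a \<Rightarrow> real ^ 'n"
  assumes t: "taylor2 C u u1 u2" and xi: "\<xi> \<in> L2 M" and eta: "\<eta> \<in> L2 M"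
  shows "integrable M (\<lambda>w. u1 (\<xi> w) \<bullet> \<eta> w)" "integrable M (\<lambda>w. u2 (\<xi> w) *v \<eta> w)"
proof -
  note [measurable] = taylor2_measurable[OF t] L2D(1)[OF xi] L2D(1)[OF eta]
  have i: "integrable M (\<lambda>w. C * norm (\<eta> w))" using L2_integrable[OF eta] by simp
  have "norm (u1 x \<bullet> y) \<le> C * norm y" "norm (u2 x *v y) \<le> C * norm y" for x y
    using order_trans[OF Cauchy_Schwarz_ineq2 mult_right_mono[OF taylor2D(1)[OF t]]]
      order_trans[OF norm_matrix_vector_le mult_right_mono[OF taylor2D(2)[OF t]]] by auto
  then have b: "norm (u1 x \<bullet> y) \<le> norm (C * norm y)" "norm (u2 x *v y) \<le> norm (C * norm y)" for x y
    unfolding real_norm_def[of "C * _"] using order_trans[OF _ abs_ge_self] by blast+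
  show "integrable M (\<lambda>w. u1 (\<xi> w) \<bullet> \<eta> w)"
    by (rule Bochner_Integration.integrable_bound[OF i]) (use b in auto)
  show "integrable M (\<lambda>w. u2 (\<xi> w) *v \<eta> w)"
    by (rule Bochner_Integration.integrable_bound[OF i]) (use b in auto)
qed

text \<open>The quadratic remainders integrate to a multiple of the squared L2 norm. The cubic one
  would call for a third moment, which a general element of \<open>L2 M\<close> does not
  have.\<close>

lemma (in prob_space) taylor2_expectation_remainder:
  fixes \<xi> k :: "'a \<Rightarrow> real ^ 'n"
  assumes t: "taylor2 C u u1 u2" and xi: "\<xi> \<in> L2 M" and k: "k \<in> L2 M"
  shows "\<bar>(\<integral>w. u (\<xi> w + k w) \<partial>M) - (\<integral>w. u (\<xi> w) \<partial>M) - (\<integral>w. u1 (\<xi> w) \<bullet> k w \<partial>M)\<bar> \<le> C * (L2_norm M k)\<^sup>2"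
    and "norm ((\<integral>w. u1 (\<xi> w + k w) \<partial>M) - (\<integral>w. u1 (\<xi> w) \<partial>M) - (\<integral>w. u2 (\<xi> w) *v k w \<partial>M)) \<le> C * (L2_norm M k)\<^sup>2"
proof -
  note i = taylor2_integrable[OF t xi] taylor2_integrable[OF t L2_add[OF xi k]] taylor2_integrable_linear[OF t xi k]
  have ik: "integrable M (\<lambda>w. C * (norm (k w))\<^sup>2)" using L2D(2)[OF k] by simp
  have "norm (\<integral>w. u (\<xi> w + k w) - u (\<xi> w) - u1 (\<xi> w) \<bullet> k w \<partial>M) \<le> (\<integral>w. C * (norm (k w))\<^sup>2 \<partial>M)"
  proof (rule order_trans[OF integral_norm_bound integral_mono'[OF ik]])
    show "norm (u (\<xi> w + k w) - u (\<xi> w) - u1 (\<xi> w) \<bullet> k w) \<le> C * (norm (k w))\<^sup>2" for w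
      using taylor2D(6)[OF t, of "\<xi> w + k w" "\<xi> w"] by simp
  qed (use taylor2_nonneg[OF t] in auto)
  then show "\<bar>(\<integral>w. u (\<xi> w + k w) \<partial>M) - (\<integral>w. u (\<xi> w) \<partial>M) - (\<integral>w. u1 (\<xi> w) \<bullet> k w \<partial>M)\<bar> \<le> C * (L2_norm M k)\<^sup>2"
    using i by (simp add: L2_norm_square)
  have "norm (\<integral>w. u1 (\<xi> w + k w) - u1 (\<xi> w) - u2 (\<xi> w) *v k w \<partial>M) \<le> (\<integral>w. C * (norm (k w))\<^sup>2 \<partial>M)"
  proof (rule order_trans[OF integral_norm_bound integral_mono'[OF ik]])
    show "norm (u1 (\<xi> w + k w) - u1 (\<xi> w) - u2 (\<xi> w) *v k w) \<le> C * (norm (k w))\<^sup>2" for w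
      using taylor2D(7)[OF t, of "\<xi> w + k w" "\<xi> w"] by simp
  qed (use taylor2_nonneg[OF t] in auto)
  then show "norm ((\<integral>w. u1 (\<xi> w + k w) \<partial>M) - (\<integral>w. u1 (\<xi> w) \<partial>M) - (\<integral>w. u2 (\<xi> w) *v k w \<partial>M)) \<le> C * (L2_norm M k)\<^sup>2"
    using i by (simp add: L2_norm_square)
qed

lemma (in prob_space) L2_norm_add_const:
  assumes "\<eta> \<in> L2 M"
  shows "(L2_norm M (\<lambda>w. \<eta> w + c))\<^sup>2 \<le> 2 * (L2_norm M \<eta>)\<^sup>2 + 2 * (norm c)\<^sup>2"
proof -
  have "(\<integral>w. (norm (\<eta> w + c))\<^sup>2 \<partial>M) \<le> (\<integral>w. 2 * (norm (\<eta> w))\<^sup>2 + 2 * (norm c)\<^sup>2 \<partial>M)"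
    using L2D(2)[OF assms] L2D(2)[OF L2_add[OF assms L2_const]]
    by (intro integral_mono order_trans[OF power_mono[OF norm_triangle_ineq] square_add_le]) auto
  then show ?thesis using L2D(2)[OF assms] by (simp add: L2_norm_square prob_space)
qed

context implicit_momentum
begin

text \<open>The second estimate is the envelope principle: the changes dp of \<open>mom\<close> and
  dz of \<open>pos\<close> are of order \<open>N\<close>, and they cancel to first order in
  \<open>val\<close>. The third one solves the linearised momentum equation for dp with the help of
  \<open>R\<close> and passes to dz through \<open>H2\<close>.\<close>

lemma expansions:
  fixes M :: "'w measure"
  assumes "prob_space M" and xi: "\<xi> \<in> L2 M" and eta: "\<eta> \<in> L2 M"
  defines "\<mu> \<equiv> law M \<xi>" and "\<nu> \<equiv> law M (\<lambda>w. \<xi> w + \<eta> w)" and "N \<equiv> L2_norm M \<eta>"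
  defines "K \<equiv> C * (2 + 8 * C ^ 4)"
  shows "norm (pos \<nu> - pos \<mu>) \<le> 2 * C\<^sup>2 * N"
    and "\<bar>val \<nu> - val \<mu> - (\<integral>w. dval \<mu> (\<xi> w) \<bullet> \<eta> w \<partial>M)\<bar> \<le> (K + 8 * C ^ 3) * N\<^sup>2"
    and "norm (pos \<nu> - pos \<mu> - H2 (mom \<mu>) *v (R \<mu> *v (\<integral>w. u2 (\<xi> w + pos \<mu>) *v \<eta> w \<partial>M)))
      \<le> (4 * C ^ 3 + C * (2 * (K + 4 * C ^ 4))) * N\<^sup>2"
proof -
  interpret prob_space M by fact
  have P: "\<mu> \<in> P2" "\<nu> \<in> P2"
    unfolding \<mu>_def \<nu>_def using assms(1) xi L2_add[OF xi eta] by (auto intro: law_in_P2)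
  have N0: "0 \<le> N" by (simp add: N_def L2_norm_nonneg)
  have W: "W2 \<nu> \<mu> \<le> N"
    using W2_le_L2_norm[OF assms(1) L2_add[OF xi eta] xi] by (simp add: \<mu>_def \<nu>_def N_def)
  define dp where "dp = mom \<nu> - mom \<mu>"
  define dz where "dz = pos \<nu> - pos \<mu>"
  have dp: "norm dp \<le> 2 * C * N"
    unfolding dp_def using C_pos by (intro order_trans[OF mom_pos_lipschitz(1)[OF P(2,1)]] mult_left_mono W) auto
  have dz: "norm dz \<le> 2 * C\<^sup>2 * N"
    unfolding dz_def using C_pos by (intro order_trans[OF mom_pos_lipschitz(2)[OF P(2,1)]] mult_left_mono W) auto
  then show "norm (pos \<nu> - pos \<mu>) \<le> 2 * C\<^sup>2 * N" by (simp add: dz_def)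
  have dp2: "C * (norm dp)\<^sup>2 \<le> 4 * C ^ 3 * N\<^sup>2"
    using mult_left_mono[OF power_mono[OF dp norm_ge_zero, of 2] C_pos(2)]
    by (simp add: power_mult_distrib power2_eq_square power3_eq_cube algebra_simps)
  \<comment> \<open>The total displacement of the argument of u: the perturbation itself together
    with the motion of \<open>pos\<close> that it causes.\<close>
  define k where "k w = \<eta> w + dz" for w
  have k: "k \<in> L2 M" unfolding k_def[abs_def] by (rule L2_add[OF eta L2_const])
  \<comment> \<open>Source of \<open>K\<close>: the two parts of k contribute
    \<open>2 * N\<^sup>2\<close> and \<open>2 * (2 * C\<^sup>2 * N)\<^sup>2\<close>.\<close>
  have "(L2_norm M k)\<^sup>2 \<le> 2 * N\<^sup>2 + 2 * (2 * C\<^sup>2 * N)\<^sup>2"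
    unfolding k_def[abs_def] N_def
    by (intro order_trans[OF L2_norm_add_const[OF eta]] add_mono mult_left_mono power_mono)
       (use dz N0 in \<open>auto simp: N_def\<close>)
  also have "\<dots> = (2 + 8 * C ^ 4) * N\<^sup>2" by (simp add: power_mult_distrib algebra_simps flip: power_mult)
  finally have kN: "C * (L2_norm M k)\<^sup>2 \<le> K * N\<^sup>2"
    unfolding K_def mult.assoc using C_pos by (intro mult_left_mono) auto
  let ?x = "\<lambda>w. \<xi> w + pos \<mu>"
  have x: "?x \<in> L2 M" by (rule L2_add[OF xi L2_const])
  have shift: "?x w + k w = (\<xi> w + \<eta> w) + pos \<nu>" for w by (simp add: k_def dz_def)
  note m = taylor2_measurable[OF u]
  have ms: "(\<lambda>x. u (x + z)) \<in> borel_measurable borel" "(\<lambda>x. u1 (x + z)) \<in> borel_measurable borel"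
    "(\<lambda>x. u2 (x + z)) \<in> borel_measurable borel" for z
    using m by measurable
  note lm = integral_law[OF L2D(1)[OF xi]] and ln = integral_law[OF L2D(1)[OF L2_add[OF xi eta]]]
  have mom: "mom \<mu> = (\<integral>w. u1 (?x w) \<partial>M)" "mom \<nu> = (\<integral>w. u1 (?x w + k w) \<partial>M)"
    using mom_fixed_point[OF P(1)] mom_fixed_point[OF P(2)]
    unfolding G1_def \<mu>_def[symmetric] \<nu>_def[symmetric] shift
    using lm[OF ms(2)] ln[OF ms(2)] by (simp_all add: \<mu>_def \<nu>_def)
  have G2: "G2 \<mu> (pos \<mu>) = (\<integral>w. u2 (?x w) \<partial>M)"
    unfolding G2_def using lm[OF ms(3)] by (simp add: \<mu>_def)
  have U: "(\<integral>x. u (x + pos \<mu>) \<partial>\<mu>) = (\<integral>w. u (?x w) \<partial>M)" "(\<integral>x. u (x + pos \<nu>) \<partial>\<nu>) = (\<integral>w. u (?x w + k w) \<partial>M)"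
    unfolding shift using lm[OF ms(1)] ln[OF ms(1)] by (simp_all add: \<mu>_def \<nu>_def)
  note i = taylor2_integrable[OF u x] taylor2_integrable_linear[OF u x eta]
  have l1: "(\<integral>w. u1 (?x w) \<bullet> k w \<partial>M) = (\<integral>w. dval \<mu> (\<xi> w) \<bullet> \<eta> w \<partial>M) + mom \<mu> \<bullet> dz"
    using i by (simp add: k_def inner_add_right mom(1) dval_def)
  have l2: "(\<integral>w. u2 (?x w) *v k w \<partial>M) = (\<integral>w. u2 (?x w) *v \<eta> w \<partial>M) + G2 \<mu> (pos \<mu>) *v dz"
    using i integrable_bounded_linear[OF bounded_linear_matrix_vector_mult_left i(3), of dz]
    by (simp add: k_def matrix_vector_right_distrib G2
        integral_bounded_linear[OF bounded_linear_matrix_vector_mult_left i(3)])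
  have e1: "\<bar>(\<integral>w. u (?x w + k w) \<partial>M) - (\<integral>w. u (?x w) \<partial>M) - ((\<integral>w. dval \<mu> (\<xi> w) \<bullet> \<eta> w \<partial>M) + mom \<mu> \<bullet> dz)\<bar> \<le> K * N\<^sup>2"
    using order_trans[OF taylor2_expectation_remainder(1)[OF u x k] kN] unfolding l1 .
  have e2: "norm (dp - ((\<integral>w. u2 (?x w) *v \<eta> w \<partial>M) + G2 \<mu> (pos \<mu>) *v dz)) \<le> K * N\<^sup>2"
    using order_trans[OF taylor2_expectation_remainder(2)[OF u x k] kN] unfolding l2 dp_def mom .
  have e3: "norm (dz - H2 (mom \<mu>) *v dp) \<le> 4 * C ^ 3 * N\<^sup>2"
    using order_trans[OF taylor2D(7)[OF H, of "mom \<nu>" "mom \<mu>"] dp2[unfolded dp_def]]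
    by (simp add: dz_def dp_def pos_def)
  have e4: "\<bar>H (mom \<nu>) - H (mom \<mu>) - pos \<mu> \<bullet> dp\<bar> \<le> 4 * C ^ 3 * N\<^sup>2"
    using order_trans[OF taylor2D(6)[OF H, of "mom \<nu>" "mom \<mu>"] dp2[unfolded dp_def]]
    by (simp add: dp_def pos_def)
  have "\<bar>dp \<bullet> dz\<bar> \<le> (2 * C * N) * (2 * C\<^sup>2 * N)"
    using C_pos N0 by (intro order_trans[OF Cauchy_Schwarz_ineq2 mult_mono] dp dz) auto
  then have e5: "\<bar>dp \<bullet> dz\<bar> \<le> 4 * C ^ 3 * N\<^sup>2"
    by (simp add: power2_eq_square power3_eq_cube algebra_simps)
  \<comment> \<open>The expansion of the average of u yields the inner product of
    \<open>mom \<mu>\<close> with dz, that of H yields the one of \<open>pos \<mu>\<close> with dp,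
    and the change of the product term removes both. Only the product of dp and dz is left over, and
    it is quadratic.\<close>
  have "val \<nu> - val \<mu> - (\<integral>w. dval \<mu> (\<xi> w) \<bullet> \<eta> w \<partial>M)
      = ((\<integral>w. u (?x w + k w) \<partial>M) - (\<integral>w. u (?x w) \<partial>M) - ((\<integral>w. dval \<mu> (\<xi> w) \<bullet> \<eta> w \<partial>M) + mom \<mu> \<bullet> dz))
        + (H (mom \<nu>) - H (mom \<mu>) - pos \<mu> \<bullet> dp) - dp \<bullet> dz"
    unfolding val_def U by (simp add: dp_def dz_def algebra_simps inner_commute)
  then show "\<bar>val \<nu> - val \<mu> - (\<integral>w. dval \<mu> (\<xi> w) \<bullet> \<eta> w \<partial>M)\<bar> \<le> (K + 8 * C ^ 3) * N\<^sup>2"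
    using e1 e4 e5 unfolding distrib_right by linarith
  let ?E = "\<integral>w. u2 (?x w) *v \<eta> w \<partial>M"
  have "norm (G2 \<mu> (pos \<mu>) *v (dz - H2 (mom \<mu>) *v dp)) \<le> C * (4 * C ^ 3 * N\<^sup>2)"
    using C_pos by (intro order_trans[OF norm_matrix_vector_le mult_mono] taylor2D(2)[OF G_taylor2[OF P(1)]] e3) auto
  then have e6: "norm (G2 \<mu> (pos \<mu>) *v (dz - H2 (mom \<mu>) *v dp)) \<le> 4 * C ^ 4 * N\<^sup>2"
    by (simp add: power3_eq_cube power4_eq_xxxx algebra_simps)
  \<comment> \<open>The linearised fixed point equation, once dz is replaced by its first order part
    \<open>H2 (mom \<mu>) *v dp\<close>; the right-hand side collects the two quadratic
    errors.\<close>
  have "(mat 1 - A \<mu>) *v dp - ?E = (dp - (?E + G2 \<mu> (pos \<mu>) *v dz)) + G2 \<mu> (pos \<mu>) *v (dz - H2 (mom \<mu>) *v dp)"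
    by (simp add: A_def matrix_vector_mult_diff_rdistrib matrix_vector_mult_diff_distrib
        matrix_vector_mul_assoc[symmetric])
  then have e7: "norm ((mat 1 - A \<mu>) *v dp - ?E) \<le> (K + 4 * C ^ 4) * N\<^sup>2"
    unfolding distrib_right by (simp only: norm_triangle_le[OF add_mono[OF e2 e6]])
  have "dp - R \<mu> *v ?E = R \<mu> *v ((mat 1 - A \<mu>) *v dp - ?E)"
    unfolding matrix_vector_mult_diff_distrib matrix_vector_mul_assoc R_inverse[OF P(1)] by simp
  then have e8: "norm (dp - R \<mu> *v ?E) \<le> 2 * (K + 4 * C ^ 4) * N\<^sup>2"
    unfolding mult.assoc
    by (simp only:) (rule order_trans[OF norm_R_vector_le[OF P(1)] mult_left_mono[OF e7]], simp)
  have "norm (H2 (mom \<mu>) *v (dp - R \<mu> *v ?E)) \<le> C * (2 * (K + 4 * C ^ 4) * N\<^sup>2)"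
    using C_pos by (intro order_trans[OF norm_matrix_vector_le mult_mono] taylor2D(2)[OF H] e8) auto
  from norm_triangle_le[OF add_mono[OF e3 this]]
  show "norm (pos \<nu> - pos \<mu> - H2 (mom \<mu>) *v (R \<mu> *v ?E)) \<le> (4 * C ^ 3 + C * (2 * (K + 4 * C ^ 4))) * N\<^sup>2"
    by (simp add: dz_def[symmetric] matrix_vector_mult_diff_distrib algebra_simps)
qed

text \<open>The space \<open>M\<close> is arbitrary, as the derivatives are wanted on the
  restriction of one space to each member of a filtration. For fixed x, \<open>dval \<mu> x\<close>
  varies with the measure only through \<open>pos \<mu>\<close>, so the first and third estimates of
  \<open>expansions\<close> give its derivative.\<close>

theorem val_C2_Lip_b:
  fixes M :: "'w measure"
  assumes "prob_space M"
  shows "C2_Lip_b_derivs M val dval ddval dxdval"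
  unfolding C2_Lip_b_derivs_def C1_Lip_b_deriv_def
proof (intro conjI allI ballI bdd_Lip_dval bdd_Lip_dxdval bdd_Lip2_ddval)
  interpret prob_space M by fact
  show "has_L_derivative M val dval"
    by (rule has_L_derivative_quadratic_remainder[OF assms bdd_Lip_dval expansions(2)[OF assms]])
  show "(dval \<mu> has_derivative (\<lambda>h. dxdval \<mu> x *v h)) (at x)" for \<mu> x
  proof -
    have "((\<lambda>x. x + pos \<mu>) has_derivative (\<lambda>h. h)) (at x)" by (auto intro!: derivative_eq_intros)
    from has_derivative_compose[OF this taylor2_has_derivative(2)[OF u]]
    show ?thesis by (simp add: dval_def[abs_def] dxdval_def)
  qed
  fix x :: "real ^ 'n" and i :: 'n
  obtain L where L: "\<And>\<mu> x y. \<mu> \<in> P2 \<Longrightarrow> norm (ddval \<mu> x y) \<le> L"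
    "\<And>\<mu> \<nu> x y x' y'. \<mu> \<in> P2 \<Longrightarrow> \<nu> \<in> P2 \<Longrightarrow>
      norm (ddval \<mu> x y - ddval \<nu> x' y') \<le> L * (W2 \<mu> \<nu> + norm (x - x') + norm (y - y'))"
    using bdd_Lip2_ddval by (rule bdd_Lip2D) (rule that)
  have row: "norm (ddval \<mu> x y $ i) \<le> L" if "\<mu> \<in> P2" for \<mu> y
    using order_trans[OF Finite_Cartesian_Product.norm_nth_le L(1)[OF that]] .
  have rowL: "norm (ddval \<mu> x y $ i - ddval \<nu> x y' $ i) \<le> L * (W2 \<mu> \<nu> + norm (y - y'))"
    if "\<mu> \<in> P2" "\<nu> \<in> P2" for \<mu> \<nu> y y'
    using order_trans[OF Finite_Cartesian_Product.norm_nth_le L(2)[OF that], of x y x y' i] by simp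
  show bL: "bdd_Lip (\<lambda>\<mu> y. ddval \<mu> x y $ i)"
    unfolding bdd_Lip_def dist_norm using row rowL by blast
  \<comment> \<open>The constant of the third estimate of \<open>expansions\<close>, with its local
    abbreviation unfolded. The other constant, \<open>4 * C ^ 5\<close>, is C times the square of
    the factor \<open>2 * C\<^sup>2\<close> bounding the change of \<open>pos\<close>.\<close>
  define K where "K = 4 * C ^ 3 + C * (2 * (C * (2 + 8 * C ^ 4) + 4 * C ^ 4))"
  show "has_L_derivative M (\<lambda>\<mu>. dval \<mu> x $ i) (\<lambda>\<mu> y. ddval \<mu> x y $ i)"
  proof (rule has_L_derivative_quadratic_remainder[OF assms bL, where K="C * K + 4 * C ^ 5"])
    fix \<xi> \<eta> :: "'w \<Rightarrow> real ^ 'n" assume xi: "\<xi> \<in> L2 M" and eta: "\<eta> \<in> L2 M"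
    let ?m = "law M \<xi>" and ?n = "law M (\<lambda>w. \<xi> w + \<eta> w)" and ?N = "L2_norm M \<eta>"
    define E where "E = (\<integral>w. u2 (\<xi> w + pos ?m) *v \<eta> w \<partial>M)"
    define dz where "dz = pos ?n - pos ?m"
    let ?B = "u2 (x + pos ?m) ** H2 (mom ?m) ** R ?m"
    have "(\<integral>w. (ddval ?m x (\<xi> w) $ i) \<bullet> \<eta> w \<partial>M) = (\<integral>w. (?B *v (u2 (\<xi> w + pos ?m) *v \<eta> w)) $ i \<partial>M)"
      unfolding ddval_def matrix_vector_mul_component[symmetric] matrix_vector_mul_assoc ..
    also have "\<dots> = (?B *v E) $ i"
      unfolding E_def
      by (rule integral_bounded_linear[OF bounded_linear_compose[OF bounded_linear_vec_nth
          matrix_vector_mul_bounded_linear]])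
        (rule taylor2_integrable_linear(2)[OF u L2_add[OF xi L2_const] eta])
    finally have i: "(\<integral>w. (ddval ?m x (\<xi> w) $ i) \<bullet> \<eta> w \<partial>M) = (?B *v E) $ i" .
    have "norm dz \<le> 2 * C\<^sup>2 * ?N" unfolding dz_def by (rule expansions(1)[OF assms xi eta])
    then have "C * (norm dz)\<^sup>2 \<le> C * (2 * C\<^sup>2 * ?N)\<^sup>2"
      using C_pos by (intro mult_left_mono power_mono) auto
    then have a1: "norm (dval ?n x - dval ?m x - u2 (x + pos ?m) *v dz) \<le> 4 * C ^ 5 * ?N\<^sup>2"
      using taylor2D(7)[OF u, of "x + pos ?n" "x + pos ?m"]
      by (simp add: dval_def dz_def power_mult_distrib flip: power_mult) (simp add: eval_nat_numeral algebra_simps)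
    have "norm (dz - H2 (mom ?m) *v (R ?m *v E)) \<le> K * ?N\<^sup>2"
      unfolding dz_def E_def K_def by (rule expansions(3)[OF assms xi eta])
    then have a2: "norm (u2 (x + pos ?m) *v (dz - H2 (mom ?m) *v (R ?m *v E))) \<le> C * (K * ?N\<^sup>2)"
      using C_pos by (intro order_trans[OF norm_matrix_vector_le mult_mono] taylor2D(2)[OF u]) auto
    have "dval ?n x - dval ?m x - ?B *v E = (dval ?n x - dval ?m x - u2 (x + pos ?m) *v dz)
        + u2 (x + pos ?m) *v (dz - H2 (mom ?m) *v (R ?m *v E))"
      by (simp add: matrix_vector_mult_diff_distrib matrix_vector_mul_assoc[symmetric])
    then have "norm (dval ?n x - dval ?m x - ?B *v E) \<le> (C * K + 4 * C ^ 5) * ?N\<^sup>2"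
      using norm_triangle_le[OF add_mono[OF a1 a2]] by (simp add: algebra_simps)
    then have "norm ((dval ?n x - dval ?m x - ?B *v E) $ i) \<le> (C * K + 4 * C ^ 5) * ?N\<^sup>2"
      by (rule order_trans[OF Finite_Cartesian_Product.norm_nth_le])
    then show "\<bar>dval ?n x $ i - dval ?m x $ i - (\<integral>w. (ddval ?m x (\<xi> w) $ i) \<bullet> \<eta> w \<partial>M)\<bar>
        \<le> (C * K + 4 * C ^ 5) * ?N\<^sup>2"
      unfolding i by simp
  qed
qed

end

section \<open>The standard Gaussian measure\<close>

abbreviation std_normal_family :: "'n \<Rightarrow> real measure" where
  "std_normal_family \<equiv> (\<lambda>_. std_normal_distribution)"

definition gauss :: "(real ^ 'n) measure" where
  "gauss = distr (PiM (UNIV :: 'n set) std_normal_family) borel (\<lambda>f. \<chi> i. f i)"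

lemma prob_space_std_normal: "prob_space std_normal_distribution"
  using real_dist_normal_dist by (simp add: real_distribution_def)

lemma product_prob_space_std_normal: "product_prob_space std_normal_family"
  using prob_space_std_normal
  by (auto simp: product_prob_space_def product_prob_space_axioms_def product_sigma_finite_def
      prob_space_imp_sigma_finite)

lemma borel_measurable_vec_lambda:
  fixes f :: "'w \<Rightarrow> 'n::finite \<Rightarrow> real"
  assumes [measurable]: "\<And>i. (\<lambda>w. f w i) \<in> borel_measurable M"
  shows "(\<lambda>w. \<chi> i. f w i) \<in> borel_measurable M"
proof -
  have "(\<lambda>w. (\<chi> i. f w i) \<bullet> b) \<in> borel_measurable M" if "b \<in> Basis" for b
    using that by (auto simp: Basis_vec_def inner_axis)
  then show ?thesis by (subst borel_measurable_euclidean_space) blast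
qed

lemma measurable_vec_lambda_PiM[measurable]:
  "(\<lambda>f. \<chi> i. f i) \<in> borel_measurable (PiM (UNIV :: 'n::finite set) (\<lambda>_. borel :: real measure))"
  "(\<lambda>f. \<chi> i. f i) \<in> borel_measurable (PiM (UNIV :: 'n::finite set) std_normal_family)"
  by (rule borel_measurable_vec_lambda; measurable)+

lemma prob_space_gauss: "prob_space gauss"
proof -
  interpret product_prob_space std_normal_family UNIV by (rule product_prob_space_std_normal)
  show ?thesis unfolding gauss_def by (rule prob_space_distr) simp
qed

lemma sets_gauss[measurable_cong, simp]: "sets gauss = sets borel"
  by (simp add: gauss_def)

lemma gauss_integral_prod:
  fixes h :: "'n::finite \<Rightarrow> real \<Rightarrow> real"
  assumes "\<And>i. integrable std_normal_distribution (h i)"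
  shows "integrable gauss (\<lambda>x. \<Prod>i\<in>UNIV. h i (x $ i))"
    and "(\<integral>x. (\<Prod>i\<in>UNIV. h i (x $ i)) \<partial>gauss) = (\<Prod>i\<in>UNIV. \<integral>r. h i r \<partial>std_normal_distribution)"
proof -
  interpret product_prob_space std_normal_family UNIV by (rule product_prob_space_std_normal)
  have [measurable]: "h i \<in> borel_measurable borel" for i
    using borel_measurable_integrable[OF assms[of i]] by simp
  have m: "(\<lambda>x. \<Prod>i\<in>UNIV. h i (x $ i)) \<in> borel_measurable borel" by measurable
  show "integrable gauss (\<lambda>x. \<Prod>i\<in>UNIV. h i (x $ i))"
    unfolding gauss_def integrable_distr_eq[OF measurable_vec_lambda_PiM(2) m]
    using product_integrable_prod[of UNIV h] assms by simp
  show "(\<integral>x. (\<Prod>i\<in>UNIV. h i (x $ i)) \<partial>gauss) = (\<Prod>i\<in>UNIV. \<integral>r. h i r \<partial>std_normal_distribution)"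
    unfolding gauss_def integral_distr[OF measurable_vec_lambda_PiM(2) m]
    using product_integral_prod[of UNIV h] assms by simp
qed

lemma gauss_integral_coordinate:
  fixes h :: "real \<Rightarrow> real" and i :: "'n::finite"
  assumes "integrable std_normal_distribution h"
  shows "integrable gauss (\<lambda>x. h (x $ i))"
    and "(\<integral>x. h (x $ i) \<partial>gauss) = (\<integral>r. h r \<partial>std_normal_distribution)"
proof -
  interpret N: prob_space std_normal_distribution by (rule prob_space_std_normal)
  have e: "(\<Prod>k\<in>UNIV. (if k = i then h else (\<lambda>_. 1)) (x $ k)) = h (x $ i)" for x :: "real ^ 'n"
    by (subst prod.remove[of _ i]) (auto intro!: prod.neutral)
  have e2: "(\<Prod>k\<in>UNIV. \<integral>r. (if k = i then h else (\<lambda>_. 1)) r \<partial>std_normal_distribution) = (\<integral>r. h r \<partial>std_normal_distribution)"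
    using N.prob_space by (subst prod.remove[of _ i]) (auto intro!: prod.neutral)
  have "integrable std_normal_distribution ((if k = i then h else (\<lambda>_. 1)))" for k :: 'n
    using assms by simp
  from gauss_integral_prod[of "\<lambda>k. if k = i then h else (\<lambda>_. 1)", OF this]
  show "integrable gauss (\<lambda>x. h (x $ i))" "(\<integral>x. h (x $ i) \<partial>gauss) = (\<integral>r. h r \<partial>std_normal_distribution)"
    unfolding e e2 .
qed

lemma gauss_moments:
  fixes i j :: "'n::finite"
  shows "integrable gauss (\<lambda>x. (x $ i) ^ k)" "(\<integral>x. x $ i \<partial>gauss) = 0" "(\<integral>x. (x $ i) ^ 2 \<partial>gauss) = 1"
    and "i \<noteq> j \<Longrightarrow> (\<integral>x. x $ i * x $ j \<partial>gauss) = 0"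
proof -
  note I = integrable_std_normal_distribution_moment
  show "integrable gauss (\<lambda>x. (x $ i) ^ k)" by (rule gauss_integral_coordinate(1)[OF I])
  show "(\<integral>x. x $ i \<partial>gauss) = 0"
    using gauss_integral_coordinate(2)[OF I[of 1], of i] integral_std_normal_distribution_moment_odd[of 1] by simp
  show "(\<integral>x. (x $ i) ^ 2 \<partial>gauss) = 1"
    using gauss_integral_coordinate(2)[OF I[of 2], of i] std_normal_distribution_even_moments(1)[of 1] by simp
  assume ij: "i \<noteq> j"
  let ?h = "\<lambda>k r. r ^ (if k = i \<or> k = j then 1 else 0) :: real"
  have e: "(\<Prod>k\<in>UNIV. ?h k (x $ k)) = x $ i * x $ j" for x :: "real ^ 'n"
  proof -
    have "(\<Prod>k\<in>UNIV. ?h k (x $ k)) = (\<Prod>k\<in>{i, j}. ?h k (x $ k))"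
      by (rule prod.mono_neutral_right) auto
    then show ?thesis using ij by simp
  qed
  have "(\<integral>x. x $ i * x $ j \<partial>gauss) = (\<Prod>k\<in>UNIV. \<integral>r. ?h k r \<partial>std_normal_distribution)"
    using gauss_integral_prod(2)[of ?h, OF I] unfolding e .
  also have "\<dots> = 0"
    using integral_std_normal_distribution_moment_odd[of 1]
    by (intro prod_zero) (auto intro!: bexI[of _ i])
  finally show "(\<integral>x. x $ i * x $ j \<partial>gauss) = 0" .
qed

lemma gauss_norm_integrable:
  "integrable gauss (\<lambda>x :: real ^ 'n. (norm x) ^ 2)" "integrable gauss (\<lambda>x :: real ^ 'n. (norm x) ^ 3)"
  "integrable gauss (\<lambda>x :: real ^ 'n. norm x)" "integrable gauss (\<lambda>x :: real ^ 'n. x)"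
  "(\<lambda>x :: real ^ 'n. x) \<in> L2 gauss"
proof -
  interpret prob_space "gauss :: (real ^ 'n) measure" by (rule prob_space_gauss)
  have n2: "(norm x)\<^sup>2 = (\<Sum>i\<in>UNIV. (x $ i)\<^sup>2)" for x :: "real ^ 'n"
    by (simp add: norm_vec_def L2_set_def sum_nonneg)
  show i2: "integrable gauss (\<lambda>x :: real ^ 'n. (norm x) ^ 2)"
    unfolding n2 by (intro Bochner_Integration.integrable_sum gauss_moments(1))
  then show L: "(\<lambda>x :: real ^ 'n. x) \<in> L2 gauss" by (simp add: L2_def)
  show "integrable gauss (\<lambda>x :: real ^ 'n. norm x)" "integrable gauss (\<lambda>x :: real ^ 'n. x)"
    using L2_integrable[OF L] by auto
  \<comment> \<open>A bound for the third power of the norm in terms of coordinate moments: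
    \<open>r ^ 3 \<le> r ^ 2 + r ^ 4\<close>, and the fourth power of the norm expands into products
    of squared coordinates.\<close>
  let ?b = "\<lambda>x :: real ^ 'n. (norm x)\<^sup>2 + (\<Sum>i\<in>UNIV. \<Sum>j\<in>UNIV. (x $ i) ^ 4 + (x $ j) ^ 4)"
  have ib: "integrable gauss ?b"
    using i2 by (intro Bochner_Integration.integrable_add Bochner_Integration.integrable_sum gauss_moments(1))
  have "norm x ^ 3 \<le> ?b x" for x :: "real ^ 'n"
  proof -
    have "norm x ^ 4 = ((norm x)\<^sup>2)\<^sup>2" by simp
    also have "\<dots> = (\<Sum>i\<in>UNIV. \<Sum>j\<in>UNIV. (x $ i)\<^sup>2 * (x $ j)\<^sup>2)"
      unfolding n2 power2_eq_square[of "sum _ _"] sum_product ..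
    also have "\<dots> \<le> (\<Sum>i\<in>UNIV. \<Sum>j\<in>UNIV. (x $ i) ^ 4 + (x $ j) ^ 4)"
    proof (intro sum_mono)
      fix i j :: 'n
      have "p * q \<le> p\<^sup>2 + q\<^sup>2" if "0 \<le> p" "0 \<le> q" for p q :: real
        using sum_squares_bound[of p q] mult_nonneg_nonneg[OF that] by simp
      from this[of "(x $ i)\<^sup>2" "(x $ j)\<^sup>2"]
      show "(x $ i)\<^sup>2 * (x $ j)\<^sup>2 \<le> (x $ i) ^ 4 + (x $ j) ^ 4" by simp
    qed
    finally have "norm x ^ 4 \<le> (\<Sum>i\<in>UNIV. \<Sum>j\<in>UNIV. (x $ i) ^ 4 + (x $ j) ^ 4)" .
    moreover have "norm x ^ 3 \<le> (norm x)\<^sup>2 + norm x ^ 4"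
      using mult_left_mono[OF le_one_plus_square[of "norm x"], of "(norm x)\<^sup>2"]
      by (simp add: algebra_simps eval_nat_numeral)
    ultimately show ?thesis by simp
  qed
  from order_trans[OF this abs_ge_self]
  have "norm (norm x ^ 3) \<le> norm (?b x)" for x :: "real ^ 'n" by simp
  then have "AE x in gauss. norm (norm x ^ 3) \<le> norm (?b x)" by blast
  then show "integrable gauss (\<lambda>x :: real ^ 'n. (norm x) ^ 3)"
    by (rule Bochner_Integration.integrable_bound[OF ib, rotated]) simp
qed

lemma gauss_mean: "(\<integral>x. x \<partial>gauss) = (0 :: real ^ 'n)"
  unfolding vec_eq_iff
  by (simp add: gauss_moments(2) integral_bounded_linear[OF bounded_linear_vec_nth gauss_norm_integrable(4), symmetric])

text \<open>The covariance matrix is the identity. This is the origin of the trace in the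
  equation.\<close>

lemma gauss_quadratic_form:
  fixes A :: "real ^ 'n ^ 'n"
  shows "integrable gauss (\<lambda>x. x \<bullet> (A *v x))" "(\<integral>x. x \<bullet> (A *v x) \<partial>gauss) = trace A"
proof -
  have e: "x \<bullet> (A *v x) = (\<Sum>i\<in>UNIV. \<Sum>j\<in>UNIV. A $ i $ j * (x $ i * x $ j))" for x :: "real ^ 'n"
    by (simp add: inner_vec_def matrix_vector_mult_def sum_distrib_left mult_ac)
  have ij: "integrable gauss (\<lambda>x :: real ^ 'n. x $ i * x $ j)" for i j
  proof (rule Bochner_Integration.integrable_bound[OF gauss_norm_integrable(1)])
    show "AE x :: real ^ 'n in gauss. norm (x $ i * x $ j) \<le> norm ((norm x)\<^sup>2)"
      by (auto simp: abs_mult power2_eq_square intro!: mult_mono component_le_norm_cart)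
  qed measurable
  show "integrable gauss (\<lambda>x. x \<bullet> (A *v x))"
    unfolding e by (intro Bochner_Integration.integrable_sum integrable_mult_right ij)
  have "(\<integral>x. x $ i * x $ j \<partial>gauss) = (if i = j then 1 else 0)" for i j :: 'n
    using gauss_moments(3)[of j] gauss_moments(4)[of i j] by (auto simp: power2_eq_square)
  then have "(\<integral>x. x \<bullet> (A *v x) \<partial>gauss) = (\<Sum>i\<in>UNIV. \<Sum>j\<in>UNIV. A $ i $ j * (if i = j then 1 else 0))"
    unfolding e using ij by (simp add: Bochner_Integration.integral_sum)
  then show "(\<integral>x. x \<bullet> (A *v x) \<partial>gauss) = trace A"
    by (simp add: trace_def if_distrib cong: if_cong)
qed

text \<open>
  Only \<open>a\<^sup>2 + b\<^sup>2\<close> matters for the law of \<open>a X + b Y\<close>; comparing \<open>(a, b)\<close> with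
  \<open>(sqrt (a\<^sup>2 + b\<^sup>2), 0)\<close> is the semigroup property of the heat flow.
\<close>

lemma std_normal_pair_law_cong:
  fixes a b c d :: real
  assumes "a\<^sup>2 + b\<^sup>2 = c\<^sup>2 + d\<^sup>2"
  shows "distr (std_normal_distribution \<Otimes>\<^sub>M std_normal_distribution) borel (\<lambda>z. a * fst z + b * snd z)
    = distr (std_normal_distribution \<Otimes>\<^sub>M std_normal_distribution) borel (\<lambda>z. c * fst z + d * snd z)"
proof -
  interpret N: prob_space std_normal_distribution by (rule prob_space_std_normal)
  interpret NN: pair_prob_space std_normal_distribution std_normal_distribution ..
  let ?NN = "std_normal_distribution \<Otimes>\<^sub>M std_normal_distribution"
  \<comment> \<open>By independence the characteristic function is a product of two Gaussian ones,
    and it sees (a, b) only through the sum of squares.\<close>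
  have char: "char (distr ?NN borel (\<lambda>z. a * fst z + b * snd z)) t = complex_of_real (exp (- (a\<^sup>2 + b\<^sup>2) * t\<^sup>2 / 2))"
    for a b t
  proof -
    have ii: "integrable ?NN (\<lambda>z. iexp (t * (a * fst z + b * snd z)))"
      by (rule NN.integrable_const_bound[where B=1]) (auto simp: norm_exp_i_times)
    have "char (distr ?NN borel (\<lambda>z. a * fst z + b * snd z)) t = (\<integral>z. iexp (t * (a * fst z + b * snd z)) \<partial>?NN)"
      unfolding char_def by (subst integral_distr) auto
    also have "\<dots> = (\<integral>r. (\<integral>s. iexp (t * (a * r + b * s)) \<partial>std_normal_distribution) \<partial>std_normal_distribution)"
      using NN.integral_fst'[OF ii] by simp
    also have "\<dots> = (\<integral>r. (\<integral>s. iexp (t * a * r) * iexp (t * b * s) \<partial>std_normal_distribution) \<partial>std_normal_distribution)"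
      by (simp add: exp_add[symmetric] algebra_simps)
    also have "\<dots> = char std_normal_distribution (t * a) * char std_normal_distribution (t * b)"
      unfolding char_def by (simp add: mult.assoc)
    also have "\<dots> = complex_of_real (exp (- (a\<^sup>2 + b\<^sup>2) * t\<^sup>2 / 2))"
      unfolding char_std_normal_distribution of_real_mult[symmetric] exp_add[symmetric]
      by (simp add: power_mult_distrib add_divide_distrib algebra_simps)
    finally show ?thesis .
  qed
  have rd: "real_distribution (distr ?NN borel (\<lambda>z. a * fst z + b * snd z))" for a b
    unfolding real_distribution_def real_distribution_axioms_def
    by (auto intro!: NN.prob_space_distr)
  show ?thesis by (rule Levy_uniqueness[OF rd rd]) (simp add: fun_eq_iff char assms)
qed

text \<open>Reduction to dimension one: coordinates are independent, so the combination has a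
  product law. The two laws are compared on boxes, where the integral over the two product spaces
  factorises one space at a time.\<close>

lemma PiM_std_normal_linear_combination:
  fixes a b :: real
  defines "\<nu> \<equiv> distr (std_normal_distribution \<Otimes>\<^sub>M std_normal_distribution) borel (\<lambda>z. a * fst z + b * snd z)"
  shows "distr (PiM (UNIV :: 'n::finite set) std_normal_family \<Otimes>\<^sub>M PiM UNIV std_normal_family)
      (PiM UNIV (\<lambda>_. \<nu>)) (\<lambda>z i. a * fst z i + b * snd z i) = PiM UNIV (\<lambda>_. \<nu>)"
proof -
  interpret P: product_prob_space std_normal_family "UNIV :: 'n set" by (rule product_prob_space_std_normal)
  interpret N: prob_space std_normal_distribution by (rule prob_space_std_normal)
  interpret NN: pair_prob_space std_normal_distribution std_normal_distribution ..
  let ?P = "PiM (UNIV :: 'n set) std_normal_family"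
  have pn: "prob_space \<nu>" unfolding \<nu>_def by (rule NN.prob_space_distr) simp
  then interpret Q: product_prob_space "\<lambda>_ :: 'n. \<nu>" UNIV
    by (auto simp: product_prob_space_def product_prob_space_axioms_def product_sigma_finite_def
      prob_space_imp_sigma_finite)
  have s[measurable_cong]: "sets \<nu> = sets borel" by (simp add: \<nu>_def)
  have m[measurable]: "(\<lambda>z i. a * fst z i + b * snd z i) \<in> measurable (?P \<Otimes>\<^sub>M ?P) (PiM UNIV (\<lambda>_. \<nu>))"
    by (rule measurable_PiM_single') (auto simp: space_PiM measurable_cong_sets[OF refl s] sets_eq_imp_space_eq[OF s])
  show ?thesis
  proof (rule Q.PiM_eqI)
    fix A :: "'n \<Rightarrow> real set" assume A: "\<And>i. i \<in> UNIV \<Longrightarrow> A i \<in> sets \<nu>"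
    then have [measurable]: "A i \<in> sets borel" for i using s by auto
    have "PiE UNIV A \<in> sets (PiM UNIV (\<lambda>_ :: 'n. \<nu>))" using A by (intro sets_PiM_I_finite) auto
    then have "emeasure (distr (?P \<Otimes>\<^sub>M ?P) (PiM UNIV (\<lambda>_. \<nu>)) (\<lambda>z i. a * fst z i + b * snd z i)) (PiE UNIV A)
        = (\<integral>\<^sup>+z. indicator (PiE UNIV A) (\<lambda>i. a * fst z i + b * snd z i) \<partial>(?P \<Otimes>\<^sub>M ?P))"
      by (subst nn_integral_indicator[symmetric], simp) (subst nn_integral_distr, auto)
    also have "\<dots> = (\<integral>\<^sup>+z. (\<Prod>i\<in>UNIV. indicator (A i) (a * fst z i + b * snd z i)) \<partial>(?P \<Otimes>\<^sub>M ?P))"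
      by (intro nn_integral_cong) (auto simp: indicator_def PiE_def Pi_iff extensional_def)
    also have "\<dots> = (\<integral>\<^sup>+f. (\<integral>\<^sup>+g. (\<Prod>i\<in>UNIV. indicator (A i) (a * f i + b * g i)) \<partial>?P) \<partial>?P)"
      by (subst P.P.nn_integral_fst[symmetric]) auto
    also have "\<dots> = (\<integral>\<^sup>+f. (\<Prod>i\<in>UNIV. \<integral>\<^sup>+s. indicator (A i) (a * f i + b * s) \<partial>std_normal_distribution) \<partial>?P)"
      by (subst P.product_nn_integral_prod) auto
    also have "\<dots> = (\<Prod>i\<in>UNIV. \<integral>\<^sup>+r. (\<integral>\<^sup>+s. indicator (A i) (a * r + b * s) \<partial>std_normal_distribution) \<partial>std_normal_distribution)"
      by (rule P.product_nn_integral_prod) auto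
    also have "\<dots> = (\<Prod>i\<in>UNIV. emeasure \<nu> (A i))"
    proof (rule prod.cong[OF refl])
      fix i
      have "emeasure \<nu> (A i) = (\<integral>\<^sup>+z. indicator (A i) (a * fst z + b * snd z) \<partial>(std_normal_distribution \<Otimes>\<^sub>M std_normal_distribution))"
        unfolding \<nu>_def by (subst nn_integral_indicator[symmetric], simp) (subst nn_integral_distr, auto)
      also have "\<dots> = (\<integral>\<^sup>+r. (\<integral>\<^sup>+s. indicator (A i) (a * r + b * s) \<partial>std_normal_distribution) \<partial>std_normal_distribution)"
        by (subst sigma_finite_measure.nn_integral_fst[OF prob_space_imp_sigma_finite[OF prob_space_std_normal], symmetric]) auto
      finally show "(\<integral>\<^sup>+r. (\<integral>\<^sup>+s. indicator (A i) (a * r + b * s) \<partial>std_normal_distribution) \<partial>std_normal_distribution) = emeasure \<nu> (A i)" ..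
    qed
    finally show "emeasure (distr (?P \<Otimes>\<^sub>M ?P) (PiM UNIV (\<lambda>_. \<nu>)) (\<lambda>z i. a * fst z i + b * snd z i)) (PiE UNIV A)
        = (\<Prod>i\<in>UNIV. emeasure \<nu> (A i))" .
  qed auto
qed

lemma gauss_pair_law:
  fixes a b c d :: real
  assumes "a\<^sup>2 + b\<^sup>2 = c\<^sup>2 + d\<^sup>2"
  shows "distr (gauss \<Otimes>\<^sub>M gauss) borel (\<lambda>z. a *\<^sub>R fst z + b *\<^sub>R snd z)
    = distr (gauss \<Otimes>\<^sub>M gauss) borel (\<lambda>z :: (real ^ 'n) \<times> (real ^ 'n). c *\<^sub>R fst z + d *\<^sub>R snd z)"
proof -
  interpret P: product_prob_space std_normal_family "UNIV :: 'n set" by (rule product_prob_space_std_normal)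
  let ?P = "PiM (UNIV :: 'n set) std_normal_family"
  let ?N = "std_normal_distribution \<Otimes>\<^sub>M std_normal_distribution"
  have gg: "gauss \<Otimes>\<^sub>M (gauss :: (real ^ 'n) measure)
      = distr (?P \<Otimes>\<^sub>M ?P) (borel \<Otimes>\<^sub>M borel) (\<lambda>(f, g). ((\<chi> i. f i), (\<chi> i. g i)))"
    unfolding gauss_def
    by (rule pair_measure_distr)
      (auto intro!: prob_space_imp_sigma_finite prob_space_gauss[unfolded gauss_def])
  have [measurable]: "(\<lambda>f. \<chi> i. (f i :: real)) \<in> measurable ?P borel" by measurable
  have key: "distr (gauss \<Otimes>\<^sub>M gauss) borel (\<lambda>z :: (real ^ 'n) \<times> (real ^ 'n). a *\<^sub>R fst z + b *\<^sub>R snd z)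
      = distr (PiM (UNIV :: 'n set) (\<lambda>_. distr ?N borel (\<lambda>z. a * fst z + b * snd z))) borel (\<lambda>f. \<chi> i. f i)"
    for a b :: real
  proof -
    let ?\<nu> = "distr ?N borel (\<lambda>z. a * fst z + b * snd z)"
    have s: "sets ?\<nu> = sets borel" by simp
    have m1[measurable]: "(\<lambda>z i. a * fst z i + b * snd z i) \<in> measurable (?P \<Otimes>\<^sub>M ?P) (PiM UNIV (\<lambda>_. ?\<nu>))"
      by (rule measurable_PiM_single') (auto simp: space_PiM)
    have m2[measurable]: "(\<lambda>f. \<chi> i. f i) \<in> borel_measurable (PiM (UNIV :: 'n set) (\<lambda>_. ?\<nu>))"
      by (rule borel_measurable_vec_lambda) measurable
    have m3: "(\<lambda>(f, g). ((\<chi> i. f i), (\<chi> i. g i))) \<in> measurable (?P \<Otimes>\<^sub>M ?P) (borel \<Otimes>\<^sub>M (borel :: (real ^ 'n) measure))"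
      by measurable
    have m4: "(\<lambda>z :: (real ^ 'n) \<times> (real ^ 'n). a *\<^sub>R fst z + b *\<^sub>R snd z) \<in> measurable (borel \<Otimes>\<^sub>M borel) borel"
      by measurable
    have "distr (gauss \<Otimes>\<^sub>M gauss) borel (\<lambda>z :: (real ^ 'n) \<times> (real ^ 'n). a *\<^sub>R fst z + b *\<^sub>R snd z)
        = distr (?P \<Otimes>\<^sub>M ?P) borel (\<lambda>z. \<chi> i. a * fst z i + b * snd z i)"
      unfolding gg distr_distr[OF m4 m3]
      by (rule arg_cong[where f="distr _ _"]) (auto simp: fun_eq_iff vec_eq_iff)
    also have "\<dots> = distr (distr (?P \<Otimes>\<^sub>M ?P) (PiM UNIV (\<lambda>_. ?\<nu>)) (\<lambda>z i. a * fst z i + b * snd z i)) borel (\<lambda>f. \<chi> i. f i)"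
      by (subst distr_distr[OF m2 m1]) (simp add: comp_def)
    finally show ?thesis unfolding PiM_std_normal_linear_combination .
  qed
  show ?thesis by (simp only: key std_normal_pair_law_cong[OF assms])
qed

section \<open>The heat flow\<close>

text \<open>A fixed Gaussian measure is scaled by \<open>sqrt s\<close> instead of using the heat
  kernel, so time zero is included. The general value type covers a function, its gradient and its
  Hessian at once.\<close>

definition heat :: "real \<Rightarrow> (real ^ 'n \<Rightarrow> 'b::{banach, second_countable_topology}) \<Rightarrow> real ^ 'n \<Rightarrow> 'b" where
  "heat s f x = (\<integral>y. f (x + sqrt s *\<^sub>R y) \<partial>gauss)"

lemma L2_scaleR: "\<xi> \<in> L2 M \<Longrightarrow> (\<lambda>w. c *\<^sub>R \<xi> w) \<in> L2 M"
  by (auto simp: L2_def power_mult_distrib)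

lemma gauss_in_P2: "gauss \<in> P2"
  unfolding P2_def using prob_space_gauss gauss_norm_integrable(1) by simp

lemma heat_arg_L2:
  fixes x :: "real ^ 'n"
  shows "(\<lambda>y. x + c *\<^sub>R y) \<in> L2 gauss"
proof -
  interpret prob_space "gauss :: (real ^ 'n) measure" by (rule prob_space_gauss)
  show ?thesis by (intro L2_add L2_const L2_scaleR gauss_norm_integrable(5))
qed

lemma heat_0:
  fixes x :: "real ^ 'n"
  shows "heat 0 f x = f x"
proof -
  interpret prob_space "gauss :: (real ^ 'n) measure" by (rule prob_space_gauss)
  show ?thesis by (simp add: heat_def prob_space)
qed

lemma heat_eq_law_integral:
  fixes f :: "real ^ 'n \<Rightarrow> 'b::{banach, second_countable_topology}"
  assumes "f \<in> borel_measurable borel"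
  shows "heat s f z = (\<integral>x. f (x + z) \<partial>law gauss (\<lambda>y. sqrt s *\<^sub>R y))"
proof -
  note [measurable] = assms
  show ?thesis unfolding heat_def by (subst integral_law) (auto simp: add.commute)
qed

lemma heat_taylor2:
  fixes f :: "real ^ 'n \<Rightarrow> real"
  assumes "taylor2 C f f1 f2"
  shows "taylor2 C (heat s f) (heat s f1) (heat s f2)"
proof -
  have "law gauss (\<lambda>y :: real ^ 'n. sqrt s *\<^sub>R y) \<in> P2"
    by (intro law_in_P2 prob_space_gauss L2_scaleR gauss_norm_integrable(5))
  from taylor2_average[OF this assms] show ?thesis
    unfolding taylor2_measurable[OF assms, THEN heat_eq_law_integral, abs_def, symmetric] .
qed

text \<open>Fubini merges both averages into one over a pair of independent Gaussians, and
  \<open>gauss_pair_law\<close> replaces (\<open>sqrt a\<close>, \<open>sqrt b\<close>) by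
  (\<open>sqrt (a + b)\<close>, 0).\<close>

lemma heat_semigroup:
  fixes f :: "real ^ 'n \<Rightarrow> 'b::{banach, second_countable_topology}"
  assumes lip: "\<And>x y. norm (f x - f y) \<le> C * norm (x - y)" and ab: "0 \<le> a" "0 \<le> b"
  shows "heat a (heat b f) x = heat (a + b) f x"
proof -
  let ?GG = "gauss \<Otimes>\<^sub>M gauss :: ((real ^ 'n) \<times> (real ^ 'n)) measure"
  interpret g: prob_space "gauss :: (real ^ 'n) measure" by (rule prob_space_gauss)
  interpret pair_prob_space "gauss :: (real ^ 'n) measure" "gauss :: (real ^ 'n) measure" ..
  note cp = couplingsD[OF pair_measure_in_couplings[OF gauss_in_P2 gauss_in_P2] gauss_in_P2 gauss_in_P2]
  have L: "(\<lambda>z. c *\<^sub>R fst z + d *\<^sub>R snd z) \<in> L2 ?GG" for c d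
    by (intro L2_add L2_scaleR cp(2,3))
  have lipx: "norm (f (x + y) - f (x + z)) \<le> C * norm (y - z)" for y z
    using lip[of "x + y" "x + z"] by simp
  note [measurable] = lipschitz_imp_borel_measurable(2)[OF lipx]
  have fub: "(\<integral>z. f (x + (c *\<^sub>R fst z + d *\<^sub>R snd z)) \<partial>?GG) = (\<integral>y. (\<integral>w. f (x + (c *\<^sub>R y + d *\<^sub>R w)) \<partial>gauss) \<partial>gauss)" for c d
    using integral_fst'[OF lipschitz_integrable[OF cp(1) L lipx], of c d] by simp
  have law: "(\<integral>z. f (x + (c *\<^sub>R fst z + d *\<^sub>R snd z)) \<partial>?GG)
      = (\<integral>v. f (x + v) \<partial>distr ?GG borel (\<lambda>z. c *\<^sub>R fst z + d *\<^sub>R snd z))" for c d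
    by (subst integral_distr) auto
  have "heat a (heat b f) x = (\<integral>z. f (x + (sqrt a *\<^sub>R fst z + sqrt b *\<^sub>R snd z)) \<partial>?GG)"
    unfolding heat_def fub by (simp add: add.assoc)
  also have "\<dots> = (\<integral>z. f (x + (sqrt (a + b) *\<^sub>R fst z + 0 *\<^sub>R snd z)) \<partial>?GG)"
    unfolding law using ab by (subst gauss_pair_law[of "sqrt a" "sqrt b" "sqrt (a + b)" 0]) auto
  also have "\<dots> = heat (a + b) f x"
    unfolding heat_def fub by (simp add: g.prob_space)
  finally show ?thesis .
qed

text \<open>Uses nothing but the Lipschitz bound, hence the square root modulus. It is meant for the
  Hessian, of which no further derivative is available.\<close>

lemma heat_lipschitz_time:
  fixes f :: "real ^ 'n \<Rightarrow> 'b::{banach, second_countable_topology}"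
  assumes lip: "\<And>x y. norm (f x - f y) \<le> C * norm (x - y)"
  shows "norm (heat s f x - heat r f x) \<le> C * \<bar>sqrt s - sqrt r\<bar> * (\<integral>y. norm y \<partial>(gauss :: (real ^ 'n) measure))"
proof -
  note i = lipschitz_integrable[OF prob_space_gauss heat_arg_L2 lip]
  have "heat s f x - heat r f x = (\<integral>y. f (x + sqrt s *\<^sub>R y) - f (x + sqrt r *\<^sub>R y) \<partial>gauss)"
    unfolding heat_def using i by simp
  also have "norm \<dots> \<le> (\<integral>y. C * \<bar>sqrt s - sqrt r\<bar> * norm y \<partial>(gauss :: (real ^ 'n) measure))"
  proof (rule order_trans[OF integral_norm_bound integral_mono'])
    show "norm (f (x + sqrt s *\<^sub>R y) - f (x + sqrt r *\<^sub>R y)) \<le> C * \<bar>sqrt s - sqrt r\<bar> * norm y" for y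
      using lip[of "x + sqrt s *\<^sub>R y" "x + sqrt r *\<^sub>R y"]
      by (simp add: scaleR_left_diff_distrib[symmetric] mult.assoc)
    then show "0 \<le> C * \<bar>sqrt s - sqrt r\<bar> * norm y" for y :: "real ^ 'n"
      using norm_ge_zero order_trans by blast
  qed (simp add: gauss_norm_integrable(3))
  finally show ?thesis by simp
qed

text \<open>Taylor expansion at x under the Gaussian average: linear terms vanish because the mean
  is zero, the quadratic form averages to the trace, and the cubic remainder leaves an error of
  order \<open>sqrt s * s\<close>. The gradient likewise loses its linear term, so its error is of
  order s.\<close>

lemma heat_expansion:
  fixes f :: "real ^ 'n \<Rightarrow> real"
  assumes t: "taylor2 C f f1 f2" and s: "0 \<le> s"
  shows "\<bar>heat s f x - f x - s / 2 * trace (f2 x)\<bar>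
      \<le> C * (sqrt s * s) * (\<integral>y. norm y ^ 3 \<partial>(gauss :: (real ^ 'n) measure))"
    and "norm (heat s f1 x - f1 x) \<le> C * s * (\<integral>y. (norm y)\<^sup>2 \<partial>(gauss :: (real ^ 'n) measure))"
proof -
  let ?G = "gauss :: (real ^ 'n) measure"
  interpret prob_space ?G by (rule prob_space_gauss)
  note C = taylor2_nonneg[OF t]
  note i = taylor2_integrable[OF t heat_arg_L2[of x "sqrt s"]]
  have iy: "integrable ?G (\<lambda>y. y)" by (rule gauss_norm_integrable(4))
  note q = gauss_quadratic_form[of "f2 x"]
  have mean: "(\<integral>y. c \<bullet> y \<partial>?G) = 0" "integrable ?G (\<lambda>y. c \<bullet> y)" for c
    using integral_bounded_linear[OF bounded_linear_inner_right iy, of c]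
      integrable_bounded_linear[OF bounded_linear_inner_right iy, of c] by (simp_all add: gauss_mean)
  have meanv: "(\<integral>y. f2 x *v y \<partial>?G) = 0" "integrable ?G (\<lambda>y. f2 x *v y)"
    using integral_bounded_linear[OF matrix_vector_mul_bounded_linear iy, of "f2 x"]
      integrable_bounded_linear[OF matrix_vector_mul_bounded_linear iy, of "f2 x"] by (simp_all add: gauss_mean)
  have "(\<integral>y. f (x + sqrt s *\<^sub>R y) - f x - f1 x \<bullet> (sqrt s *\<^sub>R y) - ((sqrt s *\<^sub>R y) \<bullet> (f2 x *v (sqrt s *\<^sub>R y))) / 2 \<partial>?G)
      = heat s f x - f x - s / 2 * trace (f2 x)"
    unfolding heat_def using i(1) mean q s
    by (simp add: prob_space matrix_vector_mult_scaleR mult.assoc[symmetric])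
  moreover have "norm (\<integral>y. f (x + sqrt s *\<^sub>R y) - f x - f1 x \<bullet> (sqrt s *\<^sub>R y) - ((sqrt s *\<^sub>R y) \<bullet> (f2 x *v (sqrt s *\<^sub>R y))) / 2 \<partial>?G)
      \<le> (\<integral>y. C * (sqrt s * s) * norm y ^ 3 \<partial>?G)"
  proof (rule order_trans[OF integral_norm_bound integral_mono'])
    fix y :: "real ^ 'n"
    have "(norm (sqrt s *\<^sub>R y)) ^ 3 = sqrt s * s * norm y ^ 3"
      using s by (simp add: power_mult_distrib power3_eq_cube)
    then show "norm (f (x + sqrt s *\<^sub>R y) - f x - f1 x \<bullet> (sqrt s *\<^sub>R y) - ((sqrt s *\<^sub>R y) \<bullet> (f2 x *v (sqrt s *\<^sub>R y))) / 2)
        \<le> C * (sqrt s * s) * norm y ^ 3"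
      using taylor2D(8)[OF t, of x "sqrt s *\<^sub>R y"] by (simp add: mult.assoc)
    show "0 \<le> C * (sqrt s * s) * norm y ^ 3" using C s by simp
  qed (simp add: gauss_norm_integrable(2))
  ultimately show "\<bar>heat s f x - f x - s / 2 * trace (f2 x)\<bar> \<le> C * (sqrt s * s) * (\<integral>y. norm y ^ 3 \<partial>?G)"
    by simp
  have "(\<integral>y. f1 (x + sqrt s *\<^sub>R y) - f1 x - f2 x *v (sqrt s *\<^sub>R y) \<partial>?G) = heat s f1 x - f1 x"
    unfolding heat_def using i(2) meanv by (simp add: prob_space matrix_vector_mult_scaleR)
  moreover have "norm (\<integral>y. f1 (x + sqrt s *\<^sub>R y) - f1 x - f2 x *v (sqrt s *\<^sub>R y) \<partial>?G)
      \<le> (\<integral>y. C * s * (norm y)\<^sup>2 \<partial>?G)"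
  proof (rule order_trans[OF integral_norm_bound integral_mono'])
    fix y :: "real ^ 'n"
    show "norm (f1 (x + sqrt s *\<^sub>R y) - f1 x - f2 x *v (sqrt s *\<^sub>R y)) \<le> C * s * (norm y)\<^sup>2"
      using taylor2D(7)[OF t, of "x + sqrt s *\<^sub>R y" x] s by (simp add: power_mult_distrib mult.assoc)
    show "0 \<le> C * s * (norm y)\<^sup>2" using C s by simp
  qed (simp add: gauss_norm_integrable(1))
  ultimately show "norm (heat s f1 x - f1 x) \<le> C * s * (\<integral>y. (norm y)\<^sup>2 \<partial>?G)" by simp
qed

lemma sqrt_diff_le: "0 \<le> r \<Longrightarrow> r \<le> s \<Longrightarrow> sqrt s - sqrt r \<le> sqrt (s - r)"
  using sqrt_add_le_add_sqrt[of "s - r" r] by simp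

text \<open>By the semigroup property a step from r forward to s is a step from time zero for the
  datum \<open>heat r f\<close>, with the same constant. A step backwards is the forward step from
  s, corrected for evaluating the Hessian at r instead of s.\<close>

lemma heat_time_regularity:
  fixes f :: "real ^ 'n \<Rightarrow> real"
  assumes t: "taylor2 C f f1 f2"
  obtains K where "0 \<le> K"
    "\<And>r s x. 0 \<le> r \<Longrightarrow> 0 \<le> s \<Longrightarrow>
      \<bar>heat s f x - heat r f x - (s - r) / 2 * trace (heat r f2 x)\<bar> \<le> K * (sqrt \<bar>s - r\<bar> * \<bar>s - r\<bar>)"
    "\<And>r s x. 0 \<le> r \<Longrightarrow> 0 \<le> s \<Longrightarrow> norm (heat s f1 x - heat r f1 x) \<le> K * \<bar>s - r\<bar>"
    "\<And>r s x. 0 \<le> r \<Longrightarrow> 0 \<le> s \<Longrightarrow> norm (heat s f2 x - heat r f2 x) \<le> K * sqrt \<bar>s - r\<bar>"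
proof -
  let ?G = "gauss :: (real ^ 'n) measure"
  define m1 m2 m3 where "m1 = (\<integral>y. norm y \<partial>?G)" and "m2 = (\<integral>y. (norm y)\<^sup>2 \<partial>?G)" and "m3 = (\<integral>y. norm y ^ 3 \<partial>?G)"
  have m: "0 \<le> m1" "0 \<le> m2" "0 \<le> m3" by (simp_all add: m1_def m2_def m3_def)
  note C = taylor2_nonneg[OF t]
  obtain L where L: "0 \<le> L" "\<And>A :: real ^ 'n ^ 'n. norm (trace A) \<le> norm A * L"
    using bounded_linear.nonneg_bounded[OF bounded_linear_trace] by blast
  \<comment> \<open>The summands serve, in this order, the forward expansion, the correction in the
    backward expansion, the gradient and the Hessian.\<close>
  define K where "K = C * m3 + C * m1 * L + C * m2 + C * m1"
  have K: "0 \<le> K" "C * m3 \<le> K" "C * m3 + C * m1 * L \<le> K" "C * m2 \<le> K" "C * m1 \<le> K"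
    using C m L by (auto simp: K_def)
  have semi: "heat s f x = heat (s - r) (heat r f) x" "heat s f1 x = heat (s - r) (heat r f1) x"
    if "0 \<le> r" "r \<le> s" for r s x
    using heat_semigroup[of f C "s - r" r x] heat_semigroup[of f1 C "s - r" r x] taylor2D(3,4)[OF t] that by auto
  have c2: "norm (heat s f2 x - heat r f2 x) \<le> C * m1 * sqrt \<bar>s - r\<bar>" if "0 \<le> r" "0 \<le> s" for r s x
  proof -
    have d: "\<bar>sqrt s - sqrt r\<bar> \<le> sqrt \<bar>s - r\<bar>"
      using sqrt_diff_le[of r s] sqrt_diff_le[of s r] that by (cases "r \<le> s") (auto simp: abs_if)
    have "norm (heat s f2 x - heat r f2 x) \<le> C * \<bar>sqrt s - sqrt r\<bar> * m1"
      unfolding m1_def by (rule heat_lipschitz_time[OF taylor2D(5)[OF t]])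
    also have "\<dots> \<le> C * sqrt \<bar>s - r\<bar> * m1" using d C m by (intro mult_right_mono mult_left_mono) auto
    finally show ?thesis by (simp add: mult_ac)
  qed
  have e0: "\<bar>heat s f x - heat r f x - (s - r) / 2 * trace (heat r f2 x)\<bar> \<le> C * m3 * (sqrt (s - r) * (s - r))"
    if "0 \<le> r" "r \<le> s" for r s x
    using heat_expansion(1)[OF heat_taylor2[OF t], of "s - r" r x] that
    unfolding semi(1)[OF that] m3_def by (simp add: mult_ac)
  have e1: "norm (heat s f1 x - heat r f1 x) \<le> C * m2 * (s - r)" if "0 \<le> r" "r \<le> s" for r s x
    using heat_expansion(2)[OF heat_taylor2[OF t], of "s - r" r x] that
    unfolding semi(2)[OF that] m2_def by (simp add: mult_ac)
  show thesis
  proof (rule that[OF K(1)])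
    fix r s :: real and x assume rs: "0 \<le> r" "0 \<le> s"
    show "norm (heat s f2 x - heat r f2 x) \<le> K * sqrt \<bar>s - r\<bar>"
      by (rule order_trans[OF c2[OF rs] mult_right_mono[OF K(5)]]) simp
    show "norm (heat s f1 x - heat r f1 x) \<le> K * \<bar>s - r\<bar>"
    proof (cases "r \<le> s")
      case True
      then show ?thesis using e1[OF rs(1) True, of x] mult_right_mono[OF K(4), of "s - r"] by auto
    next
      case False
      then have le: "s \<le> r" by simp
      then have "C * m2 * (r - s) \<le> K * (r - s)" by (intro mult_right_mono K(4)) auto
      from order_trans[OF e1[OF rs(2) le] this] show ?thesis using le by (simp add: norm_minus_commute)
    qed
    show "\<bar>heat s f x - heat r f x - (s - r) / 2 * trace (heat r f2 x)\<bar> \<le> K * (sqrt \<bar>s - r\<bar> * \<bar>s - r\<bar>)"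
    proof (cases "r \<le> s")
      case True
      then show ?thesis
        using e0[OF rs(1) True, of x] mult_right_mono[OF K(2), of "sqrt (s - r) * (s - r)"] by auto
    next
      case False
      then have le: "s \<le> r" by simp
      let ?d = "sqrt (r - s) * (r - s)"
      \<comment> \<open>Price of exchanging the Hessian at s for the one at r: its square root
        modulus times the step, of the same order as the forward error.\<close>
      have "\<bar>trace (heat r f2 x - heat s f2 x)\<bar> \<le> (C * m1 * sqrt (r - s)) * L"
        using order_trans[OF L(2)[of "heat r f2 x - heat s f2 x"] mult_right_mono[OF c2[OF rs(2,1)] L(1)]] le by simp
      then have "(r - s) * \<bar>trace (heat r f2 x - heat s f2 x)\<bar> \<le> (r - s) * ((C * m1 * sqrt (r - s)) * L)"
        using le by (intro mult_left_mono) auto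
      moreover have "\<bar>(r - s) / 2 * trace (heat r f2 x - heat s f2 x)\<bar> \<le> (r - s) * \<bar>trace (heat r f2 x - heat s f2 x)\<bar>"
        using le unfolding abs_mult by (intro mult_right_mono) auto
      ultimately have "\<bar>(r - s) / 2 * trace (heat r f2 x - heat s f2 x)\<bar> \<le> (r - s) * ((C * m1 * sqrt (r - s)) * L)"
        by linarith
      then have tr: "\<bar>(r - s) / 2 * trace (heat r f2 x - heat s f2 x)\<bar> \<le> C * m1 * L * ?d"
        by (simp add: mult_ac)
      have "heat s f x - heat r f x - (s - r) / 2 * trace (heat r f2 x)
          = - (heat r f x - heat s f x - (r - s) / 2 * trace (heat s f2 x))
            + (r - s) / 2 * trace (heat r f2 x - heat s f2 x)"
        by (simp add: trace_sub field_simps)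
      then have "\<bar>heat s f x - heat r f x - (s - r) / 2 * trace (heat r f2 x)\<bar> \<le> C * m3 * ?d + C * m1 * L * ?d"
        using e0[OF rs(2) le, of x] tr by linarith
      also have "\<dots> = (C * m3 + C * m1 * L) * ?d" by (simp add: distrib_right)
      also have "\<dots> \<le> K * ?d" using le by (intro mult_right_mono K(3)) auto
      finally show ?thesis using le by (simp only: abs_minus_commute[of s r] abs_of_nonneg diff_ge_0_iff_ge)
    qed
  qed
qed

section \<open>The value function as a function of time\<close>

lemma lebesgue_integral_Icc:
  fixes f :: "real \<Rightarrow> 'b::euclidean_space"
  assumes "continuous_on {a..b} f"
  shows "integrable (restrict_space lborel {a..b}) f"
    and "(\<integral>s. f s \<partial>restrict_space lborel {a..b}) = integral {a..b} f"
proof -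
  have "set_integrable lborel {a..b} f" by (rule borel_integrable_atLeastAtMost'[OF assms])
  then show "integrable (restrict_space lborel {a..b}) f"
    unfolding set_integrable_def by (simp add: integrable_restrict_space)
  show "(\<integral>s. f s \<partial>restrict_space lborel {a..b}) = integral {a..b} f"
    using set_borel_integral_eq_integral(2)[OF \<open>set_integrable lborel {a..b} f\<close>]
    unfolding set_lebesgue_integral_def by (simp add: integral_restrict_space)
qed

lemma taylor2_interval_integral:
  fixes f2 :: "real \<Rightarrow> real ^ 'n \<Rightarrow> real ^ 'n ^ 'n"
  assumes ab: "a \<le> b" and t: "\<And>s. s \<in> {a..b} \<Longrightarrow> taylor2 C (f s) (f1 s) (f2 s)"
    and c: "\<And>x. continuous_on {a..b} (\<lambda>s. f s x)" "\<And>x. continuous_on {a..b} (\<lambda>s. f1 s x)"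
      "\<And>x. continuous_on {a..b} (\<lambda>s. f2 s x)"
  shows "taylor2 (C * (b - a)) (\<lambda>x. integral {a..b} (\<lambda>s. f s x)) (\<lambda>x. integral {a..b} (\<lambda>s. f1 s x))
    (\<lambda>x. integral {a..b} (\<lambda>s. f2 s x))"
proof -
  let ?M = "restrict_space lborel {a..b}"
  have e: "emeasure ?M (space ?M) = ennreal (b - a)"
    using ab by (simp add: emeasure_restrict_space space_restrict_space)
  then have fm: "finite_measure ?M" by (intro finite_measureI) simp
  have m: "measure ?M (space ?M) = b - a" using e ab by (simp add: measure_def)
  show ?thesis
    using taylor2_integral[OF fm, of C f f1 f2] t lebesgue_integral_Icc(1)[OF c(1)]
      lebesgue_integral_Icc(1)[OF c(2)] lebesgue_integral_Icc(1)[OF c(3)]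
    unfolding m lebesgue_integral_Icc(2)[OF c(1)] lebesgue_integral_Icc(2)[OF c(2)] lebesgue_integral_Icc(2)[OF c(3)]
    by (simp add: space_restrict_space)
qed

lemma integral_tail_increment:
  fixes f :: "real \<Rightarrow> 'b::euclidean_space"
  assumes c: "continuous_on {0..T} f" and rs: "0 \<le> r" "r \<le> s" "s \<le> T"
    and B: "\<And>\<sigma>. \<sigma> \<in> {r..s} \<Longrightarrow> norm (f \<sigma> - c) \<le> B"
  shows "norm (integral {r..T} f - integral {s..T} f - (s - r) *\<^sub>R c) \<le> B * (s - r)"
proof -
  have i: "f integrable_on {r..T}" "f integrable_on {r..s}"
    using rs by (auto intro!: integrable_continuous_real continuous_on_subset[OF c])
  have "integral {r..T} f - integral {s..T} f = integral {r..s} f"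
    using Henstock_Kurzweil_Integration.integral_combine[OF rs(2,3) i(1)] by (simp add: algebra_simps)
  also have "\<dots> - (s - r) *\<^sub>R c = integral {r..s} (\<lambda>\<sigma>. f \<sigma> - c)"
    using i(2) rs by (subst Henstock_Kurzweil_Integration.integral_diff) auto
  also have "norm \<dots> \<le> B * (s - r)"
    using rs B by (intro integral_bound continuous_intros continuous_on_subset[OF c]) auto
  finally show ?thesis .
qed

text \<open>In the modulus, the square root stems from the heat flow, the linear part from the
  motion of momentum and position and from the Hamiltonian.\<close>

lemma has_real_derivative_sqrt_remainder:
  fixes f :: "real \<Rightarrow> real"
  assumes "\<And>s. s \<in> S \<Longrightarrow> \<bar>f s - f t - (s - t) * D\<bar> \<le> K * ((sqrt \<bar>s - t\<bar> + \<bar>s - t\<bar>) * \<bar>s - t\<bar>)"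
  shows "(f has_real_derivative D) (at t within S)"
proof -
  have lim: "((\<lambda>s. K * (sqrt \<bar>s - t\<bar> + \<bar>s - t\<bar>)) \<longlongrightarrow> 0) (at t within S)"
    by (auto intro!: tendsto_eq_intros)
  have "((\<lambda>s. (f s - f t) / (s - t) - D) \<longlongrightarrow> 0) (at t within S)"
  proof (rule Lim_null_comparison[OF _ lim])
    have "norm ((f s - f t) / (s - t) - D) \<le> K * (sqrt \<bar>s - t\<bar> + \<bar>s - t\<bar>)" if "s \<in> S" "s \<noteq> t" for s
    proof -
      have "(f s - f t) / (s - t) - D = (f s - f t - (s - t) * D) / (s - t)"
        using that(2) by (simp add: field_simps)
      then have "norm ((f s - f t) / (s - t) - D) = \<bar>f s - f t - (s - t) * D\<bar> / \<bar>s - t\<bar>"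
        by (simp only: real_norm_def abs_divide)
      also have "\<dots> \<le> K * (sqrt \<bar>s - t\<bar> + \<bar>s - t\<bar>)"
        using assms[OF that(1)] that(2) by (simp add: divide_le_eq mult.assoc)
      finally show ?thesis .
    qed
    then show "\<forall>\<^sub>F s in at t within S. norm ((f s - f t) / (s - t) - D) \<le> K * (sqrt \<bar>s - t\<bar> + \<bar>s - t\<bar>)"
      by (auto simp: eventually_at_filter)
  qed
  then show ?thesis by (simp add: has_field_derivative_iff LIM_zero_iff)
qed

lemma continuous_on_sqrt_modulus:
  fixes f :: "real \<Rightarrow> 'b::real_normed_vector"
  assumes "\<And>s t. s \<in> S \<Longrightarrow> t \<in> S \<Longrightarrow> norm (f s - f t) \<le> K * (sqrt \<bar>s - t\<bar> + \<bar>s - t\<bar>)"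
  shows "continuous_on S f"
  unfolding continuous_on_def
proof
  fix t assume t: "t \<in> S"
  have lim: "((\<lambda>s. K * (sqrt \<bar>s - t\<bar> + \<bar>s - t\<bar>)) \<longlongrightarrow> 0) (at t within S)"
    by (auto intro!: tendsto_eq_intros)
  have "((\<lambda>s. f s - f t) \<longlongrightarrow> 0) (at t within S)"
    by (rule Lim_null_comparison[OF _ lim]) (use assms t in \<open>auto simp: eventually_at_filter\<close>)
  then show "(f \<longlongrightarrow> f t) (at t within S)" by (rule LIM_zero_cancel)
qed

text \<open>The signs follow the decomposition of the time increment of \<open>V\<close> in
  \<open>time_estimates\<close>.\<close>

lemma abs_le_sum7:
  fixes a b c d e f h :: real
  assumes "\<bar>a\<bar> \<le> A" "\<bar>b\<bar> \<le> B" "\<bar>c\<bar> \<le> C" "\<bar>d\<bar> \<le> D" "\<bar>e\<bar> \<le> E" "\<bar>f\<bar> \<le> F" "\<bar>h\<bar> \<le> H"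
  shows "\<bar>a - b + c + d - e + f - h\<bar> \<le> A + B + C + D + E + F + H"
  using assms unfolding abs_le_iff by linarith

section \<open>From the data to the time dependent value function\<close>

locale smooth_data =
  fixes C T :: real
    and F :: "real \<Rightarrow> real ^ 'n \<Rightarrow> real" and F1 F2
    and g :: "real ^ 'n \<Rightarrow> real" and g1 g2
  assumes T_pos: "0 < T" and C_ge_1: "1 \<le> C"
    and g: "taylor2 C g g1 g2"
    and F: "\<And>t. t \<in> {0..T} \<Longrightarrow> taylor2 C (F t) (F1 t) (F2 t)"
    and F_lip: "\<And>s t x. s \<in> {0..T} \<Longrightarrow> t \<in> {0..T} \<Longrightarrow> \<bar>F s x - F t x\<bar> \<le> C * \<bar>s - t\<bar>"
    and F1_cont: "\<And>x. continuous_on {0..T} (\<lambda>t. F1 t x)"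
    and F2_cont: "\<And>x. continuous_on {0..T} (\<lambda>t. F2 t x)"
begin

definition H :: "real \<Rightarrow> real ^ 'n \<Rightarrow> real" where "H t p = integral {t..T} (\<lambda>s. F s p)"
definition H1 :: "real \<Rightarrow> real ^ 'n \<Rightarrow> real ^ 'n" where "H1 t p = integral {t..T} (\<lambda>s. F1 s p)"
definition H2 :: "real \<Rightarrow> real ^ 'n \<Rightarrow> real ^ 'n ^ 'n" where "H2 t p = integral {t..T} (\<lambda>s. F2 s p)"

lemma F_cont: "continuous_on {0..T} (\<lambda>t. F t x)"
  by (rule lipschitz_on_continuous_on[of C], rule lipschitz_onI)
    (use F_lip C_ge_1 in \<open>auto simp: dist_real_def\<close>)

lemma H_taylor2_small:
  assumes "t \<in> {0..T}"
  shows "taylor2 (C * (T - t)) (H t) (H1 t) (H2 t)"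
  unfolding H_def H1_def H2_def using assms
  by (intro taylor2_interval_integral F continuous_on_subset[OF F_cont]
      continuous_on_subset[OF F1_cont] continuous_on_subset[OF F2_cont]) auto

end

text \<open>Stability is the only point at which the two alternative conditions of the theorem
  differ; as an assumption here it allows a common construction.\<close>

locale master_data = smooth_data C T F F1 F2 g g1 g2
  for C T and F :: "real \<Rightarrow> real ^ 'n \<Rightarrow> real" and F1 F2 g g1 g2 +
  assumes stable: "\<And>t \<mu> p q. t \<in> {0..T} \<Longrightarrow> \<mu> \<in> P2 \<Longrightarrow>
      norm (p - q) \<le> 2 * norm ((p - (\<integral>x. heat (T - t) g1 (x + H1 t p) \<partial>\<mu>))
        - (q - (\<integral>x. heat (T - t) g1 (x + H1 t q) \<partial>\<mu>)))"
begin

text \<open>One constant for the heat flow of g and for \<open>H t\<close>, whose own constant is at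
  most \<open>C * T\<close>; the length T may be large in the one-dimensional case.\<close>

definition B :: real where "B = max C (C * T)"

abbreviation "mom t \<equiv> implicit_momentum.mom (heat (T - t) g1) (H1 t)"
abbreviation "pos t \<equiv> implicit_momentum.pos (heat (T - t) g1) (H1 t)"
abbreviation "V t \<equiv> implicit_momentum.val (heat (T - t) g) (heat (T - t) g1) (H t) (H1 t)"

lemma H_taylor2:
  assumes "t \<in> {0..T}"
  shows "taylor2 B (H t) (H1 t) (H2 t)"
proof -
  have "C * (T - t) \<le> B"
    unfolding B_def using assms C_ge_1 by (intro max.coboundedI2 mult_left_mono) auto
  with H_taylor2_small[OF assms] show ?thesis by (rule taylor2_mono)
qed

lemma implicit: "t \<in> {0..T} \<Longrightarrow> implicit_momentum B (heat (T - t) g) (heat (T - t) g1) (heat (T - t) g2) (H t) (H1 t) (H2 t)"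
proof
  assume t: "t \<in> {0..T}"
  show "taylor2 B (heat (T - t) g) (heat (T - t) g1) (heat (T - t) g2)"
    by (rule taylor2_mono[OF heat_taylor2[OF g]]) (simp add: B_def)
  show "taylor2 B (H t) (H1 t) (H2 t)" by (rule H_taylor2[OF t])
  show "1 \<le> B" using C_ge_1 by (simp add: B_def)
qed (rule stable)

lemma H_increment:
  assumes "s \<in> {0..T}" "t \<in> {0..T}"
  shows "\<bar>H s p - H t p + (s - t) * F t p\<bar> \<le> C * (s - t)\<^sup>2" "norm (H1 s p - H1 t p) \<le> C * \<bar>s - t\<bar>"
proof -
  have C: "0 \<le> C" using C_ge_1 by simp
  \<comment> \<open>The free time \<open>\<tau>\<close> in the interval allows F to be evaluated at
    either end point, as needed for s before t and for s after t.\<close>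
  have 1: "\<bar>H r p - H s p - (s - r) * F \<tau> p\<bar> \<le> C * (s - r)\<^sup>2"
    if "r \<in> {0..T}" "s \<in> {0..T}" "r \<le> s" "\<tau> \<in> {r..s}" for r s \<tau>
  proof -
    have "norm (F \<sigma> p - F \<tau> p) \<le> C * (s - r)" if "\<sigma> \<in> {r..s}" for \<sigma>
    proof -
      have "\<bar>F \<sigma> p - F \<tau> p\<bar> \<le> C * \<bar>\<sigma> - \<tau>\<bar>" by (rule F_lip) (use that \<open>r \<in> _\<close> \<open>s \<in> _\<close> \<open>\<tau> \<in> _\<close> in auto)
      also have "\<dots> \<le> C * (s - r)" using that \<open>\<tau> \<in> _\<close> C by (intro mult_left_mono) auto
      finally show ?thesis by simp
    qed
    from integral_tail_increment[OF F_cont _ that(3) _ this]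
    show ?thesis unfolding H_def using that by (simp add: power2_eq_square mult.assoc)
  qed
  show "\<bar>H s p - H t p + (s - t) * F t p\<bar> \<le> C * (s - t)\<^sup>2"
  proof (cases "s \<le> t")
    case True
    then show ?thesis using 1[OF assms True, of t] by (simp add: power2_commute algebra_simps)
  next
    case False
    then show ?thesis using 1[OF assms(2,1), of t] by (simp add: abs_minus_commute algebra_simps)
  qed
  have 2: "norm (H1 r p - H1 s p) \<le> C * (s - r)" if "r \<in> {0..T}" "s \<in> {0..T}" "r \<le> s" for r s
  proof -
    have "norm (F1 \<sigma> p - 0) \<le> C" if "\<sigma> \<in> {r..s}" for \<sigma>
      using taylor2D(1)[OF F, of \<sigma> p] that \<open>r \<in> _\<close> \<open>s \<in> _\<close> by auto
    from integral_tail_increment[OF F1_cont _ that(3) _ this]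
    show ?thesis unfolding H1_def using that by simp
  qed
  show "norm (H1 s p - H1 t p) \<le> C * \<bar>s - t\<bar>"
    using 2[OF assms] 2[OF assms(2,1)] by (cases "s \<le> t") (auto simp: norm_minus_commute)
qed

definition G2m :: "real \<Rightarrow> (real ^ 'n) measure \<Rightarrow> real ^ 'n ^ 'n" where
  "G2m t \<mu> = (\<integral>x. heat (T - t) g2 (x + pos t \<mu>) \<partial>\<mu>)"

definition Vt :: "real \<Rightarrow> (real ^ 'n) measure \<Rightarrow> real" where
  "Vt t \<mu> = - (trace (G2m t \<mu>) / 2 + F t (mom t \<mu>))"

text \<open>The envelope principle in time: momentum and position are Lipschitz in t, their first
  order effects cancel, and what remains is the explicit time dependence of the heat flow and of
  \<open>H\<close>.\<close>

lemma time_estimates: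
  assumes mu: "\<mu> \<in> P2"
  obtains K where "0 \<le> K"
    "\<And>s t. s \<in> {0..T} \<Longrightarrow> t \<in> {0..T} \<Longrightarrow>
      \<bar>V s \<mu> - V t \<mu> - (s - t) * Vt t \<mu>\<bar> \<le> K * ((sqrt \<bar>s - t\<bar> + \<bar>s - t\<bar>) * \<bar>s - t\<bar>)"
    "\<And>s t. s \<in> {0..T} \<Longrightarrow> t \<in> {0..T} \<Longrightarrow> norm (Vt s \<mu> - Vt t \<mu>) \<le> K * (sqrt \<bar>s - t\<bar> + \<bar>s - t\<bar>)"
proof -
  interpret mu: prob_space \<mu> by (rule P2D(1)[OF mu])
  obtain K where K: "0 \<le> K"
    "\<And>r s x. 0 \<le> r \<Longrightarrow> 0 \<le> s \<Longrightarrow>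
      \<bar>heat s g x - heat r g x - (s - r) / 2 * trace (heat r g2 x)\<bar> \<le> K * (sqrt \<bar>s - r\<bar> * \<bar>s - r\<bar>)"
    "\<And>r s x. 0 \<le> r \<Longrightarrow> 0 \<le> s \<Longrightarrow> norm (heat s g1 x - heat r g1 x) \<le> K * \<bar>s - r\<bar>"
    "\<And>r s x. 0 \<le> r \<Longrightarrow> 0 \<le> s \<Longrightarrow> norm (heat s g2 x - heat r g2 x) \<le> K * sqrt \<bar>s - r\<bar>"
    using heat_time_regularity[OF g] by blast
  obtain L where L: "0 \<le> L" "\<And>A :: real ^ 'n ^ 'n. norm (trace A) \<le> norm A * L"
    using bounded_linear.nonneg_bounded[OF bounded_linear_trace] by blast
  have CB: "0 \<le> C" "C \<le> B" "0 \<le> B" using C_ge_1 by (auto simp: B_def)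
  define G G1 G2 where "G t z = (\<integral>x. heat (T - t) g (x + z) \<partial>\<mu>)"
    and "G1 t z = (\<integral>x. heat (T - t) g1 (x + z) \<partial>\<mu>)"
    and "G2 t z = (\<integral>x. heat (T - t) g2 (x + z) \<partial>\<mu>)" for t z
  have GT: "taylor2 C (G t) (G1 t) (G2 t)" for t
    unfolding G_def G1_def G2_def by (rule taylor2_average[OF mu heat_taylor2[OF g]])
  have shift: "(\<lambda>x. x + z) \<in> L2 \<mu>" for z by (intro L2_add P2_id_in_L2(1)[OF mu] mu.L2_const)
  note i = mu.taylor2_integrable[OF heat_taylor2[OF g] shift]
  have nb: "norm (\<integral>x. k x \<partial>\<mu>) \<le> b" if "integrable \<mu> k" "\<And>x. norm (k x) \<le> b"
    for k :: "real ^ 'n \<Rightarrow> 'b::{banach, second_countable_topology}" and b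
    using mu.norm_integral_le_bound[OF that] by (simp add: mu.prob_space)
  have Gd: "\<bar>G s z - G t z + (s - t) / 2 * trace (G2 t z)\<bar> \<le> K * (sqrt \<bar>s - t\<bar> * \<bar>s - t\<bar>)"
    "norm (G1 s z - G1 t z) \<le> K * \<bar>s - t\<bar>" "norm (G2 s z - G2 t z) \<le> K * sqrt \<bar>s - t\<bar>"
    if "s \<in> {0..T}" "t \<in> {0..T}" for s t z
  proof -
    \<comment> \<open>The heat flow runs in the remaining time, which reverses the sign of the
      increment.\<close>
    have T: "0 \<le> T - s" "0 \<le> T - t" "\<bar>(T - s) - (T - t)\<bar> = \<bar>s - t\<bar>" "(T - s) - (T - t) = - (s - t)"
      using that by auto
    have k: "norm (heat (T - s) g x - heat (T - t) g x - (- (s - t)) / 2 * trace (heat (T - t) g2 x)) \<le> K * (sqrt \<bar>s - t\<bar> * \<bar>s - t\<bar>)"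
      "norm (heat (T - s) g1 x - heat (T - t) g1 x) \<le> K * \<bar>s - t\<bar>"
      "norm (heat (T - s) g2 x - heat (T - t) g2 x) \<le> K * sqrt \<bar>s - t\<bar>" for x
      using K(2-4)[OF T(2,1), of x] unfolding T(3) unfolding T(4) real_norm_def .
    have it: "integrable \<mu> (\<lambda>x. trace (heat (T - t) g2 (x + z)))"
      "(\<integral>x. trace (heat (T - t) g2 (x + z)) \<partial>\<mu>) = trace (G2 t z)"
      unfolding G2_def by (rule integrable_bounded_linear[OF bounded_linear_trace i(3)]
          integral_bounded_linear[OF bounded_linear_trace i(3)])+
    have "(\<integral>x. heat (T - s) g (x + z) - heat (T - t) g (x + z) - (- (s - t)) / 2 * trace (heat (T - t) g2 (x + z)) \<partial>\<mu>)
        = G s z - G t z - (- (s - t)) / 2 * trace (G2 t z)"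
      using i it by (simp add: G_def)
    also have "\<dots> = G s z - G t z + (s - t) / 2 * trace (G2 t z)" by (simp add: field_simps)
    finally have eq: "(\<integral>x. heat (T - s) g (x + z) - heat (T - t) g (x + z) - (- (s - t)) / 2 * trace (heat (T - t) g2 (x + z)) \<partial>\<mu>)
        = G s z - G t z + (s - t) / 2 * trace (G2 t z)" .
    have "norm (\<integral>x. heat (T - s) g (x + z) - heat (T - t) g (x + z) - (- (s - t)) / 2 * trace (heat (T - t) g2 (x + z)) \<partial>\<mu>)
        \<le> K * (sqrt \<bar>s - t\<bar> * \<bar>s - t\<bar>)"
      using i it(1) by (intro nb k Bochner_Integration.integrable_diff integrable_mult_right)
    then show "\<bar>G s z - G t z + (s - t) / 2 * trace (G2 t z)\<bar> \<le> K * (sqrt \<bar>s - t\<bar> * \<bar>s - t\<bar>)"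
      unfolding eq real_norm_def .
    have "norm (\<integral>x. heat (T - s) g1 (x + z) - heat (T - t) g1 (x + z) \<partial>\<mu>) \<le> K * \<bar>s - t\<bar>"
      using i by (intro nb k Bochner_Integration.integrable_diff)
    then show "norm (G1 s z - G1 t z) \<le> K * \<bar>s - t\<bar>" using i by (simp add: G1_def)
    have "norm (\<integral>x. heat (T - s) g2 (x + z) - heat (T - t) g2 (x + z) \<partial>\<mu>) \<le> K * sqrt \<bar>s - t\<bar>"
      using i by (intro nb k Bochner_Integration.integrable_diff)
    then show "norm (G2 s z - G2 t z) \<le> K * sqrt \<bar>s - t\<bar>" using i by (simp add: G2_def)
  qed
  define p z where "p t = mom t \<mu>" and "z t = pos t \<mu>" for t
  have z: "z t = H1 t (p t)" if "t \<in> {0..T}" for t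
    unfolding z_def p_def by (rule implicit_momentum.pos_def[OF implicit[OF that]])
  have fp: "p t = G1 t (z t)" if "t \<in> {0..T}" for t
    using implicit_momentum.mom_fixed_point[OF implicit[OF that] mu]
    unfolding implicit_momentum.G1_def[OF implicit[OF that]] p_def z_def G1_def .
  have V: "V t \<mu> = G t (z t) - p t \<bullet> z t + H t (p t)" if "t \<in> {0..T}" for t
    unfolding implicit_momentum.val_def[OF implicit[OF that]] p_def z_def G_def ..
  have Vt: "Vt t \<mu> = - (trace (G2 t (z t)) / 2 + F t (p t))" for t
    unfolding Vt_def G2m_def p_def z_def G2_def ..
  \<comment> \<open>Lipschitz constants in time of p and z. At time t, the residual of the momentum
    of time s has a part from the heat flow of the gradient (K) and one from \<open>H1\<close> (C *
    C), doubled by \<open>mom_stable\<close>. The position follows with the constant B of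
    \<open>H1 t\<close> in p and C in time.\<close>
  define P where "P = 2 * (K + C * C)"
  define Z where "Z = B * P + C"
  have PZ: "0 \<le> P" "0 \<le> Z" using K(1) CB by (auto simp: P_def Z_def)
  have dp: "norm (p s - p t) \<le> P * \<bar>s - t\<bar>" if st: "s \<in> {0..T}" "t \<in> {0..T}" for s t
  proof -
    have "norm (p s - p t) \<le> 2 * norm (p s - G1 t (H1 t (p s)))"
      using implicit_momentum.mom_stable[OF implicit[OF st(2)] mu, of "p s"]
      unfolding implicit_momentum.G1_def[OF implicit[OF st(2)]] p_def G1_def .
    also have "p s - G1 t (H1 t (p s)) = (G1 s (z s) - G1 t (z s)) + (G1 t (z s) - G1 t (H1 t (p s)))"
      using fp[OF st(1)] by simp
    also have "norm \<dots> \<le> K * \<bar>s - t\<bar> + C * (C * \<bar>s - t\<bar>)"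
      unfolding z[OF st(1)] using CB
      by (intro order_trans[OF norm_triangle_ineq add_mono] Gd(2)[OF st]
          order_trans[OF taylor2D(4)[OF GT] mult_left_mono] H_increment(2)[OF st]) auto
    finally show ?thesis by (simp add: P_def algebra_simps)
  qed
  have dz: "norm (z s - z t) \<le> Z * \<bar>s - t\<bar>" if st: "s \<in> {0..T}" "t \<in> {0..T}" for s t
  proof -
    have "z s - z t = (H1 t (p s) - H1 t (p t)) + (H1 s (p s) - H1 t (p s))"
      using z st by simp
    also have "norm \<dots> \<le> B * (P * \<bar>s - t\<bar>) + C * \<bar>s - t\<bar>"
      using CB by (intro order_trans[OF norm_triangle_ineq add_mono] H_increment(2)[OF st]
          order_trans[OF taylor2D(4)[OF H_taylor2[OF st(2)]] mult_left_mono] dp[OF st]) auto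
    finally show ?thesis by (simp add: Z_def algebra_simps)
  qed
  have sq: "norm v ^ 2 \<le> X\<^sup>2 * (\<bar>d\<bar> * \<bar>d\<bar>)" if "norm v \<le> X * \<bar>d\<bar>" for v :: "real ^ 'n" and X d
    using power_mono[OF that norm_ge_zero, of 2] unfolding power_mult_distrib power2_eq_square[of "\<bar>d\<bar>"] .
  \<comment> \<open>The coefficients of the six errors b to h below that are quadratic in the time
    step; only the heat error a is of order 3/2.\<close>
  define Q where "Q = L * C * Z + C * Z\<^sup>2 + C + C * P + B * P\<^sup>2 + P * Z"
  have Q: "0 \<le> Q" using K(1) CB PZ L by (auto simp: Q_def intro!: add_nonneg_nonneg mult_nonneg_nonneg)
  have est: "\<bar>V s \<mu> - V t \<mu> - (s - t) * Vt t \<mu>\<bar> \<le> (K + Q) * ((sqrt \<bar>s - t\<bar> + \<bar>s - t\<bar>) * \<bar>s - t\<bar>)"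
    if st: "s \<in> {0..T}" "t \<in> {0..T}" for s t
  proof -
    let ?d = "\<bar>s - t\<bar>" and ?dp = "p s - p t" and ?dz = "z s - z t"
    note a = Gd(1)[OF st, of "z s"]
    have "norm (trace (G2 t (z s)) - trace (G2 t (z t))) \<le> (C * (Z * ?d)) * L"
      unfolding trace_sub[symmetric] using CB L
      by (intro order_trans[OF L(2) mult_right_mono] order_trans[OF taylor2D(5)[OF GT] mult_left_mono] dz[OF st]) auto
    then have "?d * \<bar>trace (G2 t (z s)) - trace (G2 t (z t))\<bar> \<le> ?d * ((C * (Z * ?d)) * L)"
      by (intro mult_left_mono) auto
    then have b: "\<bar>(s - t) / 2 * (trace (G2 t (z s)) - trace (G2 t (z t)))\<bar> \<le> L * C * Z * (?d * ?d)"
      (is "?l \<le> _")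
    proof -
      have "?l \<le> ?d * \<bar>trace (G2 t (z s)) - trace (G2 t (z t))\<bar>"
        unfolding abs_mult by (intro mult_right_mono) auto
      also have "\<dots> \<le> ?d * ((C * (Z * ?d)) * L)" by fact
      finally show ?thesis by (simp only: mult_ac)
    qed
    have c: "\<bar>G t (z s) - G t (z t) - p t \<bullet> ?dz\<bar> \<le> C * Z\<^sup>2 * (?d * ?d)"
      using order_trans[OF taylor2D(6)[OF GT, of t "z s" "z t"] mult_left_mono[OF sq[OF dz[OF st]] CB(1)]]
      unfolding fp[OF st(2), symmetric] by (simp add: mult.assoc)
    have d: "\<bar>H s (p s) - H t (p s) + (s - t) * F t (p s)\<bar> \<le> C * (?d * ?d)"
      using H_increment(1)[OF st, of "p s"] by (simp add: power2_eq_square)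
    have "?d * \<bar>F t (p s) - F t (p t)\<bar> \<le> ?d * (C * (P * ?d))"
      using CB by (intro mult_left_mono order_trans[OF taylor2D(3)[OF F[OF st(2)]] mult_left_mono] dp[OF st]) auto
    then have e: "\<bar>(s - t) * (F t (p s) - F t (p t))\<bar> \<le> C * P * (?d * ?d)"
      by (simp only: abs_mult mult_ac)
    have f: "\<bar>H t (p s) - H t (p t) - z t \<bullet> ?dp\<bar> \<le> B * P\<^sup>2 * (?d * ?d)"
      using order_trans[OF taylor2D(6)[OF H_taylor2[OF st(2)], of "p s" "p t"] mult_left_mono[OF sq[OF dp[OF st]] CB(3)]]
      unfolding z[OF st(2), symmetric] by (simp add: mult.assoc)
    have "\<bar>?dp \<bullet> ?dz\<bar> \<le> (P * ?d) * (Z * ?d)"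
      using PZ by (intro order_trans[OF Cauchy_Schwarz_ineq2 mult_mono] dp[OF st] dz[OF st]) auto
    then have h: "\<bar>?dp \<bullet> ?dz\<bar> \<le> P * Z * (?d * ?d)" by (simp only: mult_ac)
    \<comment> \<open>One variable is moved at a time: the heat flow at \<open>z s\<close>, its
      trace term back to \<open>z t\<close>, then z; the Hamiltonian at \<open>p s\<close>, F back
      to \<open>p t\<close>, then p. The inner products with \<open>p t\<close> and
      \<open>z t\<close> cancel against the product term, up to the product of both
      increments.\<close>
    have "V s \<mu> - V t \<mu> - (s - t) * Vt t \<mu>
        = (G s (z s) - G t (z s) + (s - t) / 2 * trace (G2 t (z s)))
          - (s - t) / 2 * (trace (G2 t (z s)) - trace (G2 t (z t)))
          + (G t (z s) - G t (z t) - p t \<bullet> ?dz)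
          + (H s (p s) - H t (p s) + (s - t) * F t (p s))
          - (s - t) * (F t (p s) - F t (p t))
          + (H t (p s) - H t (p t) - z t \<bullet> ?dp) - ?dp \<bullet> ?dz"
      unfolding V[OF st(1)] V[OF st(2)] Vt
      by (simp add: algebra_simps inner_commute add_divide_distrib diff_divide_distrib)
    then have "\<bar>V s \<mu> - V t \<mu> - (s - t) * Vt t \<mu>\<bar> \<le> K * (sqrt ?d * ?d) + L * C * Z * (?d * ?d)
        + C * Z\<^sup>2 * (?d * ?d) + C * (?d * ?d) + C * P * (?d * ?d) + B * P\<^sup>2 * (?d * ?d) + P * Z * (?d * ?d)"
      by (simp only: abs_le_sum7[OF a b c d e f h])
    also have "\<dots> = K * (sqrt ?d * ?d) + Q * (?d * ?d)" by (simp only: Q_def distrib_right add.assoc)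
    also have "\<dots> \<le> (K + Q) * (sqrt ?d * ?d) + (K + Q) * (?d * ?d)"
      using K(1) Q by (intro add_mono mult_right_mono) auto
    finally show ?thesis by (simp only: distrib_left distrib_right mult.assoc)
  qed
  define R where "R = K * L + C * Z * L + C + C * P"
  have R: "0 \<le> R" using K(1) CB PZ L by (auto simp: R_def intro!: add_nonneg_nonneg mult_nonneg_nonneg)
  have cont: "norm (Vt s \<mu> - Vt t \<mu>) \<le> R * (sqrt \<bar>s - t\<bar> + \<bar>s - t\<bar>)"
    if st: "s \<in> {0..T}" "t \<in> {0..T}" for s t
  proof -
    let ?d = "\<bar>s - t\<bar>"
    have "norm (G2 s (z s) - G2 t (z t)) \<le> K * sqrt ?d + C * (Z * ?d)"
    proof -
      have "G2 s (z s) - G2 t (z t) = (G2 s (z s) - G2 t (z s)) + (G2 t (z s) - G2 t (z t))" by simp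
      also have "norm \<dots> \<le> K * sqrt ?d + C * (Z * ?d)"
        using CB by (intro order_trans[OF norm_triangle_ineq add_mono] Gd(3)[OF st]
            order_trans[OF taylor2D(5)[OF GT] mult_left_mono] dz[OF st]) auto
      finally show ?thesis .
    qed
    then have tr: "\<bar>trace (G2 s (z s) - G2 t (z t))\<bar> \<le> (K * sqrt ?d + C * (Z * ?d)) * L"
      using order_trans[OF L(2) mult_right_mono[OF _ L(1)]] by simp
    have fs: "\<bar>F s (p s) - F t (p s)\<bar> \<le> C * ?d" by (rule F_lip[OF st])
    have ft: "\<bar>F t (p s) - F t (p t)\<bar> \<le> C * (P * ?d)"
      using CB by (intro order_trans[OF taylor2D(3)[OF F[OF st(2)]] mult_left_mono] dp[OF st]) auto
    have "norm (Vt s \<mu> - Vt t \<mu>) \<le> \<bar>trace (G2 s (z s) - G2 t (z t))\<bar> + \<bar>F s (p s) - F t (p s)\<bar> + \<bar>F t (p s) - F t (p t)\<bar>"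
      unfolding Vt trace_sub real_norm_def by linarith
    also have "\<dots> \<le> (K * sqrt ?d + C * (Z * ?d)) * L + C * ?d + C * (P * ?d)"
      using tr fs ft by linarith
    also have "\<dots> = (K * L) * sqrt ?d + (C * Z * L + C + C * P) * ?d" by (simp add: algebra_simps)
    also have "\<dots> \<le> R * sqrt ?d + R * ?d"
      using K(1) CB PZ L by (intro add_mono mult_right_mono) (auto simp: R_def intro!: add_nonneg_nonneg mult_nonneg_nonneg)
    finally show ?thesis by (simp add: distrib_left)
  qed
  show thesis
  proof (rule that)
    show "0 \<le> K + Q + R" using K(1) Q R by simp
    show "\<bar>V s \<mu> - V t \<mu> - (s - t) * Vt t \<mu>\<bar> \<le> (K + Q + R) * ((sqrt \<bar>s - t\<bar> + \<bar>s - t\<bar>) * \<bar>s - t\<bar>)"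
      if "s \<in> {0..T}" "t \<in> {0..T}" for s t
      by (rule order_trans[OF est[OF that] mult_right_mono]) (use R in auto)
    show "norm (Vt s \<mu> - Vt t \<mu>) \<le> (K + Q + R) * (sqrt \<bar>s - t\<bar> + \<bar>s - t\<bar>)"
      if "s \<in> {0..T}" "t \<in> {0..T}" for s t
      by (rule order_trans[OF cont[OF that] mult_right_mono]) (use K(1) Q in auto)
  qed
qed

lemma V_time_derivative:
  assumes "\<mu> \<in> P2" "t \<in> {0..T}"
  shows "((\<lambda>t. V t \<mu>) has_real_derivative Vt t \<mu>) (at t within {0..T})"
proof -
  obtain K where "\<And>s t. s \<in> {0..T} \<Longrightarrow> t \<in> {0..T} \<Longrightarrow>
      \<bar>V s \<mu> - V t \<mu> - (s - t) * Vt t \<mu>\<bar> \<le> K * ((sqrt \<bar>s - t\<bar> + \<bar>s - t\<bar>) * \<bar>s - t\<bar>)"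
    by (rule time_estimates[OF assms(1)]) (rule that)
  from has_real_derivative_sqrt_remainder[OF this[OF _ assms(2)]] show ?thesis .
qed

lemma V_C1_on_interval:
  assumes "\<mu> \<in> P2"
  shows "C1_on_interval T (\<lambda>t. V t \<mu>)"
proof -
  obtain K where "\<And>s t. s \<in> {0..T} \<Longrightarrow> t \<in> {0..T} \<Longrightarrow> norm (Vt s \<mu> - Vt t \<mu>) \<le> K * (sqrt \<bar>s - t\<bar> + \<bar>s - t\<bar>)"
    by (rule time_estimates[OF assms]) (rule that)
  then have "continuous_on {0..T} (\<lambda>t. Vt t \<mu>)" by (rule continuous_on_sqrt_modulus)
  then show ?thesis unfolding C1_on_interval_def using V_time_derivative[OF assms] by blast
qed

lemma time_deriv_V:
  assumes "\<mu> \<in> P2" and t: "t \<in> {0..<T}"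
  shows "time_deriv V t \<mu> = Vt t \<mu>"
proof -
  have "((\<lambda>s. V s \<mu>) has_real_derivative Vt t \<mu>) (at t within {t..T})"
    using V_time_derivative[OF assms(1), of t] t by (auto intro: DERIV_subset)
  then have "((\<lambda>s. (V s \<mu> - V t \<mu>) / (s - t)) \<longlongrightarrow> Vt t \<mu>) (at_right t)"
    using t by (simp add: has_field_derivative_iff at_within_Icc_at_right)
  then have "((\<lambda>\<delta>. (V (t + \<delta>) \<mu> - V t \<mu>) / \<delta>) \<longlongrightarrow> Vt t \<mu>) (at_right 0)"
    unfolding filterlim_at_right_to_0[of _ _ t] by (simp add: add.commute)
  then show ?thesis unfolding time_deriv_def by (intro tendsto_Lim) auto
qed

text \<open>The mean of \<open>dxdval\<close> has trace \<open>trace (G2m t \<mu>)\<close>, and the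
  mean of \<open>dval\<close> is the momentum by the fixed point equation, so the three terms of the
  equation cancel by the form of \<open>Vt\<close>.\<close>

theorem V_classical_solution:
  fixes M :: "'w measure"
  assumes "filtered_prob_space M Fil T"
  shows "V \<in> C12 M Fil T" "solves_master_equation M Fil T F g V"
proof -
  have pM: "prob_space M" and sub: "\<And>t. t \<in> {0..T} \<Longrightarrow> subalgebra M (Fil t)"
    using assms by (auto simp: filtered_prob_space_def)
  have pr: "prob_space (restr_to_subalg M (Fil t))" if "t \<in> {0..T}" for t
    by (rule prob_space_restr_to_subalg[OF sub[OF that] pM])
  note C2 = implicit_momentum.val_C2_Lip_b[OF implicit pr]
  show "V \<in> C12 M Fil T"
    unfolding C12_def using V_C1_on_interval C2 by blast
  show "solves_master_equation M Fil T F g V"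
    unfolding solves_master_equation_def
  proof (intro conjI ballI impI)
    fix t assume t: "t \<in> {0..<T}"
    then have t': "t \<in> {0..T}" by simp
    interpret I: implicit_momentum B "heat (T - t) g" "heat (T - t) g1" "heat (T - t) g2" "H t" "H1 t" "H2 t"
      by (rule implicit[OF t'])
    have "time_deriv V t \<mu> + 1/2 * (\<integral>\<omega>. trace (I.dxdval \<mu> (\<xi> \<omega>)) \<partial>M) + F t (\<integral>\<omega>. I.dval \<mu> (\<xi> \<omega>) \<partial>M) = 0"
      if mu: "\<mu> \<in> P2" and xi: "\<xi> \<in> borel_measurable M" "law M \<xi> = \<mu>" for \<mu> \<xi>
    proof -
      interpret mu: prob_space \<mu> by (rule P2D(1)[OF mu])
      have shift: "(\<lambda>x. x + I.pos \<mu>) \<in> L2 \<mu>" by (intro L2_add P2_id_in_L2(1)[OF mu] mu.L2_const)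
      note i = mu.taylor2_integrable[OF heat_taylor2[OF g] shift]
      note [measurable] = taylor2_measurable[OF heat_taylor2[OF g], of "T - t"]
        borel_measurable_continuous_onI[OF linear_continuous_on[OF bounded_linear_trace]]
      have "(\<integral>\<omega>. trace (I.dxdval \<mu> (\<xi> \<omega>)) \<partial>M) = (\<integral>x. trace (I.dxdval \<mu> x) \<partial>\<mu>)"
        unfolding xi(2)[symmetric] by (rule integral_law[OF xi(1), symmetric]) (unfold I.dxdval_def, measurable)
      also have "\<dots> = trace (G2m t \<mu>)"
        unfolding I.dxdval_def G2m_def by (rule integral_bounded_linear[OF bounded_linear_trace i(3)])
      finally have 1: "(\<integral>\<omega>. trace (I.dxdval \<mu> (\<xi> \<omega>)) \<partial>M) = trace (G2m t \<mu>)" .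
      have "(\<integral>\<omega>. I.dval \<mu> (\<xi> \<omega>) \<partial>M) = (\<integral>x. I.dval \<mu> x \<partial>\<mu>)"
        unfolding xi(2)[symmetric] by (rule integral_law[OF xi(1), symmetric]) (unfold I.dval_def, measurable)
      also have "\<dots> = I.mom \<mu>"
        using I.mom_fixed_point[OF mu] unfolding I.dval_def I.G1_def by simp
      finally have 2: "(\<integral>\<omega>. I.dval \<mu> (\<xi> \<omega>) \<partial>M) = I.mom \<mu>" .
      show ?thesis unfolding 1 2 time_deriv_V[OF mu t] Vt_def by simp
    qed
    then show "\<exists>D DD Dx. C2_Lip_b_derivs (restr_to_subalg M (Fil t)) (V t) D DD Dx \<and>
        (\<forall>\<mu>\<in>P2. \<forall>\<xi>\<in>borel_measurable M. law M \<xi> = \<mu> \<longrightarrow>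
           time_deriv V t \<mu> + 1/2 * (\<integral>\<omega>. trace (Dx \<mu> (\<xi> \<omega>)) \<partial>M) + F t (\<integral>\<omega>. D \<mu> (\<xi> \<omega>) \<partial>M) = 0)"
      using C2[OF t' t'] by blast
  next
    fix \<mu> :: "(real ^ 'n) measure" and \<xi> assume mu: "\<mu> \<in> P2" and xi: "\<xi> \<in> borel_measurable M" "law M \<xi> = \<mu>"
    have T: "T \<in> {0..T}" using T_pos by simp
    note I = implicit[OF T]
    \<comment> \<open>At the terminal time the Hamiltonian is integrated over a single point, so
      there is no shift, and \<open>heat 0\<close> is the identity.\<close>
    have H0: "H1 T p = 0" "H T p = 0" for p by (simp_all add: H_def H1_def)
    have z0: "pos T \<mu> = 0" unfolding implicit_momentum.pos_def[OF I] H0 ..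
    have "V T \<mu> = (\<integral>x. g x \<partial>\<mu>)"
      unfolding implicit_momentum.val_def[OF I] z0 H0 by (simp add: heat_0)
    also have "\<dots> = (\<integral>\<omega>. g (\<xi> \<omega>) \<partial>M)"
      unfolding xi(2)[symmetric] by (rule integral_law[OF xi(1) taylor2_measurable(1)[OF g]])
    finally show "V T \<mu> = (\<integral>\<omega>. g (\<xi> \<omega>) \<partial>M)" .
  qed
qed

end

section \<open>Bounded derivatives yield Taylor expansions\<close>

lemma linear_bound_from_Basis:
  fixes L :: "'a::euclidean_space \<Rightarrow> real"
  assumes "linear L" and b: "\<And>b. b \<in> Basis \<Longrightarrow> \<bar>L b\<bar> \<le> K"
  shows "\<bar>L v\<bar> \<le> real DIM('a) * K * norm v"
proof -
  interpret linear L by fact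
  have "L v = L (\<Sum>b\<in>Basis. (v \<bullet> b) *\<^sub>R b)" by (simp add: euclidean_representation)
  also have "\<dots> = (\<Sum>b\<in>Basis. (v \<bullet> b) * L b)" by (simp add: sum scale)
  finally have "\<bar>L v\<bar> \<le> (\<Sum>b\<in>Basis. \<bar>(v \<bullet> b) * L b\<bar>)" by (simp only: sum_abs)
  also have "\<dots> \<le> (\<Sum>b\<in>(Basis :: 'a set). norm v * K)"
    unfolding abs_mult by (intro sum_mono mult_mono b) (auto simp: Basis_le_norm)
  finally show ?thesis by (simp add: mult_ac)
qed

lemma lipschitz_from_partial_derivatives:
  fixes f :: "'a::euclidean_space \<Rightarrow> real"
  assumes S: "convex S" and D: "\<And>z. z \<in> S \<Longrightarrow> (f has_derivative D z) (at z within S)"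
    and b: "\<And>z h. z \<in> S \<Longrightarrow> h \<in> Basis \<Longrightarrow> \<bar>D z h\<bar> \<le> K" and zw: "z \<in> S" "w \<in> S"
  shows "\<bar>f z - f w\<bar> \<le> real DIM('a) * K * norm (z - w)"
proof -
  have "norm (f z - f w) \<le> real DIM('a) * K * norm (z - w)"
  proof (rule differentiable_bound[OF S D])
    fix x assume x: "x \<in> S"
    show "onorm (D x) \<le> real DIM('a) * K"
    proof (rule onorm_le)
      fix v show "norm (D x v) \<le> real DIM('a) * K * norm v"
        using linear_bound_from_Basis[OF has_derivative_linear[OF D[OF x]] b[OF x]] by simp
    qed
  qed (use zw in auto)
  then show ?thesis by simp
qed

text \<open>Why three orders: bounded third partial derivatives make the second ones Lipschitz, as
  \<open>taylor2\<close> requires. The predicate asserts second derivatives separately for each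
  basis direction h, so \<open>D2\<close> is assembled by choice.\<close>

lemma bounded_derivs_3E:
  fixes f :: "'a::euclidean_space \<Rightarrow> real"
  assumes S: "convex S" and bd: "bounded_derivs 3 K S f"
  obtains D D2 where
    "\<And>z. z \<in> S \<Longrightarrow> (f has_derivative D z) (at z within S)"
    "\<And>z h. z \<in> S \<Longrightarrow> h \<in> Basis \<Longrightarrow> ((\<lambda>z. D z h) has_derivative D2 h z) (at z within S)"
    "\<And>z h. z \<in> S \<Longrightarrow> h \<in> Basis \<Longrightarrow> \<bar>D z h\<bar> \<le> K"
    "\<And>z h k. z \<in> S \<Longrightarrow> h \<in> Basis \<Longrightarrow> k \<in> Basis \<Longrightarrow> \<bar>D2 h z k\<bar> \<le> K"
    "\<And>z w h k. z \<in> S \<Longrightarrow> w \<in> S \<Longrightarrow> h \<in> Basis \<Longrightarrow> k \<in> Basis \<Longrightarrow>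
      \<bar>D2 h z k - D2 h w k\<bar> \<le> real DIM('a) * K * norm (z - w)"
proof -
  have 3: "(3::nat) = Suc (Suc (Suc 0))" by simp
  obtain D where D: "\<And>z. z \<in> S \<Longrightarrow> (f has_derivative D z) (at z within S)"
    and D_le: "\<And>z h. z \<in> S \<Longrightarrow> h \<in> Basis \<Longrightarrow> \<bar>D z h\<bar> \<le> K"
    and bd2: "\<And>h. h \<in> Basis \<Longrightarrow> bounded_derivs (Suc (Suc 0)) K S (\<lambda>z. D z h)"
    using bd unfolding 3 by (subst (asm) bounded_derivs.simps) blast
  have "\<forall>h\<in>Basis. \<exists>E. (\<forall>z\<in>S. ((\<lambda>z. D z h) has_derivative E z) (at z within S)) \<and>
      (\<forall>k\<in>Basis. (\<forall>z\<in>S. \<bar>E z k\<bar> \<le> K) \<and> bounded_derivs (Suc 0) K S (\<lambda>z. E z k))"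
    using bd2 by (subst (asm) bounded_derivs.simps) blast
  then obtain D2 where D2: "\<forall>h\<in>Basis. (\<forall>z\<in>S. ((\<lambda>z. D z h) has_derivative D2 h z) (at z within S)) \<and>
      (\<forall>k\<in>Basis. (\<forall>z\<in>S. \<bar>D2 h z k\<bar> \<le> K) \<and> bounded_derivs (Suc 0) K S (\<lambda>z. D2 h z k))"
    unfolding bchoice_iff by blast
  have lip: "\<bar>D2 h z k - D2 h w k\<bar> \<le> real DIM('a) * K * norm (z - w)"
    if "z \<in> S" "w \<in> S" "h \<in> Basis" "k \<in> Basis" for z w h k
  proof -
    have "bounded_derivs (Suc 0) K S (\<lambda>z. D2 h z k)" using D2 that by blast
    then obtain D3 where "\<And>z. z \<in> S \<Longrightarrow> ((\<lambda>z. D2 h z k) has_derivative D3 z) (at z within S)"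
      "\<And>z l. z \<in> S \<Longrightarrow> l \<in> Basis \<Longrightarrow> \<bar>D3 z l\<bar> \<le> K"
      by (subst (asm) bounded_derivs.simps) blast
    from lipschitz_from_partial_derivatives[OF S this that(1,2)] show ?thesis .
  qed
  show thesis by (rule that[of D D2]) (use D D2 D_le lip in blast)+
qed

lemma norm_vec_le_card:
  fixes v :: "'b::real_normed_vector ^ 'n"
  assumes "\<And>i. norm (v $ i) \<le> c"
  shows "norm v \<le> real CARD('n) * c"
proof -
  have "norm v \<le> (\<Sum>i\<in>UNIV. norm (v $ i))" unfolding norm_vec_def by (rule L2_set_le_sum) simp
  also have "\<dots> \<le> (\<Sum>i\<in>(UNIV :: 'n set). c)" by (intro sum_mono assms)
  finally show ?thesis by simp
qed

lemma vec_linear_expansion: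
  fixes L :: "real ^ 'n \<Rightarrow> real"
  assumes "linear L"
  shows "L h = (\<chi> i. L (axis i 1)) \<bullet> h"
proof -
  interpret linear L by fact
  have "L h = L (\<Sum>i\<in>UNIV. (h $ i) *\<^sub>R axis i 1)"
    by (simp add: basis_expansion[of h, unfolded scalar_mult_eq_scaleR])
  also have "\<dots> = (\<Sum>i\<in>UNIV. h $ i * L (axis i 1))" by (simp add: sum scale)
  finally show ?thesis by (simp add: inner_vec_def mult.commute)
qed

text \<open>
  The affine map \<open>x \<mapsto> a + e x\<close> is the identity for the terminal datum and \<open>x \<mapsto> (t, x)\<close> for the
  Hamiltonian, so both cases are handled at once.
\<close>

lemma taylor2_from_partial_derivatives:
  fixes f :: "'a::euclidean_space \<Rightarrow> real" and e :: "real ^ 'n \<Rightarrow> 'a"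
  assumes D: "\<And>z. z \<in> S \<Longrightarrow> (f has_derivative D z) (at z within S)"
    and D2: "\<And>z h. z \<in> S \<Longrightarrow> h \<in> Basis \<Longrightarrow> ((\<lambda>z. D z h) has_derivative D2 h z) (at z within S)"
    and D_le: "\<And>z h. z \<in> S \<Longrightarrow> h \<in> Basis \<Longrightarrow> \<bar>D z h\<bar> \<le> K"
    and D2_le: "\<And>z h k. z \<in> S \<Longrightarrow> h \<in> Basis \<Longrightarrow> k \<in> Basis \<Longrightarrow> \<bar>D2 h z k\<bar> \<le> K"
    and D2_lip: "\<And>z w h k. z \<in> S \<Longrightarrow> w \<in> S \<Longrightarrow> h \<in> Basis \<Longrightarrow> k \<in> Basis \<Longrightarrow>
      \<bar>D2 h z k - D2 h w k\<bar> \<le> real DIM('a) * K * norm (z - w)"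
    and e: "bounded_linear e" "\<And>i. e (axis i 1) \<in> Basis" "\<And>x. norm (e x) = norm x" "\<And>x. a + e x \<in> S"
    and C: "real CARD('n) * real CARD('n) * (real DIM('a) * K) \<le> C"
  shows "taylor2 C (\<lambda>x. f (a + e x)) (\<lambda>x. \<chi> i. D (a + e x) (e (axis i 1)))
      (\<lambda>x. \<chi> i j. D2 (e (axis i 1)) (a + e x) (e (axis j 1)))"
proof -
  let ?n = "real CARD('n)" and ?d = "real DIM('a)"
  have K: "0 \<le> K" using D_le[OF e(4) e(2)] abs_ge_zero order_trans by blast
  have n: "1 \<le> ?n" "1 \<le> ?d" by (simp_all add: DIM_ge_Suc0 Suc_leI)
  have Kd: "K \<le> ?d * K" using mult_right_mono[OF n(2) K] by simp
  have C2: "?n * (?n * K) \<le> C"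
    using order_trans[OF mult_left_mono[OF mult_left_mono[OF Kd]] C[unfolded mult.assoc]] by simp
  have "?n * K \<le> ?n * (?n * K)" using mult_right_mono[OF n(1) K] by (intro mult_left_mono) auto
  then have C1: "?n * K \<le> C" using C2 by linarith
  \<comment> \<open>The affine map takes all its values in S, so a derivative within S, a set that
    need not be open, becomes a full derivative in x.\<close>
  have comp: "((\<lambda>x. \<phi> (a + e x)) has_derivative (\<lambda>h. \<phi>' (e h))) (at x)"
    if "(\<phi> has_derivative \<phi>') (at (a + e x) within S)" for \<phi> \<phi>' x
  proof -
    have r: "range (\<lambda>x. a + e x) \<subseteq> S" using e(4) by auto
    have "((\<lambda>x. a + e x) has_derivative e) (at x)"
      using bounded_linear_imp_has_derivative[OF e(1), of "at x"] by (auto intro!: derivative_eq_intros)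
    from has_derivative_in_compose[OF this has_derivative_subset[OF that r]] show ?thesis .
  qed
  have lin: "linear (\<lambda>h. \<phi>' (e h))" if "linear \<phi>'" for \<phi>' :: "'a \<Rightarrow> real"
    using linear_compose[OF bounded_linear.linear[OF e(1)] that] by (simp add: comp_def)
  show ?thesis
  proof (rule taylor2I)
    fix x y :: "real ^ 'n"
    show "((\<lambda>x. f (a + e x)) has_derivative (\<lambda>h. (\<chi> i. D (a + e x) (e (axis i 1))) \<bullet> h)) (at x)"
      by (rule has_derivative_eq_rhs[OF comp[OF D[OF e(4)]]])
        (rule ext, rule vec_linear_expansion[OF lin[OF has_derivative_linear[OF D[OF e(4)]]]])
    have "((\<lambda>x. D (a + e x) (e (axis i 1))) has_derivative
        (\<lambda>h. (\<chi> j. D2 (e (axis i 1)) (a + e x) (e (axis j 1))) \<bullet> h)) (at x)" for i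
      by (rule has_derivative_eq_rhs[OF comp[OF D2[OF e(4) e(2)]]])
        (rule ext, rule vec_linear_expansion[OF lin[OF has_derivative_linear[OF D2[OF e(4) e(2)]]]])
    then show "((\<lambda>x. \<chi> i. D (a + e x) (e (axis i 1))) has_derivative
        (\<lambda>h. (\<chi> i j. D2 (e (axis i 1)) (a + e x) (e (axis j 1))) *v h)) (at x)"
      by (subst has_derivative_componentwise_within)
        (auto simp: Basis_vec_def inner_axis matrix_vector_mul_component)
    show "norm (\<chi> i. D (a + e x) (e (axis i 1))) \<le> C"
      by (rule order_trans[OF norm_vec_le_card C1]) (use D_le[OF e(4) e(2)] in simp)
    show "norm (\<chi> i j. D2 (e (axis i 1)) (a + e x) (e (axis j 1))) \<le> C"
      by (rule order_trans[OF norm_vec_le_card[OF norm_vec_le_card] C2])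
        (use D2_le[OF e(4) e(2) e(2)] in simp)
    have dist: "norm (e x - e y) = norm (x - y)"
      using e(3)[of "x - y"] by (simp add: linear_diff[OF bounded_linear.linear[OF e(1)]])
    \<comment> \<open>This estimate fixes the size of C: a factor n for each index of the Hessian,
      and the Lipschitz constant of a single entry.\<close>
    have "norm ((\<chi> i j. D2 (e (axis i 1)) (a + e x) (e (axis j 1))) - (\<chi> i j. D2 (e (axis i 1)) (a + e y) (e (axis j 1))))
        \<le> ?n * (?n * (?d * K * norm (x - y)))"
      by (rule norm_vec_le_card[OF norm_vec_le_card])
        (use D2_lip[OF e(4) e(4) e(2) e(2), of _ x _ y] in \<open>simp add: dist\<close>)
    also have "\<dots> = (?n * ?n * (?d * K)) * norm (x - y)" by simp
    also have "\<dots> \<le> C * norm (x - y)" by (intro mult_right_mono C) simp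
    finally show "norm ((\<chi> i j. D2 (e (axis i 1)) (a + e x) (e (axis j 1))) - (\<chi> i j. D2 (e (axis i 1)) (a + e y) (e (axis j 1))))
        \<le> C * norm (x - y)" .
  qed
qed

lemma bounded_derivs_imp_taylor2:
  fixes g :: "real ^ 'n \<Rightarrow> real"
  assumes "bounded_derivs 3 K UNIV g" and C: "real CARD('n) * real CARD('n) * (real CARD('n) * K) \<le> C"
  obtains g1 g2 where "taylor2 C g g1 g2"
proof -
  obtain D D2 where D: "\<And>z. z \<in> UNIV \<Longrightarrow> (g has_derivative D z) (at z within UNIV)"
    "\<And>z h. z \<in> UNIV \<Longrightarrow> h \<in> Basis \<Longrightarrow> ((\<lambda>z. D z h) has_derivative D2 h z) (at z within UNIV)"
    "\<And>z h. z \<in> UNIV \<Longrightarrow> h \<in> Basis \<Longrightarrow> \<bar>D z h\<bar> \<le> K"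
    "\<And>z h k. z \<in> UNIV \<Longrightarrow> h \<in> Basis \<Longrightarrow> k \<in> Basis \<Longrightarrow> \<bar>D2 h z k\<bar> \<le> K"
    "\<And>z w h k. z \<in> UNIV \<Longrightarrow> w \<in> UNIV \<Longrightarrow> h \<in> Basis \<Longrightarrow> k \<in> Basis \<Longrightarrow>
      \<bar>D2 h z k - D2 h w k\<bar> \<le> real DIM(real ^ 'n) * K * norm (z - w)"
    by (rule bounded_derivs_3E[OF convex_UNIV assms(1)]) (rule that)
  have "taylor2 C (\<lambda>x. g (0 + x)) (\<lambda>x. \<chi> i. D (0 + x) (axis i 1))
      (\<lambda>x. \<chi> i j. D2 (axis i 1) (0 + x) (axis j 1))"
  proof (rule taylor2_from_partial_derivatives[OF D, where e="\<lambda>x. x"])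
    show "real CARD('n) * real CARD('n) * (real DIM(real ^ 'n) * K) \<le> C" using C by simp
  qed (simp_all add: axis_in_Basis_iff)
  then show thesis using that by simp
qed

lemma bounded_derivs_imp_taylor2_time:
  fixes F :: "real \<Rightarrow> real ^ 'n \<Rightarrow> real"
  assumes bd: "bounded_derivs 3 K ({0..T} \<times> UNIV) (\<lambda>(t, x). F t x)"
    and C: "real CARD('n) * real CARD('n) * ((real CARD('n) + 1) * K) \<le> C" and T: "0 \<le> T"
  obtains F1 F2 where "\<And>t. t \<in> {0..T} \<Longrightarrow> taylor2 C (F t) (F1 t) (F2 t)"
    "\<And>s t x. s \<in> {0..T} \<Longrightarrow> t \<in> {0..T} \<Longrightarrow> \<bar>F s x - F t x\<bar> \<le> C * \<bar>s - t\<bar>"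
    "\<And>x. continuous_on {0..T} (\<lambda>t. F1 t x)" "\<And>x. continuous_on {0..T} (\<lambda>t. F2 t x)"
proof -
  let ?S = "{0..T} \<times> (UNIV :: (real ^ 'n) set)"
  let ?n = "real CARD('n)" and ?d = "real CARD('n) + 1"
  have dim: "real DIM(real \<times> (real ^ 'n)) = ?d" by simp
  have S: "convex ?S" by (intro convex_Times convex_real_interval convex_UNIV)
  obtain D D2 where D: "\<And>z. z \<in> ?S \<Longrightarrow> ((\<lambda>(t, x). F t x) has_derivative D z) (at z within ?S)"
    "\<And>z h. z \<in> ?S \<Longrightarrow> h \<in> Basis \<Longrightarrow> ((\<lambda>z. D z h) has_derivative D2 h z) (at z within ?S)"
    "\<And>z h. z \<in> ?S \<Longrightarrow> h \<in> Basis \<Longrightarrow> \<bar>D z h\<bar> \<le> K"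
    "\<And>z h k. z \<in> ?S \<Longrightarrow> h \<in> Basis \<Longrightarrow> k \<in> Basis \<Longrightarrow> \<bar>D2 h z k\<bar> \<le> K"
    "\<And>z w h k. z \<in> ?S \<Longrightarrow> w \<in> ?S \<Longrightarrow> h \<in> Basis \<Longrightarrow> k \<in> Basis \<Longrightarrow>
      \<bar>D2 h z k - D2 h w k\<bar> \<le> real DIM(real \<times> (real ^ 'n)) * K * norm (z - w)"
    by (rule bounded_derivs_3E[OF S bd]) (rule that)
  have ax: "(0, axis i 1 :: real ^ 'n) \<in> Basis" for i by (simp add: Basis_prod_def axis_in_Basis_iff)
  have "(0, 0) \<in> ?S" using T by simp
  from order_trans[OF abs_ge_zero D(3)[OF this ax]] have K: "0 \<le> K" .
  have nC: "?d * K \<le> C"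
  proof -
    have "1 * (?d * K) \<le> (?n * ?n) * (?d * K)"
      using K by (intro mult_right_mono) (auto simp: mult_ge1_I Suc_leI)
    from order_trans[OF this C] show ?thesis by simp
  qed
  have timedist: "norm ((s, x) - (t, x)) = \<bar>s - t\<bar>" for s t and x :: "real ^ 'n" by (simp add: norm_Pair)
  show thesis
  proof (rule that)
    show "taylor2 C (F t) (\<lambda>x. \<chi> i. D (t, x) (0, axis i 1)) (\<lambda>x. \<chi> i j. D2 (0, axis i 1) (t, x) (0, axis j 1))"
      if t: "t \<in> {0..T}" for t
    proof -
      have "taylor2 C (\<lambda>x. (\<lambda>(t, x). F t x) ((t, 0) + (0, x))) (\<lambda>x. \<chi> i. D ((t, 0) + (0, x)) (0, axis i 1))
          (\<lambda>x. \<chi> i j. D2 (0, axis i 1) ((t, 0) + (0, x)) (0, axis j 1))"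
        by (rule taylor2_from_partial_derivatives[OF D, where e="\<lambda>x. (0, x)"])
          (use C t ax in \<open>auto simp: norm_Pair dim add.commute[of 1 "real CARD('n)"] intro: bounded_linear_Pair bounded_linear_zero bounded_linear_ident\<close>)
      then show ?thesis by simp
    qed
    show "\<bar>F s x - F t x\<bar> \<le> C * \<bar>s - t\<bar>" if "s \<in> {0..T}" "t \<in> {0..T}" for s t x
    proof -
      have "\<bar>F s x - F t x\<bar> \<le> ?d * K * \<bar>s - t\<bar>"
        using lipschitz_from_partial_derivatives[OF S D(1,3), of "(s, x)" "(t, x)"] that
        unfolding dim timedist by simp
      also have "\<dots> \<le> C * \<bar>s - t\<bar>" by (intro mult_right_mono nC) simp
      finally show ?thesis .
    qed
    have c1: "continuous_on ?S (\<lambda>z. D z h)" if "h \<in> Basis" for h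
      using has_derivative_continuous_on[OF D(2)[OF _ that]] by blast
    have c2: "continuous_on ?S (\<lambda>z. D2 h z k)" if "h \<in> Basis" "k \<in> Basis" for h k
      by (rule lipschitz_on_continuous_on[of "?d * K"], rule lipschitz_onI)
        (use D(5)[OF _ _ that] K in \<open>auto simp: dist_norm dim add.commute[of 1 "real CARD('n)"]\<close>)
    have slice: "continuous_on {0..T} (\<lambda>t. \<phi> (t, x))"
      if "continuous_on ?S \<phi>" for \<phi> :: "real \<times> (real ^ 'n) \<Rightarrow> real" and x
      by (rule continuous_on_compose2[OF that]) (auto intro!: continuous_intros)
    show "continuous_on {0..T} (\<lambda>t. \<chi> i. D (t, x) (0, axis i 1))" for x
      by (intro continuous_on_vec_lambda slice[OF c1[OF ax]])
    show "continuous_on {0..T} (\<lambda>t. \<chi> i j. D2 (0, axis i 1) (t, x) (0, axis j 1))" for x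
      by (intro continuous_on_vec_lambda slice[OF c2[OF ax ax]])
  qed
qed

section \<open>Stability of the momentum equation\<close>

lemma dxx_eq_second_derivative:
  fixes f :: "real ^ 'n \<Rightarrow> real"
  assumes t: "taylor2 C f f1 f2"
  shows "dxx f x = vec 1 \<bullet> (f2 x *v vec 1)"
proof -
  let ?v = "vec 1 :: real ^ 'n"
  have line: "((\<lambda>s. x + vec s) has_derivative (\<lambda>r. r *\<^sub>R ?v)) (at s)" for s
  proof -
    have "(\<lambda>s. x + vec s) = (\<lambda>s. x + s *\<^sub>R ?v)" by (simp add: fun_eq_iff vec_eq_iff)
    then show ?thesis by (auto intro!: derivative_eq_intros)
  qed
  have "((\<lambda>s. f (x + vec s)) has_real_derivative f1 (x + vec s) \<bullet> ?v) (at s)" for s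
    using has_derivative_compose[OF line taylor2_has_derivative(1)[OF t]]
    by (simp add: has_field_derivative_def mult.commute[of _ "_ \<bullet> _"])
  then have 1: "deriv (\<lambda>s. f (x + vec s)) = (\<lambda>s. f1 (x + vec s) \<bullet> ?v)"
    using DERIV_imp_deriv by blast
  have "((\<lambda>s. f1 (x + vec s) \<bullet> ?v) has_real_derivative (f2 (x + vec s) *v ?v) \<bullet> ?v) (at s)" for s
    using has_derivative_inner_left[OF has_derivative_compose[OF line taylor2_has_derivative(2)[OF t]], of ?v]
    by (simp add: has_field_derivative_def matrix_vector_mult_scaleR mult.commute[of _ "_ \<bullet> _"])
  from DERIV_imp_deriv[OF this[of 0]] show ?thesis
    unfolding dxx_def by (simp add: eval_nat_numeral 1 inner_commute)
qed

text \<open>In dimension one every difference x - y is a multiple of \<open>vec 1\<close>, so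
  \<open>dxx\<close> decides the sign of the quadratic form of the Hessian along the segment. The
  sign \<open>\<sigma>\<close> handles convex and concave functions together.\<close>

lemma gradient_monotone_dim1:
  fixes f :: "real ^ 'n \<Rightarrow> real"
  assumes t: "taylor2 C f f1 f2" and one: "CARD('n) = 1" and sgn: "\<And>x. 0 \<le> \<sigma> * dxx f x"
  shows "0 \<le> \<sigma> * ((f1 x - f1 y) \<bullet> (x - y))"
proof -
  obtain i where i: "(UNIV :: 'n set) = {i}" using one by (meson card_1_singletonE)
  define a where "a = (x - y) $ i"
  have v: "x - y = a *\<^sub>R vec 1" unfolding vec_eq_iff a_def using i by (metis UNIV_I mult.right_neutral real_scaleR_def singletonD vec_component vector_scaleR_component)
  define \<phi> where "\<phi> s = \<sigma> * (f1 (y + s *\<^sub>R (x - y)) \<bullet> (x - y))" for s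
  have d\<phi>: "(\<phi> has_real_derivative \<sigma> * ((f2 (y + s *\<^sub>R (x - y)) *v (x - y)) \<bullet> (x - y))) (at s)" for s
  proof -
    have line: "((\<lambda>s. y + s *\<^sub>R (x - y)) has_derivative (\<lambda>r. r *\<^sub>R (x - y))) (at s)"
      by (auto intro!: derivative_eq_intros)
    have "((\<lambda>s. f1 (y + s *\<^sub>R (x - y)) \<bullet> (x - y)) has_real_derivative (f2 (y + s *\<^sub>R (x - y)) *v (x - y)) \<bullet> (x - y)) (at s)"
      using has_derivative_inner_left[OF has_derivative_compose[OF line taylor2_has_derivative(2)[OF t]], of "x - y"]
      by (simp add: has_field_derivative_def matrix_vector_mult_scaleR mult.commute[of _ "_ \<bullet> _"])
    from DERIV_cmult[OF this] show ?thesis unfolding \<phi>_def .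
  qed
  have nn: "0 \<le> \<sigma> * ((f2 z *v (x - y)) \<bullet> (x - y))" for z
  proof -
    have eq: "\<sigma> * ((f2 z *v (x - y)) \<bullet> (x - y)) = (a * a) * (\<sigma> * dxx f z)"
      unfolding v dxx_eq_second_derivative[OF t] by (simp add: matrix_vector_mult_scaleR inner_commute)
    show ?thesis unfolding eq by (rule mult_nonneg_nonneg[OF zero_le_square sgn])
  qed
  have "\<phi> 0 \<le> \<phi> 1"
    by (rule DERIV_nonneg_imp_nondecreasing[OF zero_le_one], intro exI conjI, rule d\<phi>, rule nn)
  then show ?thesis by (simp add: \<phi>_def inner_diff_left right_diff_distrib)
qed

text \<open>Monotonicity is linear in the function, and the averaged variable drops out of the
  difference of arguments. It is used for the Gaussian average in the heat flow and then for the
  average over \<open>\<mu>\<close>.\<close>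

lemma average_monotone:
  fixes f1 :: "real ^ 'n \<Rightarrow> real ^ 'n"
  assumes mono: "\<And>x y. 0 \<le> \<sigma> * ((f1 x - f1 y) \<bullet> (x - y))" and mu: "\<mu> \<in> P2"
    and lip: "\<And>x y. norm (f1 x - f1 y) \<le> C * norm (x - y)"
  shows "0 \<le> \<sigma> * (((\<integral>x. f1 (x + z) \<partial>\<mu>) - (\<integral>x. f1 (x + z') \<partial>\<mu>)) \<bullet> (z - z'))"
proof -
  interpret prob_space \<mu> by (rule P2D(1)[OF mu])
  have i: "integrable \<mu> (\<lambda>x. f1 (x + z))" for z
    by (rule lipschitz_integrable[OF prob_space_axioms L2_add[OF P2_id_in_L2(1)[OF mu] L2_const] lip])
  have "0 \<le> (\<integral>x. \<sigma> * ((f1 (x + z) - f1 (x + z')) \<bullet> (z - z')) \<partial>\<mu>)"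
    using mono[of "x + z" "x + z'" for x] by (intro Bochner_Integration.integral_nonneg) simp
  also have "\<dots> = \<sigma> * (((\<integral>x. f1 (x + z) \<partial>\<mu>) - (\<integral>x. f1 (x + z') \<partial>\<mu>)) \<bullet> (z - z'))"
    using i by simp
  finally show ?thesis .
qed

lemma inner_dim1:
  fixes x y :: "real ^ 'n"
  assumes "(UNIV :: 'n set) = {i}"
  shows "x \<bullet> y = x $ i * y $ i"
  unfolding inner_vec_def assms by simp

context smooth_data
begin

lemma C_nonneg: "0 \<le> C"
  using C_ge_1 by simp

lemma heat_g1_lipschitz: "norm (heat s g1 x - heat s g1 y) \<le> C * norm (x - y)"
  by (rule taylor2D(4)[OF heat_taylor2[OF g]])

text \<open>The averaged gradient is C-Lipschitz and \<open>H1 t\<close> has Lipschitz constant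
  \<open>C * (T - t)\<close>, so the fixed point map is a contraction with constant 1/2.\<close>

lemma stable_small_time:
  assumes small: "C * (C * T) \<le> 1 / 2" and t: "t \<in> {0..T}" and mu: "\<mu> \<in> P2"
  shows "norm (p - q) \<le> 2 * norm ((p - (\<integral>x. heat (T - t) g1 (x + H1 t p) \<partial>\<mu>))
    - (q - (\<integral>x. heat (T - t) g1 (x + H1 t q) \<partial>\<mu>)))"
proof -
  let ?G = "\<lambda>p. \<integral>x. heat (T - t) g1 (x + H1 t p) \<partial>\<mu>"
  have "norm (?G p - ?G q) \<le> C * norm (H1 t p - H1 t q)"
    by (rule taylor2D(4)[OF taylor2_average[OF mu heat_taylor2[OF g]]])
  also have "\<dots> \<le> C * (C * (T - t) * norm (p - q))"
    by (intro mult_left_mono taylor2D(4)[OF H_taylor2_small[OF t]] C_nonneg)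
  also have "\<dots> = C * (C * (T - t)) * norm (p - q)" by simp
  also have "\<dots> \<le> 1 / 2 * norm (p - q)"
    using t C_nonneg by (intro mult_right_mono order_trans[OF mult_left_mono[OF mult_left_mono] small]) auto
  finally have "norm (?G p - ?G q) \<le> norm (p - q) / 2" by simp
  moreover have "norm (p - q) \<le> norm ((p - ?G p) - (q - ?G q)) + norm (?G p - ?G q)"
    using norm_triangle_ineq[of "(p - ?G p) - (q - ?G q)" "?G p - ?G q"] by simp
  ultimately show ?thesis by simp
qed

text \<open>The averaged gradient and \<open>H1 t\<close> are monotone in opposite senses. On the
  line this makes their composition nonincreasing; in higher dimension the signs of the inner
  products of dG with dH and of dH with d would not determine that of dG with d.\<close>

lemma stable_monotone_dim1:
  assumes one: "CARD('n) = 1" and \<sigma>: "\<sigma> \<noteq> 0"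
    and g_sgn: "\<And>x. 0 \<le> \<sigma> * dxx g x" and F_sgn: "\<And>t x. t \<in> {0..T} \<Longrightarrow> \<sigma> * dxx (F t) x \<le> 0"
    and t: "t \<in> {0..T}" and mu: "\<mu> \<in> P2"
  shows "norm (p - q) \<le> 2 * norm ((p - (\<integral>x. heat (T - t) g1 (x + H1 t p) \<partial>\<mu>))
    - (q - (\<integral>x. heat (T - t) g1 (x + H1 t q) \<partial>\<mu>)))"
proof -
  let ?G = "\<lambda>z. \<integral>x. heat (T - t) g1 (x + z) \<partial>\<mu>"
  define dG dH d where "dG = ?G (H1 t p) - ?G (H1 t q)" and "dH = H1 t p - H1 t q" and "d = p - q"
  obtain i where i: "(UNIV :: 'n set) = {i}" using one by (meson card_1_singletonE)
  have law: "law gauss (\<lambda>y :: real ^ 'n. sqrt s *\<^sub>R y) \<in> P2" for s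
    by (intro law_in_P2 prob_space_gauss L2_scaleR gauss_norm_integrable(5))
  have "0 \<le> \<sigma> * ((heat s g1 x - heat s g1 y) \<bullet> (x - y))" for s x y
    unfolding heat_eq_law_integral[OF taylor2_measurable(2)[OF g]]
    by (rule average_monotone[OF gradient_monotone_dim1[OF g one g_sgn] law taylor2D(4)[OF g]])
  then have GH: "0 \<le> \<sigma> * (dG \<bullet> dH)"
    unfolding dG_def dH_def by (rule average_monotone[OF _ mu heat_g1_lipschitz])
  have Hd: "0 \<le> (- \<sigma>) * (dH \<bullet> d)"
  proof -
    have sub: "{t..T} \<subseteq> {0..T}" using t by auto
    have i1: "(\<lambda>s. F1 s x) integrable_on {t..T}" for x
      by (intro integrable_continuous_real continuous_on_subset[OF F1_cont sub])
    have "dH = integral {t..T} (\<lambda>s. F1 s p - F1 s q)"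
      unfolding dH_def H1_def using i1 by (simp add: Henstock_Kurzweil_Integration.integral_diff)
    then have "(- \<sigma>) * (dH \<bullet> d) = integral {t..T} (\<lambda>s. (- \<sigma>) * ((F1 s p - F1 s q) \<bullet> d))"
      using integral_linear[OF integrable_diff[OF i1[of p] i1[of q]] bounded_linear_inner_left[of d]]
      by (simp add: comp_def)
    also have "0 \<le> \<dots>"
    proof (rule Henstock_Kurzweil_Integration.integral_nonneg)
      show "(\<lambda>s. (- \<sigma>) * ((F1 s p - F1 s q) \<bullet> d)) integrable_on {t..T}"
        by (intro integrable_continuous_real continuous_intros continuous_on_subset[OF F1_cont sub])
      fix s assume "s \<in> {t..T}"
      then have s: "s \<in> {0..T}" using sub by auto
      show "0 \<le> (- \<sigma>) * ((F1 s p - F1 s q) \<bullet> d)"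
        unfolding d_def using F_sgn[OF s] by (intro gradient_monotone_dim1[OF F[OF s] one]) simp
    qed
    finally show ?thesis .
  qed
  have "dG \<bullet> d \<le> 0"
  proof (cases "dH = 0")
    case True
    then show ?thesis by (simp add: dG_def dH_def)
  next
    case False
    then have h: "dH $ i \<noteq> 0" using i by (metis UNIV_I singletonD vec_eq_iff zero_index)
    \<comment> \<open>Multiplying both sign conditions produces the positive factor
      \<open>\<sigma>\<^sup>2 * (dH $ i)\<^sup>2\<close>, which can be cancelled as dH is not
      zero.\<close>
    have "0 \<le> (\<sigma> * (dG $ i * dH $ i)) * ((- \<sigma>) * (dH $ i * d $ i))"
      using mult_nonneg_nonneg[OF GH Hd] unfolding inner_dim1[OF i] .
    then have "(\<sigma>\<^sup>2 * (dH $ i)\<^sup>2) * (dG $ i * d $ i) \<le> 0" by (simp add: power2_eq_square algebra_simps)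
    moreover have "0 < \<sigma>\<^sup>2 * (dH $ i)\<^sup>2" using h \<sigma> by simp
    ultimately show ?thesis unfolding inner_dim1[OF i] by (meson mult_pos_pos not_less)
  qed
  \<comment> \<open>Subtracting a vector at an obtuse angle to d does not shorten d; this gives
    stability with constant 1, weakened to 2 at the end.\<close>
  then have "norm d * norm d \<le> (d - dG) \<bullet> d"
    by (simp add: inner_diff_left power2_norm_eq_inner[symmetric] power2_eq_square[symmetric])
  also have "\<dots> \<le> norm (d - dG) * norm d" by (rule norm_cauchy_schwarz)
  finally have n: "norm d \<le> norm (d - dG)" by (cases "d = 0") auto
  have dd: "d - dG = (p - ?G (H1 t p)) - (q - ?G (H1 t q))" by (simp add: d_def dG_def)
  show ?thesis unfolding dd[symmetric] d_def[symmetric] using n norm_ge_zero[of "d - dG"] by linarith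
qed

end

theorem theorem3p1:
  "\<exists>N::nat. \<forall>K::real. \<exists>\<delta>>0.
     \<forall>(M :: 'w measure) (Fil :: real \<Rightarrow> 'w measure) (T :: real)
        (F :: real \<Rightarrow> real ^ 'n \<Rightarrow> real) (g :: real ^ 'n \<Rightarrow> real).
       0 < T \<longrightarrow>
       filtered_prob_space M Fil T \<longrightarrow>
       (\<forall>\<mu>\<in>(P2 :: (real ^ 'n) measure set). \<exists>\<xi>\<in>borel_measurable (Fil 0). law M \<xi> = \<mu>) \<longrightarrow>
       bounded_derivs N K ({0..T} \<times> UNIV) (\<lambda>(t, x). F t x) \<longrightarrow>
       bounded_derivs N K UNIV g \<longrightarrow>
       (T \<le> \<delta> \<or>
        CARD('n) = 1 \<and>
        ((\<forall>x. dxx g x > 0) \<and> (\<forall>t\<in>{0..T}. \<forall>x. dxx (F t) x < 0) \<or>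
         (\<forall>x. dxx g x < 0) \<and> (\<forall>t\<in>{0..T}. \<forall>x. dxx (F t) x > 0))) \<longrightarrow>
       (\<exists>V. V \<in> C12 M Fil T \<and> solves_master_equation M Fil T F g V)"
proof (rule exI[where x="3 :: nat"], rule allI)
  fix K :: real
  \<comment> \<open>A common constant for both data: dimension n + 1 includes time,
    \<open>\<bar>K\<bar>\<close> keeps the products monotone for any K, and the locales require at
    least 1.\<close>
  define C where "C = max 1 (real CARD('n) * real CARD('n) * ((real CARD('n) + 1) * \<bar>K\<bar>))"
  have C: "1 \<le> C" "real CARD('n) * real CARD('n) * ((real CARD('n) + 1) * K) \<le> C"
    "real CARD('n) * real CARD('n) * (real CARD('n) * K) \<le> C"
  proof -
    show "1 \<le> C" by (simp add: C_def)
    have "real CARD('n) * real CARD('n) * ((real CARD('n) + 1) * K)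
        \<le> real CARD('n) * real CARD('n) * ((real CARD('n) + 1) * \<bar>K\<bar>)"
      by (intro mult_left_mono) auto
    then show "real CARD('n) * real CARD('n) * ((real CARD('n) + 1) * K) \<le> C" unfolding C_def by linarith
    have "real CARD('n) * real CARD('n) * (real CARD('n) * K)
        \<le> real CARD('n) * real CARD('n) * ((real CARD('n) + 1) * \<bar>K\<bar>)"
    proof (intro mult_left_mono)
      have "real CARD('n) * K \<le> real CARD('n) * \<bar>K\<bar>" by (intro mult_left_mono) auto
      then show "real CARD('n) * K \<le> (real CARD('n) + 1) * \<bar>K\<bar>" 
        using abs_ge_zero[of K] unfolding distrib_right by linarith
    qed auto
    then show "real CARD('n) * real CARD('n) * (real CARD('n) * K) \<le> C" unfolding C_def by linarith
  qed
  show "\<exists>\<delta>>0.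
     \<forall>(M :: 'w measure) (Fil :: real \<Rightarrow> 'w measure) (T :: real)
        (F :: real \<Rightarrow> real ^ 'n \<Rightarrow> real) (g :: real ^ 'n \<Rightarrow> real).
       0 < T \<longrightarrow>
       filtered_prob_space M Fil T \<longrightarrow>
       (\<forall>\<mu>\<in>(P2 :: (real ^ 'n) measure set). \<exists>\<xi>\<in>borel_measurable (Fil 0). law M \<xi> = \<mu>) \<longrightarrow>
       bounded_derivs 3 K ({0..T} \<times> UNIV) (\<lambda>(t, x). F t x) \<longrightarrow>
       bounded_derivs 3 K UNIV g \<longrightarrow>
       (T \<le> \<delta> \<or>
        CARD('n) = 1 \<and>
        ((\<forall>x. dxx g x > 0) \<and> (\<forall>t\<in>{0..T}. \<forall>x. dxx (F t) x < 0) \<or>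
         (\<forall>x. dxx g x < 0) \<and> (\<forall>t\<in>{0..T}. \<forall>x. dxx (F t) x > 0))) \<longrightarrow>
       (\<exists>V. V \<in> C12 M Fil T \<and> solves_master_equation M Fil T F g V)"
  proof (intro exI[of _ "1 / (2 * (C * C))"] conjI allI impI)
    \<comment> \<open>The bound on T is the one for which \<open>C * (C * T) \<le> 1 / 2\<close>; it
      depends on K and the dimension only.\<close>
    show "0 < 1 / (2 * (C * C))" using C(1) by simp
    fix M :: "'w measure" and Fil :: "real \<Rightarrow> 'w measure" and T :: real
      and F :: "real \<Rightarrow> real ^ 'n \<Rightarrow> real" and g :: "real ^ 'n \<Rightarrow> real"
    assume T: "0 < T" and fil: "filtered_prob_space M Fil T"
      and bF: "bounded_derivs 3 K ({0..T} \<times> UNIV) (\<lambda>(t, x). F t x)" and bg: "bounded_derivs 3 K UNIV g"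
      and cond: "T \<le> 1 / (2 * (C * C)) \<or>
        CARD('n) = 1 \<and>
        ((\<forall>x. dxx g x > 0) \<and> (\<forall>t\<in>{0..T}. \<forall>x. dxx (F t) x < 0) \<or>
         (\<forall>x. dxx g x < 0) \<and> (\<forall>t\<in>{0..T}. \<forall>x. dxx (F t) x > 0))"
    obtain g1 g2 where g: "taylor2 C g g1 g2"
      by (rule bounded_derivs_imp_taylor2[OF bg C(3)])
    obtain F1 F2 where F: "\<And>t. t \<in> {0..T} \<Longrightarrow> taylor2 C (F t) (F1 t) (F2 t)"
      "\<And>s t x. s \<in> {0..T} \<Longrightarrow> t \<in> {0..T} \<Longrightarrow> \<bar>F s x - F t x\<bar> \<le> C * \<bar>s - t\<bar>"
      "\<And>x. continuous_on {0..T} (\<lambda>t. F1 t x)" "\<And>x. continuous_on {0..T} (\<lambda>t. F2 t x)"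
      using T by (rule bounded_derivs_imp_taylor2_time[OF bF C(2) less_imp_le]) (rule that)
    interpret smooth_data C T F F1 F2 g g1 g2
      by unfold_locales (use T C(1) g F in auto)
    interpret master_data C T F F1 F2 g g1 g2
    proof
      fix t \<mu> p q assume t: "t \<in> {0..T}" and mu: "\<mu> \<in> (P2 :: (real ^ 'n) measure set)"
      from cond consider "T \<le> 1 / (2 * (C * C))"
        | "CARD('n) = 1" "\<forall>x. dxx g x > 0" "\<forall>t\<in>{0..T}. \<forall>x. dxx (F t) x < 0"
        | "CARD('n) = 1" "\<forall>x. dxx g x < 0" "\<forall>t\<in>{0..T}. \<forall>x. dxx (F t) x > 0"
        by blast
      then show "norm (p - q) \<le> 2 * norm ((p - (\<integral>x. heat (T - t) g1 (x + H1 t p) \<partial>\<mu>))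
        - (q - (\<integral>x. heat (T - t) g1 (x + H1 t q) \<partial>\<mu>)))"
      proof cases
        case 1
        then have "C * (C * T) \<le> 1 / 2" using C(1) by (simp add: field_simps)
        then show ?thesis by (rule stable_small_time[OF _ t mu])
      next
        case 2
        then show ?thesis
          by (intro stable_monotone_dim1[of 1] t mu) (auto intro: less_imp_le)
      next
        case 3
        then show ?thesis
          by (intro stable_monotone_dim1[of "-1"] t mu) (auto intro: less_imp_le)
      qed
    qed
    show "\<exists>V. V \<in> C12 M Fil T \<and> solves_master_equation M Fil T F g V"
      using V_classical_solution[OF fil] by blast
  qed
qed

end
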